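(* Let $\gamma>0$, $M>0$, $0<\alpha<1$, $\delta>1/2$, and $H=H(\delta)$. Let $\Pi$ be the law on $L^2$ of the random series $$U_{\gamma,M}=\sum_{l\ge J_0-1}\sum_{k=0}^{2^l-1}2^{-l(\gamma+1/2)}u_{lk}\psi_{lk},$$ where the $u_{lk}$ are i.i.d. uniform on $[-M,M]$ and $\{\psi_{lk}\}$ is an $S$-regular Cohen--Daubechies--Vial wavelet basis of $L^2$, $S>\max(\gamma,1/2)$. Consider observations $\mathbb X^{(n)}=f_0+n^{-1/2}\mathbb W\sim P_{f_0}^n$ for a fixed $f_0\in C^\gamma$ with $\|f_0\|_{\gamma,\infty}<M$. Let $\Pi(\cdot\mid\mathbb X^{(n)})$ be the posterior distribution, $\bar f_n$ its mean, let $R_n$ be such that $\Pi(f:\|f-\bar f_n\|_H\le R_n/\sqrt n\mid\mathbb X^{(n)})=1-\alpha$, and let $$C_n'=\{f:\ \|f\|_{\gamma,\infty}\le M,\ \|f-\bar f_n\|_H\le R_n/\sqrt n\}.$$ Then, as $n\to\infty$, $$P_{f_0}^n(f_0\in C_n')\to1-\alpha,$$ and the $L^2$-diameter $|C_n'|_2$ of $C_n'$ satisfies, for some $\kappa>0$, $$|C_n'|_2=O_P\big(n^{-\gamma/(2\gamma+1)}(\log n)^\kappa\big).$$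
   Context: $L^2=L^2([0,1])$ with $\langle f,g\rangle=\int_0^1 f\bar g$. The $S$-regular Cohen--Daubechies--Vial (CDV) wavelet basis $\{\psi_{lk}: l\ge J_0-1,\ 0\le k\le 2^l-1\}$ is an orthonormal basis of $L^2$ of boundary-corrected wavelets, all $S$-times differentiable with derivatives in $L^2$; the functions with $l=J_0-1$ denote the scaling functions; $J_0\in\mathbb N$ with $J_0-1\ge1$. Put $a_l=2^l$. Norms. $C^\gamma=\{f\in C([0,1]):\|f\|_{\gamma,\infty}:=\sup_{l,k}2^{l(\gamma+1/2)}|\langle\psi_{lk},f\rangle|<\infty\}$. For $\delta>1/2$, $H(\delta)$ is the Hilbert space of linear forms $f$ on $\mathrm{span}\{\psi_{lk}\}$ (identified with their coefficients $\langle f,\psi_{lk}\rangle$) with $\|f\|_{H(\delta)}^2=\sum_l a_l^{-1}(\log a_l)^{-2\delta}\sum_k|\langle f,\psi_{lk}\rangle|^2<\infty$; it contains $L^2$. Model. $\mathbb W$ is standard white noise (i.i.d. $N(0,1)$ coefficients in the basis), a tight Gaussian random variable in $H(\delta)$. For $f\in L^2$, $P_f^n$ is the law of $\mathbb X^{(n)}=f+n^{-1/2}\mathbb W$. The posterior $\Pi(\cdot\mid\mathbb X^{(n)})$ is the conditional law of $f$ given $\mathbb X^{(n)}$ when $f\sim\Pi$ and $\mathbb X^{(n)}\mid f\sim P_f^n$, given by Bayes' formula with likelihood $dP_f^n/dP_0^n=\exp(n\langle f,\mathbb X^{(n)}\rangle-\tfrac n2\|f\|_2^2)$. The posterior mean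 is the Bochner integral $\bar f_n=\int f\,d\Pi(f\mid\mathbb X^{(n)})$. $O_P$ refers to $P_{f_0}^n$.
   Formalization: At the scaling level l=J_0-1 the index k runs over 0≤k≤2^{J_0}-1 instead of 0≤k≤2^l-1, since the scaling space below the wavelet levels l≥J_0 has dimension 2^{J_0} and with only 2^{J_0-1} functions the family could not be a basis. *)

theory Defs
  imports "HOL-Probability.Probability"
begin

section \<open>The Hilbert space of real square-integrable functions on the unit interval\<close>

abbreviation unit_lborel :: "real measure"
  where "unit_lborel \<equiv> restrict_space lborel {0..1}"

definition sq_integrable :: "(real \<Rightarrow> real) \<Rightarrow> bool"
  where "sq_integrable f \<longleftrightarrow>
    f \<in> borel_measurable unit_lborel \<and> integrable unit_lborel (\<lambda>x. (f x)\<^sup>2)"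

lemma prob_space_unit: "prob_space unit_lborel"
  by (rule prob_space_restrict_space) auto

interpretation unit: prob_space unit_lborel
  by (rule prob_space_unit)

lemma sq_integrable_mult:
  assumes "sq_integrable f" "sq_integrable g"
  shows "integrable unit_lborel (\<lambda>x. f x * g x)"
proof (rule Bochner_Integration.integrable_bound)
  show "integrable unit_lborel (\<lambda>x. (f x)\<^sup>2 + (g x)\<^sup>2)"
    using assms by (auto simp: sq_integrable_def)
  show "(\<lambda>x. f x * g x) \<in> borel_measurable unit_lborel"
    using assms by (auto simp: sq_integrable_def)
  have "\<bar>a * b\<bar> \<le> a\<^sup>2 + b\<^sup>2" for a b :: real
  proof -
    have "2 * (\<bar>a\<bar> * \<bar>b\<bar>) \<le> a\<^sup>2 + b\<^sup>2"
      using sum_squares_bound[of "\<bar>a\<bar>" "\<bar>b\<bar>"] by (simp add: mult.assoc)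
    moreover have "0 \<le> \<bar>a\<bar> * \<bar>b\<bar>" by simp
    ultimately show ?thesis unfolding abs_mult by linarith
  qed
  then show "AE x in unit_lborel. norm (f x * g x) \<le> norm ((f x)\<^sup>2 + (g x)\<^sup>2)"
    by (intro AE_I2) (simp)
qed

lemma sq_integrable_0: "sq_integrable (\<lambda>x. 0)"
  by (simp add: sq_integrable_def)

lemma sq_integrable_scale: "sq_integrable f \<Longrightarrow> sq_integrable (\<lambda>x. c * f x)"
  by (auto simp: sq_integrable_def power_mult_distrib)

lemma sq_integrable_add:
  assumes "sq_integrable f" "sq_integrable g"
  shows "sq_integrable (\<lambda>x. f x + g x)"
  using assms sq_integrable_mult[OF assms]
  by (auto simp: sq_integrable_def power2_sum mult.assoc)

lemma sq_integrable_diff: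
  assumes "sq_integrable f" "sq_integrable g"
  shows "sq_integrable (\<lambda>x. f x - g x)"
  using sq_integrable_add[OF assms(1) sq_integrable_scale[OF assms(2), of "-1"]] by simp

lemma sq_integrable_uminus:
  assumes "sq_integrable f"
  shows "sq_integrable (\<lambda>x. - f x)"
  using sq_integrable_scale[OF assms, of "-1"] by simp

text \<open>The class of f is meaningful only for square-integrable f.\<close>

quotient_type l2 = "real \<Rightarrow> real" / partial:
  "\<lambda>f g. sq_integrable f \<and> sq_integrable g \<and> (AE x in unit_lborel. f x = g x)"
  morphisms rep_l2 l2_of
proof (rule part_equivpI)
  show "\<exists>f. sq_integrable f \<and> sq_integrable f \<and> (AE x in unit_lborel. f x = f x)"
    using sq_integrable_0 by auto
  show "symp (\<lambda>f g. sq_integrable f \<and> sq_integrable g \<and> (AE x in unit_lborel. f x = g x))"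
    by (auto intro!: sympI)
  show "transp (\<lambda>f g. sq_integrable f \<and> sq_integrable g \<and> (AE x in unit_lborel. f x = g x))"
    by (intro transpI) auto
qed

lemma sq_integral_cong:
  assumes "sq_integrable f" "sq_integrable f'" "sq_integrable g" "sq_integrable g'"
    and "AE x in unit_lborel. f x = f' x" "AE x in unit_lborel. g x = g' x"
  shows "(LINT x|unit_lborel. f x * g x) = (LINT x|unit_lborel. f' x * g' x)"
  using assms by (intro integral_cong_AE) (auto simp: sq_integrable_def)

instantiation l2 :: "{zero,plus,minus,uminus,scaleR}"
begin
lift_definition zero_l2 :: l2 is "\<lambda>x. 0" by (simp add: sq_integrable_0)
lift_definition plus_l2 :: "l2 \<Rightarrow> l2 \<Rightarrow> l2" is "\<lambda>f g x. f x + g x"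
  by (auto simp: sq_integrable_add)
lift_definition minus_l2 :: "l2 \<Rightarrow> l2 \<Rightarrow> l2" is "\<lambda>f g x. f x - g x"
  by (auto simp: sq_integrable_diff)
lift_definition uminus_l2 :: "l2 \<Rightarrow> l2" is "\<lambda>f x. - f x"
  by (auto simp: sq_integrable_uminus)
lift_definition scaleR_l2 :: "real \<Rightarrow> l2 \<Rightarrow> l2" is "\<lambda>c f x. c * f x"
  by (auto simp: sq_integrable_scale)
instance ..
end

instance l2 :: real_vector
proof
  fix a b :: real and x y z :: l2
  show "x + y + z = x + (y + z)" by transfer (auto simp: sq_integrable_add add.assoc)
  show "x + y = y + x" by transfer (auto simp: sq_integrable_add add.commute)
  show "0 + x = x" by transfer auto
  show "- x + x = 0" by transfer (auto simp: sq_integrable_0)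
  show "x - y = x + - y" by transfer (auto simp: sq_integrable_diff)
  show "a *\<^sub>R (x + y) = a *\<^sub>R x + a *\<^sub>R y"
    by transfer (auto simp: sq_integrable_scale sq_integrable_add algebra_simps)
  show "(a + b) *\<^sub>R x = a *\<^sub>R x + b *\<^sub>R x"
    by transfer (auto simp: sq_integrable_scale sq_integrable_add algebra_simps)
  show "a *\<^sub>R b *\<^sub>R x = (a * b) *\<^sub>R x"
    by transfer (auto simp: sq_integrable_scale algebra_simps)
  show "1 *\<^sub>R x = x" by transfer auto
qed

instantiation l2 :: real_inner
begin
lift_definition inner_l2 :: "l2 \<Rightarrow> l2 \<Rightarrow> real"
  is "\<lambda>f g. LINT x|unit_lborel. f x * g x"
  by (rule sq_integral_cong) auto
definition norm_l2 :: "l2 \<Rightarrow> real" where "norm_l2 f = sqrt (f \<bullet> f)"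
definition sgn_l2 :: "l2 \<Rightarrow> l2" where "sgn_l2 f = f /\<^sub>R norm f"
definition dist_l2 :: "l2 \<Rightarrow> l2 \<Rightarrow> real" where "dist_l2 f g = norm (f - g)"
definition uniformity_l2 :: "(l2 \<times> l2) filter"
  where "uniformity_l2 = (INF e\<in>{0<..}. principal {(f, g). dist f g < e})"
definition open_l2 :: "l2 set \<Rightarrow> bool"
  where "open_l2 U \<longleftrightarrow> (\<forall>f\<in>U. \<forall>\<^sub>F (f', g) in uniformity. f' = f \<longrightarrow> g \<in> U)"
instance
proof
  fix r :: real and x y z :: l2 and U :: "l2 set"
  show "x \<bullet> y = y \<bullet> x" by transfer (simp add: mult.commute)
  show "(x + y) \<bullet> z = x \<bullet> z + y \<bullet> z"
    by transfer (simp add: distrib_right sq_integrable_mult)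
  show "(r *\<^sub>R x) \<bullet> y = r * (x \<bullet> y)" by transfer (simp add: mult.assoc)
  show "0 \<le> x \<bullet> x" by transfer simp
  show "(x \<bullet> x = 0) = (x = 0)"
  proof transfer
    fix f assume "sq_integrable f \<and> sq_integrable f \<and> (AE x in unit_lborel. f x = f x)"
    then have "sq_integrable f" by simp
    then have "(LINT x|unit_lborel. f x * f x) = 0 \<longleftrightarrow> (AE x in unit_lborel. f x * f x = 0)"
      by (intro integral_nonneg_eq_0_iff_AE) (auto simp: sq_integrable_mult)
    then show "((LINT x|unit_lborel. f x * f x) = 0) =
        (sq_integrable f \<and> sq_integrable (\<lambda>x. 0) \<and> (AE x in unit_lborel. f x = 0))"
      using \<open>sq_integrable f\<close> sq_integrable_0 by simp
  qed
qed (fact dist_l2_def sgn_l2_def uniformity_l2_def open_l2_def norm_l2_def)+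
end

lemma l2_of_cases:
  obtains f where "sq_integrable f" "F = l2_of f"
  using Quotient3_rep_reflp[OF Quotient3_l2, of F] Quotient3_abs_rep[OF Quotient3_l2, of F] by metis

lemma l2_of_eq_iff:
  "sq_integrable f \<Longrightarrow> sq_integrable g \<Longrightarrow> l2_of f = l2_of g \<longleftrightarrow> (AE x in unit_lborel. f x = g x)"
  using Quotient3_rel[OF Quotient3_l2, of f g] by auto

lemma l2_of_simps:
  assumes "sq_integrable f" "sq_integrable g"
  shows "l2_of f + l2_of g = l2_of (\<lambda>x. f x + g x)"
    "l2_of f - l2_of g = l2_of (\<lambda>x. f x - g x)"
    "c *\<^sub>R l2_of f = l2_of (\<lambda>x. c * f x)"
    "l2_of f \<bullet> l2_of g = (LINT x|unit_lborel. f x * g x)"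
  using assms by (simp_all add: plus_l2.abs_eq minus_l2.abs_eq scaleR_l2.abs_eq inner_l2.abs_eq)



lemma norm_l2_of:
  assumes "sq_integrable f"
  shows "norm (l2_of f) ^ 2 = (LINT x|unit_lborel. (f x)\<^sup>2)"
  using l2_of_simps(4)[OF assms assms] unfolding power2_norm_eq_inner by (simp add: power2_eq_square)

lemma nn_integral_sq:
  assumes "sq_integrable f"
  shows "(\<integral>\<^sup>+x. ennreal ((f x)\<^sup>2) \<partial>unit_lborel) = ennreal (norm (l2_of f) ^ 2)"
  unfolding norm_l2_of[OF assms] using assms
  by (intro nn_integral_eq_integral) (auto simp: sq_integrable_def)

lemma sq_integrableI_nn:
  assumes "f \<in> borel_measurable unit_lborel"
    and "(\<integral>\<^sup>+x. ennreal ((f x)\<^sup>2) \<partial>unit_lborel) < \<infinity>"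
  shows "sq_integrable f"
  unfolding sq_integrable_def using assms by (auto intro!: integrableI_bounded)

lemma nn_integral_abs_le_norm:
  assumes f: "sq_integrable f"
  shows "(\<integral>\<^sup>+x. ennreal \<bar>f x\<bar> \<partial>unit_lborel) \<le> ennreal (norm (l2_of f))"
proof -
  have one: "sq_integrable (\<lambda>x. 1)" by (simp add: sq_integrable_def)
  have af: "sq_integrable (\<lambda>x. \<bar>f x\<bar>)" using f by (auto simp: sq_integrable_def)
  have n1: "norm (l2_of (\<lambda>x. 1)) = 1"
  proof (rule power2_eq_imp_eq)
    show "(norm (l2_of (\<lambda>x. 1)))\<^sup>2 = 1\<^sup>2"
      unfolding norm_l2_of[OF one] using unit.prob_space by simp
  qed auto
  have n2: "norm (l2_of (\<lambda>x. \<bar>f x\<bar>)) = norm (l2_of f)"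
    by (rule power2_eq_imp_eq) (simp_all add: norm_l2_of[OF f] norm_l2_of[OF af])
  have "(LINT x|unit_lborel. \<bar>f x\<bar> * 1) \<le> norm (l2_of (\<lambda>x. \<bar>f x\<bar>)) * norm (l2_of (\<lambda>x. 1))"
    using norm_cauchy_schwarz[of "l2_of (\<lambda>x. \<bar>f x\<bar>)" "l2_of (\<lambda>x. 1)"]
    by (simp only: l2_of_simps(4)[OF af one])
  then have le: "(LINT x|unit_lborel. \<bar>f x\<bar>) \<le> norm (l2_of f)" by (simp add: n1 n2)
  have "integrable unit_lborel (\<lambda>x. \<bar>f x\<bar>)" using sq_integrable_mult[OF af one] by simp
  then have "(\<integral>\<^sup>+x. ennreal \<bar>f x\<bar> \<partial>unit_lborel) = ennreal (LINT x|unit_lborel. \<bar>f x\<bar>)"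
    by (intro nn_integral_eq_integral) auto
  with le show ?thesis by (simp add: ennreal_leI)
qed

instance l2 :: complete_space
proof
  fix X :: "nat \<Rightarrow> l2"
  assume X: "Cauchy X"
  have "\<exists>r. \<forall>n. (\<forall>i\<ge>r n. \<forall>j\<ge>r n. dist (X i) (X j) < (1/2)^n) \<and> r n < r (Suc n)"
  proof (rule dependent_nat_choice)
    show "\<exists>x. \<forall>i\<ge>x. \<forall>j\<ge>x. dist (X i) (X j) < (1/2)^0"
      using X unfolding Cauchy_def by (auto dest: spec[where x=1])
    fix x n :: nat
    have "(1/2::real)^Suc n > 0" by simp
    then obtain N where N: "\<forall>i\<ge>N. \<forall>j\<ge>N. dist (X i) (X j) < (1/2)^Suc n"
      using X unfolding Cauchy_def by blast
    then show "\<exists>y. (\<forall>i\<ge>y. \<forall>j\<ge>y. dist (X i) (X j) < (1/2)^Suc n) \<and> x < y"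
      by (intro exI[of _ "max N (Suc x)"]) auto
  qed
  then obtain r where r: "\<And>n i j. i \<ge> r n \<Longrightarrow> j \<ge> r n \<Longrightarrow> dist (X i) (X j) < (1/2)^n"
    and mono: "\<And>n. r n < r (Suc n)" by blast
  have r_mono: "strict_mono r" by (simp add: strict_mono_Suc_iff mono)
  define Y where "Y n = X (r n)" for n
  have Y: "norm (Y m - Y n) \<le> (1/2)^n" if "m \<ge> n" for m n
    using r[of n "r m" "r n"] that r_mono by (auto simp: Y_def dist_norm strict_mono_less_eq)
  have "\<forall>n. \<exists>f. sq_integrable f \<and> Y n = l2_of f" by (metis l2_of_cases)
  then obtain F where F: "\<And>n. sq_integrable (F n)" and YF: "\<And>n. Y n = l2_of (F n)" by metis
  have [measurable]: "F n \<in> borel_measurable unit_lborel" for n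
    using F[of n] by (simp add: sq_integrable_def)
  define g where "g = (\<lambda>x. lim (\<lambda>n. F n x))"
  have [measurable]: "g \<in> borel_measurable unit_lborel" unfolding g_def by measurable
  have "(\<integral>\<^sup>+x. (\<Sum>n. ennreal \<bar>F (Suc n) x - F n x\<bar>) \<partial>unit_lborel)
      = (\<Sum>n. \<integral>\<^sup>+x. ennreal \<bar>F (Suc n) x - F n x\<bar> \<partial>unit_lborel)"
    by (rule nn_integral_suminf) measurable
  also have "\<dots> \<le> (\<Sum>n. ennreal ((1/2)^n))"
  proof (intro suminf_le allI)
    fix n
    show "(\<integral>\<^sup>+x. ennreal \<bar>F (Suc n) x - F n x\<bar> \<partial>unit_lborel) \<le> ennreal ((1/2)^n)"
      using nn_integral_abs_le_norm[OF sq_integrable_diff[OF F F], of "Suc n" n] Y[of n "Suc n"]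
      by (auto simp: YF l2_of_simps F intro: order_trans ennreal_leI)
  qed auto
  also have "\<dots> = ennreal (\<Sum>n. (1/2)^n)"
    by (intro suminf_ennreal2) (auto intro!: summable_geometric)
  also have "\<dots> < \<infinity>" by simp
  finally have "AE x in unit_lborel. (\<Sum>n. ennreal \<bar>F (Suc n) x - F n x\<bar>) \<noteq> \<infinity>"
    by (intro nn_integral_noteq_infinite) (auto, measurable)
  then have conv: "AE x in unit_lborel. (\<lambda>n. F n x) \<longlonglongrightarrow> g x"
  proof eventually_elim
    fix x assume "(\<Sum>n. ennreal \<bar>F (Suc n) x - F n x\<bar>) \<noteq> \<infinity>"
    then have "summable (\<lambda>n. \<bar>F (Suc n) x - F n x\<bar>)"
      by (intro summable_suminf_not_top) auto
    then have "summable (\<lambda>n. F (Suc n) x - F n x)" by (rule summable_rabs_cancel)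
    then have "convergent (\<lambda>n. F n x - F 0 x)"
      by (simp add: summable_iff_convergent sum_lessThan_telescope[of "\<lambda>n. F n x"])
    from convergent_add[OF this convergent_const[of "F 0 x"]]
    have "convergent (\<lambda>n. (F n x - F 0 x) + F 0 x)" .
    then have "convergent (\<lambda>n. F n x)" by simp
    then show "(\<lambda>n. F n x) \<longlonglongrightarrow> g x" by (simp add: g_def convergent_LIMSEQ_iff)
  qed
  have bound: "(\<integral>\<^sup>+x. ennreal ((g x - F n x)\<^sup>2) \<partial>unit_lborel) \<le> ennreal (((1/2)^n)^2)" for n
  proof -
    have "(\<integral>\<^sup>+x. ennreal ((g x - F n x)\<^sup>2) \<partial>unit_lborel)
        = (\<integral>\<^sup>+x. liminf (\<lambda>m. ennreal ((F m x - F n x)\<^sup>2)) \<partial>unit_lborel)"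
    proof (rule nn_integral_cong_AE, use conv in eventually_elim)
      fix x assume "(\<lambda>n. F n x) \<longlonglongrightarrow> g x"
      then have "(\<lambda>m. ennreal ((F m x - F n x)\<^sup>2)) \<longlonglongrightarrow> ennreal ((g x - F n x)\<^sup>2)"
        by (intro tendsto_intros)
      then show "ennreal ((g x - F n x)\<^sup>2) = liminf (\<lambda>m. ennreal ((F m x - F n x)\<^sup>2))"
        by (intro lim_imp_Liminf[symmetric]) auto
    qed
    also have "\<dots> \<le> liminf (\<lambda>m. \<integral>\<^sup>+x. ennreal ((F m x - F n x)\<^sup>2) \<partial>unit_lborel)"
      by (rule nn_integral_liminf) measurable
    also have "\<dots> = liminf (\<lambda>m. ennreal (norm (Y m - Y n) ^ 2))"
      by (simp add: nn_integral_sq sq_integrable_diff F YF l2_of_simps)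
    also have "\<dots> \<le> limsup (\<lambda>m. ennreal (norm (Y m - Y n) ^ 2))"
      by (rule Liminf_le_Limsup) simp
    also have "\<dots> \<le> ennreal (((1/2)^n)^2)"
      by (rule Limsup_bounded)
         (auto intro!: eventually_sequentiallyI[of n] ennreal_leI power_mono Y)
    finally show ?thesis .
  qed
  have d: "sq_integrable (\<lambda>x. g x - F n x)" for n
    by (rule sq_integrableI_nn) (use le_less_trans[OF bound[of n]] in auto)
  have g: "sq_integrable g"
    using sq_integrable_add[OF d[of 0] F[of 0]] by simp
  have "norm (l2_of g - Y n) \<le> (1/2)^n" for n
  proof -
    have "ennreal (norm (l2_of g - Y n) ^ 2) \<le> ennreal (((1/2)^n)^2)"
      using bound[of n] nn_integral_sq[OF d[of n]] by (simp add: YF l2_of_simps g F)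
    then have "norm (l2_of g - Y n) ^ 2 \<le> ((1/2)^n)^2"
      by (subst (asm) ennreal_le_iff) auto
    then show ?thesis by (rule power2_le_imp_le) simp
  qed
  then have "Y \<longlonglongrightarrow> l2_of g"
  proof -
    assume *: "norm (l2_of g - Y n) \<le> (1/2)^n" for n
    have "(\<lambda>n. Y n - l2_of g) \<longlonglongrightarrow> 0"
    proof (rule Lim_null_comparison)
      show "\<forall>\<^sub>F n in sequentially. norm (Y n - l2_of g) \<le> (1/2)^n"
        using * by (intro always_eventually allI) (subst norm_minus_commute)
      show "(\<lambda>n. (1/2::real)^n) \<longlonglongrightarrow> 0" by (rule LIMSEQ_realpow_zero) auto
    qed
    then show ?thesis by (rule LIM_zero_cancel)
  qed
  then have "X \<longlonglongrightarrow> l2_of g"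
    using Cauchy_converges_subseq[OF X r_mono, of "l2_of g"] by (simp add: Y_def[abs_def] o_def)
  then show "convergent X" by (rule convergentI)
qed

instance l2 :: banach ..

lemma l2_of_dominated:
  assumes f: "\<And>n. f n \<in> borel_measurable unit_lborel" "h \<in> borel_measurable unit_lborel"
    and g: "sq_integrable g" and le: "\<And>n x. \<bar>f n x\<bar> \<le> g x"
    and lim: "\<And>x. x \<in> {0..1} \<Longrightarrow> (\<lambda>n. f n x) \<longlonglongrightarrow> h x"
  shows "(\<lambda>n. l2_of (f n)) \<longlonglongrightarrow> l2_of h" and "sq_integrable h" and "sq_integrable (f n)"
proof -
  note [measurable] = f
  have gm[measurable]: "g \<in> borel_measurable unit_lborel"
    and gi: "integrable unit_lborel (\<lambda>x. (g x)\<^sup>2)" using g by (auto simp: sq_integrable_def)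
  have g0: "g x \<ge> 0" for x using le[of 0 x] by linarith
  have hle: "\<bar>h x\<bar> \<le> g x" if "x \<in> {0..1}" for x
    by (rule LIMSEQ_le_const2[OF tendsto_rabs[OF lim[OF that]]]) (use le in auto)
  have fi: "sq_integrable (f n)" for n
    unfolding sq_integrable_def
    using le g0 by (auto intro!: Bochner_Integration.integrable_bound[OF gi] AE_I2 simp: abs_le_square_iff[symmetric])
  have hi: "sq_integrable h"
    unfolding sq_integrable_def
    using hle g0 by (auto intro!: Bochner_Integration.integrable_bound[OF gi] AE_I2 simp: abs_le_square_iff[symmetric])
  show "sq_integrable h" by fact
  show "sq_integrable (f n)" by fact
  have "(\<lambda>n. LINT x|unit_lborel. (f n x - h x)\<^sup>2) \<longlonglongrightarrow> (LINT x|unit_lborel. 0)"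
  proof (rule integral_dominated_convergence)
    show "integrable unit_lborel (\<lambda>x. 4 * (g x)\<^sup>2)" using gi by simp
    show "AE x in unit_lborel. (\<lambda>n. (f n x - h x)\<^sup>2) \<longlonglongrightarrow> 0"
    proof (intro AE_I2)
      fix x assume "x \<in> space unit_lborel"
      then have "(\<lambda>n. (f n x - h x)\<^sup>2) \<longlonglongrightarrow> (h x - h x)\<^sup>2"
        by (intro tendsto_intros lim) simp
      then show "(\<lambda>n. (f n x - h x)\<^sup>2) \<longlonglongrightarrow> 0" by simp
    qed
    fix n
    show "AE x in unit_lborel. norm ((f n x - h x)\<^sup>2) \<le> 4 * (g x)\<^sup>2"
    proof (intro AE_I2)
      fix x assume "x \<in> space unit_lborel"
      then have "\<bar>f n x - h x\<bar> \<le> 2 * g x" using le[of n x] hle[of x] by simp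
      then have "(f n x - h x)\<^sup>2 \<le> (2 * g x)\<^sup>2" using g0[of x] by (metis abs_le_square_iff abs_of_nonneg mult_nonneg_nonneg zero_le_numeral)
      then show "norm ((f n x - h x)\<^sup>2) \<le> 4 * (g x)\<^sup>2" by (simp add: power_mult_distrib)
    qed
  qed measurable
  then have "(\<lambda>n. norm (l2_of (f n) - l2_of h) ^ 2) \<longlonglongrightarrow> 0"
    by (simp add: l2_of_simps fi hi norm_l2_of sq_integrable_diff)
  then have "(\<lambda>n. sqrt (norm (l2_of (f n) - l2_of h) ^ 2)) \<longlonglongrightarrow> sqrt 0"
    by (intro tendsto_intros)
  then show "(\<lambda>n. l2_of (f n)) \<longlonglongrightarrow> l2_of h"
    by (simp add: tendsto_norm_zero_iff LIM_zero_iff)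
qed

lemma l2_of_indicator_sq: "A \<in> sets borel \<Longrightarrow> sq_integrable (\<lambda>x. indicator A x)"
  unfolding sq_integrable_def
  by (auto intro!: Bochner_Integration.integrable_bound[of _ "\<lambda>x. 1::real"] measurable_restrict_space1
      simp: indicator_def)

text \<open>A countable dense set, with rational coefficients and rational endpoints.\<close>

definition l2_combs :: "l2 set"
  where "l2_combs = range (\<lambda>xs :: (rat \<times> rat) list.
    \<Sum>(c, q)\<leftarrow>xs. of_rat c *\<^sub>R l2_of (indicator {..of_rat q}))"

lemma countable_l2_combs: "countable l2_combs"
  by (simp add: l2_combs_def)

lemma l2_combs_add: "x \<in> l2_combs \<Longrightarrow> y \<in> l2_combs \<Longrightarrow> x + y \<in> l2_combs"
  unfolding l2_combs_def image_iff
  by (elim bexE) (rule_tac x="xa @ xaa" in bexI, auto)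

lemma l2_combs_scale: "x \<in> l2_combs \<Longrightarrow> of_rat d *\<^sub>R x \<in> l2_combs"
proof -
  assume "x \<in> l2_combs"
  then obtain xs where x: "x = (\<Sum>(c, q)\<leftarrow>xs. of_rat c *\<^sub>R l2_of (indicator {..of_rat q}))"
    by (auto simp: l2_combs_def)
  have "of_rat d *\<^sub>R x = (\<Sum>(c, q)\<leftarrow>map (\<lambda>(c, q). (d * c, q)) xs. of_rat c *\<^sub>R l2_of (indicator {..of_rat q}))"
    unfolding x by (induction xs) (auto simp: scaleR_add_right of_rat_mult)
  then show ?thesis unfolding l2_combs_def by blast
qed

lemma closure_l2_combs_add:
  assumes "x \<in> closure l2_combs" "y \<in> closure l2_combs" shows "x + y \<in> closure l2_combs"
proof -
  obtain f g where "\<And>n. f n \<in> l2_combs" "f \<longlonglongrightarrow> x" "\<And>n. g n \<in> l2_combs" "g \<longlonglongrightarrow> y"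
    using assms unfolding closure_sequential by blast
  then show ?thesis unfolding closure_sequential
    by (intro exI[of _ "\<lambda>n. f n + g n"]) (auto intro: l2_combs_add tendsto_add)
qed

lemma closure_l2_combs_scale:
  assumes "x \<in> closure l2_combs" shows "c *\<^sub>R x \<in> closure l2_combs"
proof -
  obtain f where f: "\<And>n. f n \<in> l2_combs" "f \<longlonglongrightarrow> x"
    using assms unfolding closure_sequential by blast
  have "\<exists>q. \<bar>of_rat q - c\<bar> < inverse (Suc n)" for n
    using of_rat_dense[of "c - inverse (Suc n)" "c + inverse (Suc n)"] by (auto simp: abs_less_iff) (smt (verit) inverse_positive_iff_positive of_nat_0_less_iff zero_less_Suc)
  then obtain q where q: "\<And>n. \<bar>of_rat (q n) - c\<bar> < inverse (Suc n)" by metis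
  have "(\<lambda>n. of_rat (q n) - c) \<longlonglongrightarrow> 0"
    by (rule tendsto_rabs_zero_cancel, rule tendsto_sandwich[OF _ _ tendsto_const LIMSEQ_inverse_real_of_nat])
       (use q in \<open>auto intro!: always_eventually less_imp_le\<close>)
  then have "(\<lambda>n. of_rat (q n)) \<longlonglongrightarrow> c" by (simp add: LIM_zero_iff)
  with f show ?thesis unfolding closure_sequential
    by (intro exI[of _ "\<lambda>n. of_rat (q n) *\<^sub>R f n"]) (auto intro: l2_combs_scale tendsto_scaleR)
qed

lemma closure_l2_combs_lim:
  assumes "\<And>n. f n \<in> closure l2_combs" "f \<longlonglongrightarrow> x" shows "x \<in> closure l2_combs"
  using closed_sequentially[OF closed_closure assms] .

lemma closure_l2_combs_atMost: "l2_of (indicator {..a}) \<in> closure l2_combs"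
proof -
  have "\<exists>q. a < of_rat q \<and> of_rat q < a + inverse (Suc n)" for n
    using of_rat_dense[of a "a + inverse (Suc n)"] by auto
  then obtain q where q: "\<And>n. a < of_rat (q n)" "\<And>n. of_rat (q n) < a + inverse (Suc n)" by metis
  have ql: "(\<lambda>n. of_rat (q n)) \<longlonglongrightarrow> a"
    by (rule tendsto_sandwich[OF _ _ tendsto_const, of _ _ _ "\<lambda>n. a + inverse (Suc n)"])
       (use q LIMSEQ_inverse_real_of_nat_add[of a] in \<open>auto intro!: always_eventually less_imp_le\<close>)
  have "(\<lambda>n. l2_of (indicator {..of_rat (q n)})) \<longlonglongrightarrow> l2_of (indicator {..a})"
  proof (rule l2_of_dominated(1)[where g="\<lambda>x. 1"])
    fix x :: real
    show "(\<lambda>n. indicator {..of_rat (q n)} x :: real) \<longlonglongrightarrow> indicator {..a} x"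
    proof (cases "x \<le> a")
      case True
      then have "x \<le> of_rat (q n)" for n using q(1)[of n] by linarith
      with True show ?thesis by simp
    next
      case False
      then have "\<forall>\<^sub>F n in sequentially. of_rat (q n) < x"
        using ql by (intro order_tendstoD(2)) auto
      then have "\<forall>\<^sub>F n in sequentially. indicator {..of_rat (q n)} x = (indicator {..a} x :: real)"
        by eventually_elim (use False in auto)
      then show ?thesis by (rule tendsto_eventually)
    qed
  qed (auto intro!: measurable_restrict_space1 simp: sq_integrable_def indicator_def)
  moreover have "l2_of (indicator {..of_rat (q n)}) \<in> l2_combs" for n
    unfolding l2_combs_def by (rule range_eqI[of _ _ "[(1, q n)]"]) simp
  then have "l2_of (indicator {..of_rat (q n)}) \<in> closure l2_combs" for n
    using closure_subset by blast
  ultimately show ?thesis by (rule closure_l2_combs_lim[rotated])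
qed

lemma l2_of_0: "l2_of (\<lambda>x. 0) = 0"
  by (simp add: zero_l2.abs_eq)

lemma closure_l2_combs_0: "0 \<in> closure l2_combs"
  using closure_l2_combs_scale[OF closure_l2_combs_atMost, of 0] by simp

lemma closure_l2_combs_indicator:
  assumes "A \<in> sets borel"
  shows "l2_of (indicator A) \<in> closure l2_combs"
proof -
  have "A \<in> sigma_sets UNIV (range (\<lambda>a::real. {..a}))"
    using assms by (simp add: borel_eq_atMost)
  then show ?thesis
  proof (induction rule: sigma_sets_induct_disjoint[rotated 2, consumes 1, case_names basic empty compl union int pow])
    case (basic A)
    then show ?case using closure_l2_combs_atMost by auto
  next
    case empty
    then show ?case using closure_l2_combs_0 by (simp add: l2_of_0)
  next
    case (compl A)
    have b: "A \<in> sets borel" using compl(1) by (simp add: borel_eq_atMost)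
    have "l2_of (indicator (UNIV - A)) = l2_of (\<lambda>x. indicator {..1} x - indicator A x)"
      using b by (subst l2_of_eq_iff)
        (auto intro!: sq_integrable_diff l2_of_indicator_sq AE_I2, auto simp: indicator_def)
    also have "\<dots> = l2_of (indicator {..1}) + (-1) *\<^sub>R l2_of (indicator A)"
      using b by (subst l2_of_simps(2)[symmetric]) (auto intro!: l2_of_indicator_sq)
    finally show ?case
      using closure_l2_combs_add[OF closure_l2_combs_atMost closure_l2_combs_scale[OF compl(2)]]
      by metis
  next
    case (union A)
    have b: "A i \<in> sets borel" for i using union(2) by (auto simp: borel_eq_atMost)
    have part: "l2_of (\<lambda>x. \<Sum>i<n. indicator (A i) x) \<in> closure l2_combs
        \<and> sq_integrable (\<lambda>x. \<Sum>i<n. indicator (A i) x)" for n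
    proof (induction n)
      case 0
      then show ?case using closure_l2_combs_0 by (simp add: l2_of_0 sq_integrable_0)
    next
      case (Suc n)
      then show ?case
        using closure_l2_combs_add[OF conjunct1[OF Suc] union(3)[of n]]
        by (auto simp: l2_of_simps b l2_of_indicator_sq intro!: sq_integrable_add)
    qed
    have eq: "(\<Sum>i<n. indicator (A i) x) = (indicator (\<Union>i<n. A i) x :: real)" for n x
      using union(1) by (subst indicator_UN_disjoint)
        (auto simp: disjoint_family_on_def)
    have "(\<lambda>n. l2_of (\<lambda>x. indicator (\<Union>i<n. A i) x)) \<longlonglongrightarrow> l2_of (indicator (\<Union>i. A i))"
    proof (rule l2_of_dominated(1)[where g="\<lambda>x. 1"])
      fix x :: real
      show "(\<lambda>n. indicator (\<Union>i<n. A i) x :: real) \<longlonglongrightarrow> indicator (\<Union>i. A i) x"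
        by (rule LIMSEQ_indicator_UN)
    qed (use b in \<open>auto intro!: measurable_restrict_space1 simp: sq_integrable_def indicator_def\<close>)
    then show ?case by (rule closure_l2_combs_lim[rotated]) (use part in \<open>simp add: eq\<close>)
  next
    case int
    then show ?case by (auto simp: Int_stable_def)
  qed auto
qed

lemma l2_of_cong:
  assumes "\<And>x. x \<in> {0..1} \<Longrightarrow> f x = g x" "sq_integrable f"
  shows "l2_of f = l2_of g" "sq_integrable g"
proof -
  have m: "f \<in> borel_measurable unit_lborel \<longleftrightarrow> g \<in> borel_measurable unit_lborel"
    by (rule measurable_cong) (use assms in auto)
  have i: "integrable unit_lborel (\<lambda>x. (f x)\<^sup>2) \<longleftrightarrow> integrable unit_lborel (\<lambda>x. (g x)\<^sup>2)"
    by (rule Bochner_Integration.integrable_cong) (use assms in auto)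
  show g: "sq_integrable g" using assms m i by (simp add: sq_integrable_def)
  show "l2_of f = l2_of g" using assms g by (auto simp: l2_of_eq_iff intro!: AE_I2)
qed

lemma closure_l2_combs_nonneg:
  assumes "f \<in> borel_measurable unit_lborel" "\<And>x. 0 \<le> f x" "sq_integrable f"
  shows "l2_of f \<in> closure l2_combs"
  using assms
proof (induction rule: borel_measurable_induct_real)
  case (set A)
  then obtain B where B: "B \<in> sets borel" "A = {0..1} \<inter> B"
    by (auto simp: sets_restrict_space)
  then show ?case by (auto intro!: closure_l2_combs_indicator)
next
  case (mult u c)
  show ?case
  proof (cases "c = 0")
    case True
    then show ?thesis using closure_l2_combs_0 by (simp add: l2_of_0)
  next
    case False
    then have "sq_integrable u" using sq_integrable_scale[OF mult.prems, of "inverse c"] by (simp add: mult.assoc[symmetric])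
    then show ?thesis using closure_l2_combs_scale[OF mult.IH, of c] by (simp add: l2_of_simps)
  qed
next
  case (add u v)
  have i: "integrable unit_lborel (\<lambda>x. (v x + u x)\<^sup>2)" using add.prems by (simp add: sq_integrable_def)
  have "sq_integrable u" "sq_integrable v"
    unfolding sq_integrable_def using add.hyps
    by (auto intro!: Bochner_Integration.integrable_bound[OF i] AE_I2 power_mono)
  then show ?case using closure_l2_combs_add add.IH by (simp add: l2_of_simps(1)[symmetric])
next
  case (seq U)
  have le: "U i x \<le> f x" if "x \<in> {0..1}" for i x
    using seq that by (intro incseq_le) (auto simp: incseq_def le_fun_def)
  let ?U = "\<lambda>i x. min (U i x) (\<bar>f x\<bar>)"
  have um[measurable]: "f \<in> borel_measurable unit_lborel" using seq.prems by (simp add: sq_integrable_def)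
  note [measurable] = seq.hyps(1)
  have au: "sq_integrable (\<lambda>x. \<bar>f x\<bar>)" using seq.prems by (simp add: sq_integrable_def)
  have eq: "?U i x = U i x" if "x \<in> {0..1}" for i x using le[OF that, of i] by simp
  have b: "\<bar>?U i x\<bar> \<le> \<bar>f x\<bar>" for i x using seq.hyps(2)[of i x] by auto
  have l: "(\<lambda>i. ?U i x) \<longlonglongrightarrow> f x" if "x \<in> {0..1}" for x
    using seq.hyps(4)[of x] that eq[OF that] by simp
  have m: "?U i \<in> borel_measurable unit_lborel" for i by measurable
  have d: "(\<lambda>i. l2_of (?U i)) \<longlonglongrightarrow> l2_of f" "sq_integrable (?U i)" for i
    using l2_of_dominated(1)[of ?U f "\<lambda>x. \<bar>f x\<bar>", OF m um au b l]
      l2_of_dominated(3)[of ?U f "\<lambda>x. \<bar>f x\<bar>", OF m um au b l] by blast+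
  have "l2_of (?U i) = l2_of (U i)" for i
    by (rule l2_of_cong(1)[of "?U i" "U i", OF eq d(2)])
  moreover have "sq_integrable (U i)" for i
    by (rule l2_of_cong(2)[of "?U i" "U i", OF eq d(2)])
  ultimately have "l2_of (?U i) \<in> closure l2_combs" for i
    using seq.IH[of i] by metis
  then show ?case using d(1) by (rule closure_l2_combs_lim)
qed

lemma closure_l2_combs: "closure l2_combs = UNIV"
proof (intro set_eqI iffI)
  fix F :: l2
  obtain f where f: "sq_integrable f" "F = l2_of f" by (rule l2_of_cases)
  have p: "sq_integrable (\<lambda>x. max 0 (f x))" "sq_integrable (\<lambda>x. max 0 (- f x))"
    using f(1) unfolding sq_integrable_def
    by (auto intro!: Bochner_Integration.integrable_bound[of _ "\<lambda>x. (f x)\<^sup>2"] simp: max_def)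
  have "l2_of (\<lambda>x. max 0 (f x)) \<in> closure l2_combs" "l2_of (\<lambda>x. max 0 (- f x)) \<in> closure l2_combs"
    using p by (auto intro!: closure_l2_combs_nonneg simp: sq_integrable_def)
  then have "l2_of (\<lambda>x. max 0 (f x)) + (-1) *\<^sub>R l2_of (\<lambda>x. max 0 (- f x)) \<in> closure l2_combs"
    by (intro closure_l2_combs_add closure_l2_combs_scale)
  also have "l2_of (\<lambda>x. max 0 (f x)) + (-1) *\<^sub>R l2_of (\<lambda>x. max 0 (- f x)) = l2_of (\<lambda>x. max 0 (f x) - max 0 (- f x))"
    using p by (subst l2_of_simps(2)[symmetric]) auto
  also have "(\<lambda>x. max 0 (f x) - max 0 (- f x)) = f" by (auto simp: max_def)
  finally show "F \<in> closure l2_combs" by (simp add: f)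
qed simp

instance l2 :: second_countable_topology
proof
  let ?B = "(\<lambda>(d, n). ball d (inverse (Suc n))) ` (l2_combs \<times> (UNIV :: nat set))"
  have "countable ?B" using countable_l2_combs by auto
  moreover have "topological_basis ?B"
  proof (rule topological_basisI)
    fix b assume "b \<in> ?B" then show "open b" by auto
  next
    fix U :: "l2 set" and x assume U: "open U" "x \<in> U"
    then obtain e where e: "e > 0" "ball x e \<subseteq> U" by (auto simp: open_contains_ball)
    obtain n where n: "inverse (Suc n) < e / 2" using reals_Archimedean[of "e/2"] e by auto
    have "x \<in> closure l2_combs" by (simp add: closure_l2_combs)
    then obtain d where d: "d \<in> l2_combs" "dist d x < inverse (Suc n)"
      unfolding closure_approachable by (metis inverse_positive_iff_positive of_nat_0_less_iff zero_less_Suc)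
    have "ball d (inverse (Suc n)) \<subseteq> ball x e"
    proof
      fix y assume "y \<in> ball d (inverse (Suc n))"
      then show "y \<in> ball x e"
        using d(2) n dist_triangle[of x y d] by (simp add: dist_commute)
    qed
    then show "\<exists>b\<in>?B. x \<in> b \<and> b \<subseteq> U"
      using d e(2) by (intro bexI[of _ "ball d (inverse (Suc n))"]) auto
  qed
  ultimately show "\<exists>B :: l2 set set. countable B \<and> open = generate_topology B"
    using topological_basis_imp_subbasis by blast
qed
section \<open>Wavelet bases on the unit interval\<close>

text \<open>
  A Daubechies scaling function and wavelet with N vanishing moments, both supported in [1 - N, N].
  The phase of the filter is left free.
\<close>

definition daubechies_pair :: "nat \<Rightarrow> (real \<Rightarrow> real) \<Rightarrow> (real \<Rightarrow> real) \<Rightarrow> bool"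
  where "daubechies_pair N \<phi> w \<longleftrightarrow>
    N \<ge> 1 \<and> \<phi> \<in> borel_measurable borel \<and> integrable lborel (\<lambda>x. (\<phi> x)\<^sup>2) \<and>
    (\<forall>x. x \<notin> {1 - real N..real N} \<longrightarrow> \<phi> x = 0) \<and>
    (LBINT x. \<phi> x) = 1 \<and>
    (\<forall>m::int. (LBINT x. \<phi> x * \<phi> (x - of_int m)) = (if m = 0 then 1 else 0)) \<and>
    (\<exists>h :: int \<Rightarrow> real.
      (\<forall>x. \<phi> x = sqrt 2 * (\<Sum>k = 1 - int N..int N. h k * \<phi> (2 * x - of_int k))) \<and>
      (\<forall>x. w x = sqrt 2 * (\<Sum>k = 1 - int N..int N. (-1) powi k * h (1 - k) * \<phi> (2 * x - of_int k)))) \<and>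
    (\<forall>p<N. (LBINT x. x ^ p * w x) = 0)"

text \<open>
  Edge functions on the half-line y \<ge> 0.  The inner sum is the i-th raw edge function of Cohen,
  Daubechies and Vial, which makes the polynomials of degree less than N available up to the
  boundary.  The k-th edge scaling function combines only the raw functions of index at least
  N - 1 - k, so its support lies in [0, N + k]; since the basis is orthonormal, this triangular
  form says that the edge scaling functions arise from the raw ones by the Gram-Schmidt process.
  The k-th edge wavelet is given by its two-scale relation and is supported in [0, N + k] too.
\<close>

definition cdv_edge_scaling :: "nat \<Rightarrow> (real \<Rightarrow> real) \<Rightarrow> (nat \<Rightarrow> nat \<Rightarrow> real) \<Rightarrow> nat \<Rightarrow> real \<Rightarrow> real"
  where "cdv_edge_scaling N \<phi> c k y =
    (\<Sum>i = N - 1 - k..N - 1. c k i *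
      (\<Sum>n = 0..2 * N - 2. real (n choose i) * \<phi> (y + real n - real N + 1)))"

definition cdv_edge_wavelet :: "nat \<Rightarrow> (real \<Rightarrow> real) \<Rightarrow> (nat \<Rightarrow> nat \<Rightarrow> real) \<Rightarrow>
    (nat \<Rightarrow> nat \<Rightarrow> real) \<Rightarrow> (nat \<Rightarrow> nat \<Rightarrow> real) \<Rightarrow> nat \<Rightarrow> real \<Rightarrow> real"
  where "cdv_edge_wavelet N \<phi> c d e k y =
    sqrt 2 * ((\<Sum>i<N. d k i * cdv_edge_scaling N \<phi> c i (2 * y)) +
      (\<Sum>m = N..N + 2 * k. e k m * \<phi> (2 * y - real m)))"

text \<open>
  The k-th of the 2^j functions of resolution j on [0, 1]: N at the left edge, then the dilated
  translates of f that live in the interior, then N at the right edge, where the half-line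
  variable is 2^j (1 - x).
\<close>

definition cdv_level :: "nat \<Rightarrow> (real \<Rightarrow> real) \<Rightarrow> (nat \<Rightarrow> real \<Rightarrow> real) \<Rightarrow> (nat \<Rightarrow> real \<Rightarrow> real) \<Rightarrow>
    nat \<Rightarrow> nat \<Rightarrow> real \<Rightarrow> real"
  where "cdv_level N f left right j k x = sqrt (2 ^ j) *
    (if k < N then left k (2 ^ j * x)
     else if k < 2 ^ j - N then f (2 ^ j * x - real k)
     else right (2 ^ j - 1 - k) (2 ^ j * (1 - x)))"

text \<open>
  Index set of the basis.  The level J0 - 1 holds the scaling functions; these span the coarsest
  multiresolution space, on which the wavelet levels l \<ge> J0 (with 2^l functions each) are stacked,
  and hence are 2^J0 in number.
\<close>

definition cdv_index :: "nat \<Rightarrow> (nat \<times> nat) set"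
  where "cdv_index J0 = {(l, k). J0 - 1 \<le> l \<and> k < (if l = J0 - 1 then 2 ^ J0 else 2 ^ l)}"

definition wavelet :: "(nat \<Rightarrow> nat \<Rightarrow> real \<Rightarrow> real) \<Rightarrow> nat \<times> nat \<Rightarrow> l2"
  where "wavelet \<psi> = (\<lambda>(l, k). l2_of (\<psi> l k))"

definition coef :: "(nat \<Rightarrow> nat \<Rightarrow> real \<Rightarrow> real) \<Rightarrow> l2 \<Rightarrow> nat \<times> nat \<Rightarrow> real"
  where "coef \<psi> f i = wavelet \<psi> i \<bullet> f"

definition times_differentiable_unit :: "nat \<Rightarrow> (real \<Rightarrow> real) \<Rightarrow> bool"
  where "times_differentiable_unit S f \<longleftrightarrow>
    (\<exists>D :: nat \<Rightarrow> real \<Rightarrow> real. (\<forall>x\<in>{0..1}. D 0 x = f x) \<and>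
      (\<forall>s<S. \<forall>x\<in>{0..1}. (D s has_real_derivative D (Suc s) x) (at x within {0..1})) \<and>
      (\<forall>s\<le>S. sq_integrable (D s)))"

definition orthonormal_basis :: "'i set \<Rightarrow> ('i \<Rightarrow> 'a::real_inner) \<Rightarrow> bool"
  where "orthonormal_basis I b \<longleftrightarrow>
    (\<forall>i\<in>I. \<forall>j\<in>I. b i \<bullet> b j = (if i = j then 1 else 0)) \<and> closure (span (b ` I)) = UNIV"

text \<open>
  The right edge uses the reflected scaling function, which again is a Daubechies scaling
  function.  The edge coefficients do not depend on the level.
\<close>

definition cdv_basis :: "nat \<Rightarrow> nat \<Rightarrow> (nat \<Rightarrow> nat \<Rightarrow> real \<Rightarrow> real) \<Rightarrow> bool"
  where "cdv_basis S J0 \<psi> \<longleftrightarrow>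
    (\<exists>N \<phi> w c d e c' d' e'. daubechies_pair N \<phi> w \<and> 2 * N \<le> 2 ^ J0 \<and>
      (\<forall>k<2 ^ J0. \<forall>x\<in>{0..1}. \<psi> (J0 - 1) k x =
        cdv_level N \<phi> (cdv_edge_scaling N \<phi> c) (cdv_edge_scaling N (\<lambda>t. \<phi> (1 - t)) c') J0 k x) \<and>
      (\<forall>l\<ge>J0. \<forall>k<2 ^ l. \<forall>x\<in>{0..1}. \<psi> l k x =
        cdv_level N w (cdv_edge_wavelet N \<phi> c d e)
          (cdv_edge_wavelet N (\<lambda>t. \<phi> (1 - t)) c' d' e') l k x)) \<and>
    (\<forall>(l, k)\<in>cdv_index J0. times_differentiable_unit S (\<psi> l k)) \<and>
    orthonormal_basis (cdv_index J0) (wavelet \<psi>)"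

section \<open>Norms\<close>

text \<open>Continuous functions are identified with their classes in the type l2.\<close>

definition C_space :: "nat \<Rightarrow> (nat \<Rightarrow> nat \<Rightarrow> real \<Rightarrow> real) \<Rightarrow> real \<Rightarrow> l2 set"
  where "C_space J0 \<psi> \<gamma> = {f. (\<exists>g. continuous_on {0..1} g \<and> f = l2_of g) \<and>
    bdd_above ((\<lambda>(l, k). 2 powr (real l * (\<gamma> + 1 / 2)) * \<bar>coef \<psi> f (l, k)\<bar>) ` cdv_index J0)}"

definition C_norm :: "nat \<Rightarrow> (nat \<Rightarrow> nat \<Rightarrow> real \<Rightarrow> real) \<Rightarrow> real \<Rightarrow> l2 \<Rightarrow> real"
  where "C_norm J0 \<psi> \<gamma> f =
    (SUP (l, k)\<in>cdv_index J0. 2 powr (real l * (\<gamma> + 1 / 2)) * \<bar>coef \<psi> f (l, k)\<bar>)"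

text \<open>The elements of H(\<delta>) are given by their coefficients.\<close>

definition H_norm :: "nat \<Rightarrow> real \<Rightarrow> (nat \<times> nat \<Rightarrow> real) \<Rightarrow> real"
  where "H_norm J0 \<delta> c =
    sqrt (\<Sum>\<^sub>\<infinity>(l, k)\<in>cdv_index J0. inverse (2 ^ l) * ln (2 ^ l) powr (- 2 * \<delta>) * (c (l, k))\<^sup>2)"

section \<open>Model, prior and posterior\<close>

definition white_noise :: "nat \<Rightarrow> (nat \<times> nat \<Rightarrow> real) measure"
  where "white_noise J0 = PiM (cdv_index J0) (\<lambda>_. density lborel std_normal_density)"

text \<open>
  The observation is represented by its coefficients; almost surely they form an element of
  H(\<delta>), whose Borel sets are the traces of the sets of the product sigma-algebra.
\<close>

definition obs_law :: "nat \<Rightarrow> (nat \<Rightarrow> nat \<Rightarrow> real \<Rightarrow> real) \<Rightarrow> nat \<Rightarrow> l2 \<Rightarrow> (nat \<times> nat \<Rightarrow> real) measure"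
  where "obs_law J0 \<psi> n f = distr (white_noise J0) (PiM (cdv_index J0) (\<lambda>_. borel))
    (\<lambda>z. \<lambda>i\<in>cdv_index J0. coef \<psi> f i + z i / sqrt (real n))"

definition uniform_wavelet_prior :: "nat \<Rightarrow> (nat \<Rightarrow> nat \<Rightarrow> real \<Rightarrow> real) \<Rightarrow> real \<Rightarrow> real \<Rightarrow> l2 measure"
  where "uniform_wavelet_prior J0 \<psi> \<gamma> M =
    distr (PiM (cdv_index J0) (\<lambda>_. uniform_measure lborel {- M..M})) borel
      (\<lambda>u. \<Sum>\<^sub>\<infinity>(l, k)\<in>cdv_index J0. (2 powr (- real l * (\<gamma> + 1 / 2)) * u (l, k)) *\<^sub>R wavelet \<psi> (l, k))"

text \<open>
  The pairing of an element of L2 with the observation is the level-wise limit of the series of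
  products of coefficients, which converges almost surely, although in general not absolutely.
\<close>

definition obs_pairing :: "nat \<Rightarrow> (nat \<Rightarrow> nat \<Rightarrow> real \<Rightarrow> real) \<Rightarrow> l2 \<Rightarrow> (nat \<times> nat \<Rightarrow> real) \<Rightarrow> real"
  where "obs_pairing J0 \<psi> f X =
    lim (\<lambda>L. \<Sum>i\<in>{i \<in> cdv_index J0. fst i \<le> L}. coef \<psi> f i * X i)"

definition likelihood :: "nat \<Rightarrow> (nat \<Rightarrow> nat \<Rightarrow> real \<Rightarrow> real) \<Rightarrow> nat \<Rightarrow> (nat \<times> nat \<Rightarrow> real) \<Rightarrow> l2 \<Rightarrow> real"
  where "likelihood J0 \<psi> n X f =
    exp (real n * obs_pairing J0 \<psi> f X - real n / 2 * (norm f)\<^sup>2)"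

definition posterior :: "nat \<Rightarrow> (nat \<Rightarrow> nat \<Rightarrow> real \<Rightarrow> real) \<Rightarrow> l2 measure \<Rightarrow> nat \<Rightarrow>
    (nat \<times> nat \<Rightarrow> real) \<Rightarrow> l2 measure"
  where "posterior J0 \<psi> prior n X = density prior
    (\<lambda>f. ennreal (likelihood J0 \<psi> n X f) / (\<integral>\<^sup>+g. ennreal (likelihood J0 \<psi> n X g) \<partial>prior))"

definition posterior_mean :: "nat \<Rightarrow> (nat \<Rightarrow> nat \<Rightarrow> real \<Rightarrow> real) \<Rightarrow> l2 measure \<Rightarrow> nat \<Rightarrow>
    (nat \<times> nat \<Rightarrow> real) \<Rightarrow> l2"
  where "posterior_mean J0 \<psi> prior n X = (LINT f|posterior J0 \<psi> prior n X. f)"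

definition H_ball :: "nat \<Rightarrow> (nat \<Rightarrow> nat \<Rightarrow> real \<Rightarrow> real) \<Rightarrow> real \<Rightarrow> l2 \<Rightarrow> real \<Rightarrow> l2 set"
  where "H_ball J0 \<psi> \<delta> f r = {g. H_norm J0 \<delta> (coef \<psi> (g - f)) \<le> r}"

definition credible_set :: "nat \<Rightarrow> (nat \<Rightarrow> nat \<Rightarrow> real \<Rightarrow> real) \<Rightarrow> real \<Rightarrow> real \<Rightarrow> real \<Rightarrow> l2 \<Rightarrow> real \<Rightarrow> l2 set"
  where "credible_set J0 \<psi> \<gamma> M \<delta> f r =
    {g \<in> C_space J0 \<psi> \<gamma>. C_norm J0 \<psi> \<gamma> g \<le> M} \<inter> H_ball J0 \<psi> \<delta> f r"

text \<open>
  Stochastic boundedness, with the exceptional event covered by a measurable one, so that no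
  measurability of Z is presupposed.
\<close>

definition bigO_P :: "(nat \<Rightarrow> 'a measure) \<Rightarrow> (nat \<Rightarrow> 'a \<Rightarrow> real) \<Rightarrow> (nat \<Rightarrow> real) \<Rightarrow> bool"
  where "bigO_P P Z r \<longleftrightarrow> (\<forall>\<epsilon>>0. \<exists>K>0. \<forall>\<^sub>F n in sequentially.
    \<exists>A\<in>sets (P n). measure (P n) A \<ge> 1 - \<epsilon> \<and> (\<forall>x\<in>A. \<bar>Z n x\<bar> \<le> K * r n))"

end

theory Submission
  imports Defs "HOL-Real_Asymp.Real_Asymp"
begin

text \<open>
  In the wavelet basis the prior is a product of uniform laws on shrinking intervals, so almost surely
  the posterior is a product of Gaussian laws with variance 1/n, centred at the observed coefficients
  and truncated to these intervals.  Integration by parts in one variable shows that every posterior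
  variance is at most 1/n, and this alone bounds the credible radius and, by splitting the levels, the
  diameter.

  For coverage, realise all experiments on one probability space by a single noise sequence z.  The true
  coefficients are interior points, so for fixed z the rescaled truncation intervals exhaust the line:
  the rescaled posterior coefficients become independent standard Gaussians, while the rescaled distance
  from the truth to the posterior mean tends to the norm of z.  The variance bound makes the
  contribution of high levels to the weak norm uniformly small, hence the posterior law of the rescaled
  distance converges weakly, for almost every z, to the law of that norm, which has no atoms.  The truth
  is therefore covered asymptotically exactly when the norm of z lies below its own (1 - alpha)-quantile.
\<close>

section \<open>Truncated normal distributions\<close>

text \<open>The distance from \<open>coef \<psi> f0 i\<close> to the edge \<open>decay i * M\<close>
  shrinks with the level, so for each n the truncation still dominates at all high levels and the
  posterior as a whole is never close to a Gaussian product. Convergence is therefore only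
  coordinatewise, without uniformity in i. The passage to the weak norm rests on two bounds free of
  n: the variance bound, and a bound of the squared rescaled posterior mean by
  \<open>2 + (z i)^2\<close>. Both are summable against the weights (the second for almost every z)
  because \<delta> > 1/2.

  A second obstacle is the pairing in the likelihood, which need not converge absolutely. Hence the
  infinite product is never evaluated: finitely many factors are split off at a time, and the
  remainder enters only through its integral, which must be finite and then cancels against the
  evidence.

  For the diameter, the cut-off level satisfies 2^L ~ n^(1/(2\<gamma>+1)), which balances the term
  2^L/n of the low levels against the term 2^(-2\<gamma>L) of the high ones. The inverse weight
  contributes the logarithm, with \<kappa> = \<delta>.\<close>

abbreviation std_normal :: "real measure"
  where "std_normal \<equiv> density lborel std_normal_density"

abbreviation trunc_normal :: "real \<Rightarrow> real \<Rightarrow> real measure"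
  where "trunc_normal a c \<equiv> uniform_measure std_normal {a..c}"

text \<open>The mean of \<open>trunc_normal a c\<close> in closed form:
  \<open>- std_normal_density\<close> is a primitive of
  \<open>y * std_normal_density y\<close>.\<close>

definition trunc_mean :: "real \<Rightarrow> real \<Rightarrow> real"
  where "trunc_mean a c =
    (std_normal_density a - std_normal_density c) / measure std_normal {a..c}"

lemma prob_space_std_normal: "prob_space std_normal"
  by (rule prob_space_normal_density) simp

lemma real_distribution_std_normal: "real_distribution std_normal"
  by (intro real_distribution.intro prob_space_std_normal real_distribution_axioms.intro) auto

lemma emeasure_std_normal_Icc_pos:
  assumes "a < c" shows "emeasure std_normal {a..c} \<noteq> 0"
proof
  assume "emeasure std_normal {a..c} = 0"
  then have "AE y in lborel. ennreal (std_normal_density y) * indicator {a..c} y = 0"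
    by (simp add: emeasure_density nn_integral_0_iff_AE)
  then have "AE y in lborel. y \<notin> {a..c}"
  proof eventually_elim
    case (elim y)
    have "std_normal_density y > 0" by (rule normal_density_pos) simp
    with elim show ?case by (auto simp: indicator_def split: if_splits)
  qed
  then have "emeasure lborel {a..c} = 0"
    by (subst (asm) AE_iff_measurable[of "{a..c}"]) auto
  with assms show False by simp
qed

lemma measure_std_normal_Icc_pos:
  assumes "a < c" shows "0 < measure std_normal {a..c}"
proof -
  interpret prob_space std_normal by (rule prob_space_std_normal)
  show ?thesis using emeasure_std_normal_Icc_pos[OF assms]
    by (simp add: emeasure_eq_measure zero_less_measure_iff)
qed

lemma prob_space_trunc_normal:
  assumes "a < c" shows "prob_space (trunc_normal a c)"
proof -
  interpret prob_space std_normal by (rule prob_space_std_normal)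
  show ?thesis
    by (rule prob_space_uniform_measure[OF emeasure_std_normal_Icc_pos[OF assms]])
      (simp add: emeasure_eq_measure)
qed

text \<open>The fundamental theorem of calculus: a moment of the truncated law is read off from the
  boundary values of a primitive of \<open>g\<close> times the density.\<close>

lemma has_bochner_integral_trunc_normal:
  assumes "a < c" and F: "\<And>y. (F has_real_derivative g y * std_normal_density y) (at y)"
    and g: "\<And>y. isCont g y"
  shows "has_bochner_integral (trunc_normal a c) g ((F c - F a) / measure std_normal {a..c})"
proof -
  let ?p = "measure std_normal {a..c}"
  interpret prob_space std_normal by (rule prob_space_std_normal)
  have p: "?p > 0" by (rule measure_std_normal_Icc_pos) fact
  have gm[measurable]: "g \<in> borel_measurable borel"
    using g by (intro borel_measurable_continuous_onI) (simp add: continuous_at_imp_continuous_on)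
  have nd: "isCont (\<lambda>y. std_normal_density y) y" for y
    unfolding normal_density_def by (intro continuous_intros) auto
  have "has_bochner_integral lborel
      (\<lambda>y. (g y * std_normal_density y) * indicator {a..c} y) (F c - F a)"
    by (rule has_bochner_integral_FTC_Icc_real)
      (use assms nd in \<open>auto intro!: continuous_intros\<close>)
  then have "has_bochner_integral lborel
      (\<lambda>y. (g y * std_normal_density y) * indicator {a..c} y / ?p) ((F c - F a) / ?p)"
    by (rule has_bochner_integral_divide_zero)
  then have "has_bochner_integral lborel
      (\<lambda>y. std_normal_density y *\<^sub>R ((indicator {a..c} y / ?p) *\<^sub>R g y)) ((F c - F a) / ?p)"
    by (simp add: mult_ac)
  then have "has_bochner_integral std_normal
      (\<lambda>y. ((indicator {a..c} y / ?p) *\<^sub>R g y)) ((F c - F a) / ?p)"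
    by (rule has_bochner_integral_density[rotated 3]) (auto simp: normal_density_nonneg)
  then have "has_bochner_integral (density std_normal (\<lambda>y. ennreal (indicator {a..c} y / ?p)))
      g ((F c - F a) / ?p)"
    by (rule has_bochner_integral_density[rotated 3]) (auto simp: p less_imp_le)
  also have "density std_normal (\<lambda>y. ennreal (indicator {a..c} y / ?p)) = trunc_normal a c"
    unfolding uniform_measure_def
    by (intro density_cong) (auto simp: emeasure_eq_measure p indicator_def simp flip: divide_ennreal)
  finally show ?thesis .
qed

lemma DERIV_std_normal_density:
  "(std_normal_density has_real_derivative - y * std_normal_density y) (at y)"
  unfolding normal_density_def
  by (auto intro!: derivative_eq_intros simp: field_simps)

lemma has_bochner_integral_trunc_normal_mean:
  assumes "a < c"
  shows "has_bochner_integral (trunc_normal a c) (\<lambda>y. y) (trunc_mean a c)"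
proof -
  have "has_bochner_integral (trunc_normal a c) (\<lambda>y. y)
      ((- std_normal_density c - - std_normal_density a) / measure std_normal {a..c})"
    by (rule has_bochner_integral_trunc_normal[OF assms])
      (use DERIV_minus[OF DERIV_std_normal_density] in auto)
  then show ?thesis by (simp add: trunc_mean_def)
qed

lemma has_bochner_integral_trunc_normal_sq:
  assumes "a < c"
  shows "has_bochner_integral (trunc_normal a c) (\<lambda>y. y\<^sup>2)
    (1 - (c * std_normal_density c - a * std_normal_density a) / measure std_normal {a..c})"
proof -
  interpret prob_space "trunc_normal a c" by (rule prob_space_trunc_normal) fact
  \<comment> \<open>The primitive \<open>- y * std_normal_density y\<close> belongs to
    \<open>y^2 - 1\<close> rather than to \<open>y^2\<close>; the constant is added back
    afterwards.\<close>
  have "has_bochner_integral (trunc_normal a c) (\<lambda>y. y\<^sup>2 - 1)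
      ((- c * std_normal_density c - - a * std_normal_density a) / measure std_normal {a..c})"
  proof (rule has_bochner_integral_trunc_normal[OF assms])
    fix y :: real
    have "((\<lambda>y. - y * std_normal_density y) has_real_derivative
        - 1 * std_normal_density y + - y * std_normal_density y * - y) (at y)"
      by (rule DERIV_mult[OF DERIV_minus[OF DERIV_ident] DERIV_std_normal_density])
    then show "((\<lambda>y. - y * std_normal_density y) has_real_derivative
        (y\<^sup>2 - 1) * std_normal_density y) (at y)"
      by (simp add: algebra_simps power2_eq_square)
  qed auto
  moreover have U: "measure (trunc_normal a c) UNIV = 1"
    using prob_space.prob_space[OF prob_space_trunc_normal[OF assms]]
    by (simp del: measure_uniform_measure)
  then have "has_bochner_integral (trunc_normal a c) (\<lambda>y. 1 :: real) 1"
    by (simp add: has_bochner_integral_iff U del: measure_uniform_measure)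
  ultimately have "has_bochner_integral (trunc_normal a c) (\<lambda>y. (y\<^sup>2 - 1) + 1)
      ((- c * std_normal_density c - - a * std_normal_density a) / measure std_normal {a..c} + 1)"
    by (rule has_bochner_integral_add)
  then show ?thesis by (simp add: diff_divide_distrib algebra_simps)
qed

text \<open>Integration by parts; the boundary terms have the right sign because s lies in [a, c].\<close>

lemma trunc_normal_moment_le:
  assumes "a < c" "a \<le> s" "s \<le> c"
  shows "(LINT y|trunc_normal a c. y\<^sup>2) - s * trunc_mean a c \<le> 1"
proof -
  let ?p = "measure std_normal {a..c}"
  have "0 \<le> ((c - s) * std_normal_density c + (s - a) * std_normal_density a) / ?p"
    using assms by (intro divide_nonneg_nonneg add_nonneg_nonneg mult_nonneg_nonneg) auto
  also have "\<dots> = (c * std_normal_density c - a * std_normal_density a) / ?p + s * trunc_mean a c"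
    using measure_std_normal_Icc_pos[OF assms(1)] unfolding trunc_mean_def by (simp add: field_simps)
  finally show ?thesis
    using has_bochner_integral_trunc_normal_sq[OF assms(1)] by (simp add: has_bochner_integral_iff)
qed

lemma trunc_mean_in:
  assumes "a < c" shows "a \<le> trunc_mean a c" "trunc_mean a c \<le> c"
proof -
  interpret prob_space "trunc_normal a c" by (rule prob_space_trunc_normal) fact
  note m = has_bochner_integral_trunc_normal_mean[OF assms, unfolded has_bochner_integral_iff]
  have ae: "AE y in trunc_normal a c. a \<le> y" "AE y in trunc_normal a c. y \<le> c"
    by (simp_all add: AE_uniform_measureI)
  show "a \<le> trunc_mean a c"
    using integral_ge_const[OF conjunct1[OF m] ae(1)] conjunct2[OF m] by (simp only:)
  show "trunc_mean a c \<le> c"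
    using integral_le_const[OF conjunct1[OF m] ae(2)] conjunct2[OF m] by (simp only:)
qed

text \<open>The mean is itself a point of [a, c], and with this choice of s the left side of
  \<open>trunc_normal_moment_le\<close> is the variance. The bound 1 holds however short or remote
  the interval is.\<close>

lemma trunc_normal_variance:
  assumes "a < c"
  shows "integrable (trunc_normal a c) (\<lambda>y. (y - trunc_mean a c)\<^sup>2)"
    "(LINT y|trunc_normal a c. (y - trunc_mean a c)\<^sup>2) \<le> 1"
proof -
  interpret prob_space "trunc_normal a c" by (rule prob_space_trunc_normal) fact
  note m = has_bochner_integral_trunc_normal_mean[OF assms, unfolded has_bochner_integral_iff]
  note s = has_bochner_integral_trunc_normal_sq[OF assms, unfolded has_bochner_integral_iff]
  have U: "prob UNIV = 1" using prob_space by (simp del: measure_uniform_measure)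
  let ?m = "trunc_mean a c"
  have *: "(\<lambda>y. (y - ?m)\<^sup>2) = (\<lambda>y. y\<^sup>2 - 2 * ?m * y + ?m\<^sup>2)"
    by (auto simp: power2_eq_square algebra_simps)
  show "integrable (trunc_normal a c) (\<lambda>y. (y - ?m)\<^sup>2)"
    unfolding * using m s by auto
  have "(LINT y|trunc_normal a c. (y - ?m)\<^sup>2) = (LINT y|trunc_normal a c. y\<^sup>2) - 2 * ?m * ?m + ?m\<^sup>2"
    unfolding * using m s by (simp add: U del: measure_uniform_measure)
  also have "\<dots> \<le> 1"
    using trunc_normal_moment_le[OF assms trunc_mean_in[OF assms]] by (simp add: power2_eq_square)
  finally show "(LINT y|trunc_normal a c. (y - ?m)\<^sup>2) \<le> 1" .
qed

text \<open>With m the mean, m^2 is at most the second moment, hence at most 1 + s m, and s m is at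
  most (s^2 + m^2) / 2. Any point s of the interval yields a bound that ignores the endpoints, which
  is what domination in n requires.\<close>

lemma trunc_mean_sq_le:
  assumes "a < c" "a \<le> s" "s \<le> c"
  shows "(trunc_mean a c)\<^sup>2 \<le> 2 + s\<^sup>2"
proof -
  interpret prob_space "trunc_normal a c" by (rule prob_space_trunc_normal) fact
  note m = has_bochner_integral_trunc_normal_mean[OF assms(1), unfolded has_bochner_integral_iff]
  note sq = has_bochner_integral_trunc_normal_sq[OF assms(1), unfolded has_bochner_integral_iff]
  have U: "prob UNIV = 1" using prob_space by (simp del: measure_uniform_measure)
  let ?m = "trunc_mean a c"
  have *: "(\<lambda>y. (y - ?m)\<^sup>2) = (\<lambda>y. y\<^sup>2 - 2 * ?m * y + ?m\<^sup>2)"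
    by (auto simp: power2_eq_square algebra_simps)
  have "0 \<le> (LINT y|trunc_normal a c. (y - ?m)\<^sup>2)" by simp
  also have "\<dots> = (LINT y|trunc_normal a c. y\<^sup>2) - 2 * ?m * ?m + ?m\<^sup>2"
    unfolding * using m sq by (simp add: U del: measure_uniform_measure)
  finally have "?m\<^sup>2 \<le> (LINT y|trunc_normal a c. y\<^sup>2)" by (simp add: power2_eq_square)
  with trunc_normal_moment_le[OF assms] have "?m\<^sup>2 \<le> 1 + s * ?m" by linarith
  moreover have "2 * (s * ?m) \<le> s\<^sup>2 + ?m\<^sup>2" using sum_squares_bound[of s ?m] by simp
  ultimately show ?thesis by linarith
qed

section \<open>Truncation intervals that exhaust the line\<close>

lemma std_normal_Icc_tendsto:
  assumes a: "filterlim a at_bot F" and c: "filterlim c at_top F"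
  shows "((\<lambda>n. measure std_normal {a n..c n}) \<longlongrightarrow> 1) F"
proof -
  interpret real_distribution std_normal by (rule real_distribution_std_normal)
  have lim: "((\<lambda>n. cdf std_normal (c n) - cdf std_normal (a n)) \<longlongrightarrow> 1 - 0) F"
    by (intro tendsto_diff filterlim_compose[OF cdf_lim_at_top_prob c] filterlim_compose[OF cdf_lim_at_bot a])
  have lower: "\<forall>\<^sub>F n in F. cdf std_normal (c n) - cdf std_normal (a n) \<le> measure std_normal {a n..c n}"
  proof (intro always_eventually allI)
    fix n
    have "cdf std_normal (c n) \<le> measure std_normal ({..a n} \<union> {a n..c n})"
      unfolding cdf_def by (intro finite_measure_mono) auto
    also have "\<dots> \<le> cdf std_normal (a n) + measure std_normal {a n..c n}"
      unfolding cdf_def by (rule measure_Un_le) auto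
    finally show "cdf std_normal (c n) - cdf std_normal (a n) \<le> measure std_normal {a n..c n}" by simp
  qed
  have upper: "\<forall>\<^sub>F n in F. measure std_normal {a n..c n} \<le> 1" by simp
  show ?thesis using tendsto_sandwich[OF lower upper lim] by simp
qed

lemma trunc_mean_tendsto_0:
  assumes a: "filterlim a at_bot F" and c: "filterlim c at_top F"
  shows "((\<lambda>n. trunc_mean (a n) (c n)) \<longlongrightarrow> 0) F"
proof -
  have lim: "((\<lambda>x. std_normal_density x) \<longlongrightarrow> 0) at_top"
  proof -
    have "((\<lambda>x::real. 1 / sqrt (2 * pi) * exp (- x\<^sup>2 / 2)) \<longlongrightarrow> 0) at_top"
      by (rule tendsto_mult_right_zero) real_asymp
    then show ?thesis by (simp only: std_normal_density_def)
  qed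
  have "((\<lambda>n. std_normal_density (c n)) \<longlongrightarrow> 0) F"
    by (rule filterlim_compose[OF lim c])
  moreover have "((\<lambda>n. std_normal_density (- a n)) \<longlongrightarrow> 0) F"
    by (rule filterlim_compose[OF lim filterlim_compose[OF filterlim_uminus_at_top_at_bot a]])
  then have "((\<lambda>n. std_normal_density (a n)) \<longlongrightarrow> 0) F"
    by (simp only: std_normal_density_def power2_minus)
  ultimately have "((\<lambda>n. trunc_mean (a n) (c n)) \<longlongrightarrow> (0 - 0) / 1) F"
    unfolding trunc_mean_def
    by (intro tendsto_divide tendsto_diff std_normal_Icc_tendsto a c) auto
  then show ?thesis by simp
qed

section \<open>Orthonormal series in a Hilbert space\<close>

lemma eventually_finite_subsets_at_top_summable_close:
  fixes f :: "'i \<Rightarrow> real"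
  assumes "f summable_on I" "d > 0"
  obtains G where "finite G" "G \<subseteq> I"
    "\<And>F. finite F \<Longrightarrow> G \<subseteq> F \<Longrightarrow> F \<subseteq> I \<Longrightarrow> \<bar>sum f F - infsum f I\<bar> < d"
proof -
  have "\<forall>\<^sub>F F in finite_subsets_at_top I. dist (sum f F) (infsum f I) < d"
    using infsum_tendsto[OF assms(1)] assms(2) by (simp add: tendsto_iff)
  then obtain G where "finite G" "G \<subseteq> I"
    "\<And>F. finite F \<and> G \<subseteq> F \<and> F \<subseteq> I \<Longrightarrow> dist (sum f F) (infsum f I) < d"
    unfolding eventually_finite_subsets_at_top by auto
  then show ?thesis by (intro that[of G]) (auto simp: dist_real_def)
qed

text \<open>Orthonormality without density of the span; Parseval's identity is the result that adds
  the density.\<close>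

definition orthonormal_on :: "'i set \<Rightarrow> ('i \<Rightarrow> 'a::real_inner) \<Rightarrow> bool"
  where "orthonormal_on I b \<longleftrightarrow> (\<forall>i\<in>I. \<forall>j\<in>I. b i \<bullet> b j = (if i = j then 1 else 0))"

lemma orthonormal_basis_imp_on: "orthonormal_basis I b \<Longrightarrow> orthonormal_on I b"
  by (auto simp: orthonormal_basis_def orthonormal_on_def)

lemma orthonormal_inner_sum:
  assumes "orthonormal_on I b" "finite F" "F \<subseteq> I" "i \<in> I"
  shows "b i \<bullet> (\<Sum>j\<in>F. c j *\<^sub>R b j) = (if i \<in> F then c i else 0)"
proof -
  have "b i \<bullet> (\<Sum>j\<in>F. c j *\<^sub>R b j) = (\<Sum>j\<in>F. if j = i then c i else 0)"
    unfolding inner_sum_right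
    using assms by (intro sum.cong) (auto simp: orthonormal_on_def subset_eq)
  then show ?thesis using assms by (simp add: sum.delta)
qed

lemma orthonormal_norm_sum:
  assumes "orthonormal_on I b" "finite F" "F \<subseteq> I"
  shows "(norm (\<Sum>i\<in>F. c i *\<^sub>R b i))\<^sup>2 = (\<Sum>i\<in>F. (c i)\<^sup>2)"
proof -
  have "(norm (\<Sum>i\<in>F. c i *\<^sub>R b i))\<^sup>2 = (\<Sum>i\<in>F. c i * (b i \<bullet> (\<Sum>j\<in>F. c j *\<^sub>R b j)))"
    unfolding power2_norm_eq_inner by (subst inner_sum_left) simp
  also have "\<dots> = (\<Sum>i\<in>F. (c i)\<^sup>2)"
    using assms by (intro sum.cong) (auto simp: orthonormal_inner_sum subset_eq power2_eq_square)
  finally show ?thesis .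
qed

text \<open>Completing the square in each coefficient. The last sum vanishes for
  \<open>c i = b i \<bullet> x\<close>, which gives Bessel's inequality; for every other choice it
  is nonnegative, which is what Parseval's identity uses.\<close>

lemma orthonormal_norm_diff:
  assumes "orthonormal_on I b" "finite F" "F \<subseteq> I"
  shows "(norm (x - (\<Sum>i\<in>F. c i *\<^sub>R b i)))\<^sup>2 =
    (norm x)\<^sup>2 - (\<Sum>i\<in>F. (b i \<bullet> x)\<^sup>2) + (\<Sum>i\<in>F. (c i - b i \<bullet> x)\<^sup>2)"
proof -
  let ?y = "\<Sum>i\<in>F. c i *\<^sub>R b i"
  have "(norm (x - ?y))\<^sup>2 = (norm x)\<^sup>2 - 2 * (?y \<bullet> x) + (norm ?y)\<^sup>2"
    unfolding power2_norm_eq_inner by (simp add: inner_diff_left inner_diff_right inner_commute)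
  also have "?y \<bullet> x = (\<Sum>i\<in>F. c i * (b i \<bullet> x))" by (simp add: inner_sum_left)
  also have "(norm ?y)\<^sup>2 = (\<Sum>i\<in>F. (c i)\<^sup>2)" by (rule orthonormal_norm_sum[OF assms])
  finally show ?thesis
    by (simp add: power2_diff sum.distrib sum_subtractf sum_distrib_left algebra_simps)
qed

lemma bessel:
  assumes "orthonormal_on I b" "finite F" "F \<subseteq> I"
  shows "(\<Sum>i\<in>F. (b i \<bullet> x)\<^sup>2) \<le> (norm x)\<^sup>2"
  using orthonormal_norm_diff[OF assms, of x "\<lambda>i. b i \<bullet> x"]
    zero_le_power2[of "norm (x - (\<Sum>i\<in>F. (b i \<bullet> x) *\<^sub>R b i))"] by simp

lemma orthonormal_coef_summable:
  assumes "orthonormal_on I b"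
  shows "(\<lambda>i. (b i \<bullet> x)\<^sup>2) summable_on I"
  by (rule nonneg_bdd_above_summable_on) (auto intro!: bdd_aboveI bessel[OF assms])

text \<open>Density of the span supplies a finite combination y with |x - y|^2 at most e. Since the
  coefficients of x are the best ones on the same finite index set, the partial sum of squares over
  it already exceeds |x|^2 - e.\<close>

lemma parseval:
  assumes onb: "orthonormal_basis I b"
  shows "((\<lambda>i. (b i \<bullet> x)\<^sup>2) has_sum (norm x)\<^sup>2) I"
proof -
  have on: "orthonormal_on I b" using onb by (rule orthonormal_basis_imp_on)
  note s = orthonormal_coef_summable[OF on, of x]
  have inj: "inj_on b I"
    using onb by (auto simp: orthonormal_basis_def inj_on_def) (metis zero_neq_one)
  have "(norm x)\<^sup>2 \<le> infsum (\<lambda>i. (b i \<bullet> x)\<^sup>2) I + e" if "e > 0" for e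
  proof -
    have "x \<in> closure (span (b ` I))" using onb by (simp add: orthonormal_basis_def)
    then obtain y where y: "y \<in> span (b ` I)" "dist y x < sqrt e"
      unfolding closure_approachable using \<open>e > 0\<close> by (metis real_sqrt_gt_0_iff)
    then obtain T r where T: "finite T" "T \<subseteq> b ` I" "y = (\<Sum>v\<in>T. r v *\<^sub>R v)"
      unfolding span_explicit by auto
    then obtain F where F: "F \<subseteq> I" "T = b ` F" by (meson subset_imageE)
    with inj have injF: "inj_on b F" by (meson inj_on_subset)
    with T F have fF: "finite F" by (simp add: finite_image_iff)
    have yF: "y = (\<Sum>i\<in>F. r (b i) *\<^sub>R b i)" using T F injF by (simp add: sum.reindex)
    have "(norm (x - y))\<^sup>2 \<le> (sqrt e)\<^sup>2"
      by (rule power_mono) (use y in \<open>simp_all add: dist_norm norm_minus_commute\<close>)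
    then have "(norm (x - y))\<^sup>2 \<le> e" using \<open>e > 0\<close> by simp
    moreover have "(norm x)\<^sup>2 - (\<Sum>i\<in>F. (b i \<bullet> x)\<^sup>2) \<le> (norm (x - y))\<^sup>2"
      unfolding yF orthonormal_norm_diff[OF on fF F(1)] by (simp add: sum_nonneg)
    moreover have "(\<Sum>i\<in>F. (b i \<bullet> x)\<^sup>2) \<le> infsum (\<lambda>i. (b i \<bullet> x)\<^sup>2) I"
      by (rule finite_sum_le_infsum[OF s fF F(1)]) simp
    ultimately show ?thesis by linarith
  qed
  then have "(norm x)\<^sup>2 \<le> infsum (\<lambda>i. (b i \<bullet> x)\<^sup>2) I" by (rule field_le_epsilon)
  moreover have "infsum (\<lambda>i. (b i \<bullet> x)\<^sup>2) I \<le> (norm x)\<^sup>2"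
    by (rule infsum_le_finite_sums[OF s]) (rule bessel[OF on])
  ultimately show ?thesis using has_sum_infsum[OF s] by simp
qed

text \<open>The Cauchy criterion along finite subsets: by Pythagoras the squared norm of a block
  outside G is a block of the series of \<open>(c i)^2\<close>.\<close>

lemma orthonormal_series_summable:
  fixes b :: "'i \<Rightarrow> 'a::{real_inner, banach}"
  assumes on: "orthonormal_on I b" and c: "(\<lambda>i. (c i)\<^sup>2) summable_on I"
  shows "(\<lambda>i. c i *\<^sub>R b i) summable_on I"
proof -
  let ?f = "\<lambda>i. c i *\<^sub>R b i" and ?s = "infsum (\<lambda>i. (c i)\<^sup>2) I"
  have "\<exists>P. eventually P (finite_subsets_at_top I) \<and>
      (\<forall>F F'. P F \<and> P F' \<longrightarrow> dist (sum ?f F) (sum ?f F') < e)" if "e > 0" for e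
  proof -
    \<comment> \<open>Comparing F and G with the total sum costs e^2/8 twice, so the block F - G has
      squared norm below (e/2)^2; the triangle inequality through G then gives e.\<close>
    obtain G where G: "finite G" "G \<subseteq> I"
      and close: "\<And>F. finite F \<Longrightarrow> G \<subseteq> F \<Longrightarrow> F \<subseteq> I \<Longrightarrow> \<bar>(\<Sum>i\<in>F. (c i)\<^sup>2) - ?s\<bar> < e\<^sup>2 / 8"
      using eventually_finite_subsets_at_top_summable_close[OF c, of "e\<^sup>2 / 8"] \<open>e > 0\<close> by auto
    define P where "P F \<longleftrightarrow> finite F \<and> G \<subseteq> F \<and> F \<subseteq> I" for F
    have "dist (sum ?f F) (sum ?f G) < e / 2" if "P F" for F
    proof -
      have F: "finite F" "G \<subseteq> F" "F \<subseteq> I" using that by (auto simp: P_def)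
      have "(norm (sum ?f (F - G)))\<^sup>2 = (\<Sum>i\<in>F - G. (c i)\<^sup>2)"
        by (rule orthonormal_norm_sum[OF on]) (use F in auto)
      also have "\<dots> = (\<Sum>i\<in>F. (c i)\<^sup>2) - (\<Sum>i\<in>G. (c i)\<^sup>2)"
        by (rule sum_diff) (use F in auto)
      also have "\<dots> < e\<^sup>2 / 4"
        using close[OF F(1,2,3)] close[OF G(1) order.refl G(2)] by linarith
      also have "\<dots> = (e / 2)\<^sup>2" by (simp add: power_divide)
      finally have "norm (sum ?f (F - G)) < e / 2"
        by (rule power_less_imp_less_base) (use \<open>e > 0\<close> in simp)
      moreover have "sum ?f (F - G) = sum ?f F - sum ?f G" by (rule sum_diff) (use F in auto)
      ultimately show ?thesis by (simp add: dist_norm)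
    qed
    then have "dist (sum ?f F) (sum ?f F') < e" if "P F" "P F'" for F F'
      using that dist_triangle2[of "sum ?f F" "sum ?f F'" "sum ?f G"] by (smt (verit) field_sum_of_halves)
    moreover have "eventually P (finite_subsets_at_top I)"
      unfolding eventually_finite_subsets_at_top P_def using G by auto
    ultimately show ?thesis by auto
  qed
  then have "cauchy_filter (filtermap (sum ?f) (finite_subsets_at_top I))"
    by (simp add: cauchy_filter_metric_filtermap)
  \<comment> \<open>Sequential completeness is turned into completeness for Cauchy filters, the form
    that a net of finite sets requires.\<close>
  moreover have "uniform_space_class.complete (UNIV :: 'a set)"
    by (meson Cauchy_convergent UNIV_I complete_def convergent_def)
  ultimately obtain L where "(sum ?f \<longlongrightarrow> L) (finite_subsets_at_top I)"
    using complete_uniform[where S="UNIV :: 'a set"] by (force simp add: filterlim_def)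
  then show ?thesis
    using summable_on_def has_sum_def by blast
qed

lemma orthonormal_series_coef:
  assumes on: "orthonormal_on I b" and s: "(\<lambda>i. c i *\<^sub>R b i) summable_on I" and i: "i \<in> I"
  shows "b i \<bullet> (\<Sum>\<^sub>\<infinity>j\<in>I. c j *\<^sub>R b j) = c i"
proof -
  have "((\<lambda>j. b i \<bullet> (c j *\<^sub>R b j)) has_sum (b i \<bullet> (\<Sum>\<^sub>\<infinity>j\<in>I. c j *\<^sub>R b j))) I"
    using has_sum_bounded_linear[OF bounded_linear_inner_right has_sum_infsum[OF s], of "b i"]
    by (simp add: o_def)
  moreover have "((\<lambda>j. b i \<bullet> (c j *\<^sub>R b j)) has_sum c i) I"
    using on i by (intro has_sum_finite_neutralI[of "{i}"]) (auto simp: orthonormal_on_def)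
  ultimately show ?thesis by (rule has_sum_unique)
qed

text \<open>Describes where a vector series converges by a nonnegative real series, whose set of
  convergence is visibly measurable.\<close>

lemma orthonormal_series_summable_iff:
  fixes b :: "'i \<Rightarrow> 'a::{real_inner, banach}"
  assumes on: "orthonormal_on I b"
  shows "(\<lambda>i. c i *\<^sub>R b i) summable_on I \<longleftrightarrow> (\<lambda>i. (c i)\<^sup>2) summable_on I"
proof
  assume s: "(\<lambda>i. c i *\<^sub>R b i) summable_on I"
  have "(\<lambda>i. (c i)\<^sup>2) summable_on I \<longleftrightarrow>
      (\<lambda>i. (b i \<bullet> (\<Sum>\<^sub>\<infinity>j\<in>I. c j *\<^sub>R b j))\<^sup>2) summable_on I"
    by (rule summable_on_cong) (simp add: orthonormal_series_coef[OF on s])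
  then show "(\<lambda>i. (c i)\<^sup>2) summable_on I" using orthonormal_coef_summable[OF on] by simp
qed (rule orthonormal_series_summable[OF on])

section \<open>Infinite sums as sequential limits, and their measurability\<close>

lemma filterlim_finite_subsets_at_topI:
  assumes fin: "\<And>n. finite (F n)" and sub: "\<And>n. F n \<subseteq> I"
    and ev: "\<And>i. i \<in> I \<Longrightarrow> \<forall>\<^sub>F n in sequentially. i \<in> F n"
  shows "filterlim F (finite_subsets_at_top I) sequentially"
  unfolding filterlim_iff
proof (intro allI impI)
  fix P assume "eventually P (finite_subsets_at_top I)"
  then obtain X where X: "finite X" "X \<subseteq> I" "\<forall>Y. finite Y \<and> X \<subseteq> Y \<and> Y \<subseteq> I \<longrightarrow> P Y"
    unfolding eventually_finite_subsets_at_top by (elim exE conjE)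
  have "\<forall>\<^sub>F n in sequentially. \<forall>i\<in>X. i \<in> F n"
    using X ev by (intro eventually_ball_finite) auto
  then show "\<forall>\<^sub>F n in sequentially. P (F n)"
  proof (rule eventually_mono)
    fix n assume "\<forall>i\<in>X. i \<in> F n"
    then show "P (F n)" using X(3)[rule_format, of "F n"] fin[of n] sub[of n] by (simp add: subset_iff)
  qed
qed

text \<open>Replaces the net of finite subsets by a sequence, so that sums over I become limits of
  countably many measurable functions.\<close>

lemma countable_exhaustion:
  assumes "countable I"
  obtains F :: "nat \<Rightarrow> 'i set" where "filterlim F (finite_subsets_at_top I) sequentially"
    "\<And>n. finite (F n)" "\<And>n. F n \<subseteq> I"
proof -
  define F where "F n = {i \<in> I. to_nat_on I i \<le> n}" for n
  have inj: "inj_on (to_nat_on I) I" by (rule inj_on_to_nat_on[OF assms])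
  have sub: "F n \<subseteq> I" for n by (auto simp: F_def)
  have fin: "finite (F n)" for n
  proof (rule finite_imageD)
    show "finite (to_nat_on I ` F n)" by (rule finite_subset[of _ "{..n}"]) (auto simp: F_def)
    show "inj_on (to_nat_on I) (F n)" using inj sub by (rule inj_on_subset)
  qed
  have "filterlim F (finite_subsets_at_top I) sequentially"
  proof (rule filterlim_finite_subsets_at_topI[OF fin sub])
    fix i assume "i \<in> I"
    then show "\<forall>\<^sub>F n in sequentially. i \<in> F n"
      by (intro eventually_sequentiallyI[of "to_nat_on I i"]) (simp add: F_def)
  qed
  with fin sub show thesis by (rule that[rotated])
qed

lemma has_sum_exhaustion:
  assumes "(f has_sum s) I" "filterlim F (finite_subsets_at_top I) sequentially"
  shows "(\<lambda>n. sum f (F n)) \<longlonglongrightarrow> s"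
  using assms unfolding has_sum_def by (rule filterlim_compose)

text \<open>For nonnegative terms, summability means bounded partial sums along one exhaustion,
  which is a condition with countable quantifiers only.\<close>

lemma measurable_summable_nonneg:
  fixes f :: "'i \<Rightarrow> 'b \<Rightarrow> real"
  assumes I: "countable I" and f: "\<And>i. i \<in> I \<Longrightarrow> f i \<in> borel_measurable M" "\<And>i u. i \<in> I \<Longrightarrow> 0 \<le> f i u"
  shows "{u \<in> space M. (\<lambda>i. f i u) summable_on I} \<in> sets M"
proof -
  obtain F where F: "filterlim F (finite_subsets_at_top I) sequentially"
    "\<And>n. finite (F n)" "\<And>n. F n \<subseteq> I"
    using countable_exhaustion[OF I] by blast
  have "(\<lambda>i. f i u) summable_on I \<longleftrightarrow> (\<exists>K::nat. \<forall>n. (\<Sum>i\<in>F n. f i u) \<le> real K)" for u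
  proof
    assume s: "(\<lambda>i. f i u) summable_on I"
    obtain K :: nat where K: "infsum (\<lambda>i. f i u) I \<le> real K" using real_arch_simple by blast
    have "(\<Sum>i\<in>F n. f i u) \<le> real K" for n
      using finite_sum_le_infsum[OF s F(2,3), of n] f(2) K by fastforce
    then show "\<exists>K::nat. \<forall>n. (\<Sum>i\<in>F n. f i u) \<le> real K" by blast
  next
    assume "\<exists>K::nat. \<forall>n. (\<Sum>i\<in>F n. f i u) \<le> real K"
    then obtain K :: nat where K: "\<And>n. (\<Sum>i\<in>F n. f i u) \<le> real K" by blast
    have "(\<Sum>i\<in>X. f i u) \<le> real K" if X: "finite X" "X \<subseteq> I" for X
    proof -
      have "\<forall>\<^sub>F n in sequentially. X \<subseteq> F n"
        using F(1) X unfolding filterlim_iff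
        by (elim allE[of _ "\<lambda>Y. X \<subseteq> Y"]) (auto simp: eventually_finite_subsets_at_top)
      then obtain n where n: "X \<subseteq> F n" by (auto simp: eventually_sequentially)
      have "(\<Sum>i\<in>X. f i u) \<le> (\<Sum>i\<in>F n. f i u)"
      proof (rule sum_mono2[OF F(2) n])
        fix i assume "i \<in> F n - X"
        then show "0 \<le> f i u" using f(2)[of i u] F(3)[of n] by blast
      qed
      with K show ?thesis by (meson order_trans)
    qed
    then show "(\<lambda>i. f i u) summable_on I"
      using f(2) by (intro nonneg_bdd_above_summable_on bdd_aboveI) auto
  qed
  moreover have "{u \<in> space M. \<exists>K::nat. \<forall>n. (\<Sum>i\<in>F n. f i u) \<le> real K} \<in> sets M"
  proof -
    have [measurable]: "(\<lambda>u. \<Sum>i\<in>F n. f i u) \<in> borel_measurable M" for n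
      using F(3) f(1) by (intro borel_measurable_sum) auto
    show ?thesis by measurable
  qed
  ultimately show ?thesis by simp
qed

lemma borel_measurable_infsum:
  fixes f :: "'i \<Rightarrow> 'b \<Rightarrow> 'c::{banach, second_countable_topology}"
  assumes I: "countable I" and f: "\<And>i. i \<in> I \<Longrightarrow> f i \<in> borel_measurable M"
    and S: "{u \<in> space M. (\<lambda>i. f i u) summable_on I} \<in> sets M"
  shows "(\<lambda>u. \<Sum>\<^sub>\<infinity>i\<in>I. f i u) \<in> borel_measurable M"
proof -
  obtain F where F: "filterlim F (finite_subsets_at_top I) sequentially"
    "\<And>n. finite (F n)" "\<And>n. F n \<subseteq> I"
    using countable_exhaustion[OF I] by blast
  let ?S = "{u \<in> space M. (\<lambda>i. f i u) summable_on I}"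
  have m: "(\<lambda>u. \<Sum>i\<in>F n. f i u) \<in> borel_measurable M" for n
    using F(3) f by (intro borel_measurable_sum) auto
  \<comment> \<open>Off \<open>?S\<close> the value of \<open>infsum\<close> is its default 0, while
    the limit along the exhaustion might still exist; hence the case distinction.\<close>
  have "(\<lambda>u. if u \<in> ?S then lim (\<lambda>n. \<Sum>i\<in>F n. f i u) else 0) \<in> borel_measurable M"
    using m S by (intro measurable_If_set borel_measurable_lim_metric) auto
  moreover have "(\<Sum>\<^sub>\<infinity>i\<in>I. f i u) = (if u \<in> ?S then lim (\<lambda>n. \<Sum>i\<in>F n. f i u) else 0)"
    if "u \<in> space M" for u
    using that has_sum_exhaustion[OF has_sum_infsum F(1), of "\<lambda>i. f i u"]
    by (auto simp: infsum_not_exists intro: limI[symmetric])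
  ultimately show ?thesis by (subst measurable_cong) auto
qed

lemma borel_measurable_infsum_nonneg:
  fixes f :: "'i \<Rightarrow> 'b \<Rightarrow> real"
  assumes "countable I" "\<And>i. i \<in> I \<Longrightarrow> f i \<in> borel_measurable M" "\<And>i u. i \<in> I \<Longrightarrow> 0 \<le> f i u"
  shows "(\<lambda>u. \<Sum>\<^sub>\<infinity>i\<in>I. f i u) \<in> borel_measurable M"
  using assms by (intro borel_measurable_infsum measurable_summable_nonneg) auto

lemma borel_measurable_orthonormal_series:
  fixes b :: "'i \<Rightarrow> 'a::{real_inner, banach, second_countable_topology}"
  assumes I: "countable I" and on: "orthonormal_on I b"
    and g: "\<And>i. i \<in> I \<Longrightarrow> g i \<in> borel_measurable M"
  shows "(\<lambda>u. \<Sum>\<^sub>\<infinity>i\<in>I. g i u *\<^sub>R b i) \<in> borel_measurable M"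
proof (rule borel_measurable_infsum[OF I])
  show "{u \<in> space M. (\<lambda>i. g i u *\<^sub>R b i) summable_on I} \<in> sets M"
    unfolding orthonormal_series_summable_iff[OF on]
    by (rule measurable_summable_nonneg[OF I]) (auto intro: borel_measurable_power g)
qed (auto intro!: borel_measurable_scaleR g)

section \<open>Products of probability measures\<close>

text \<open>Turns a nonnegative sum into an integral over counting measure, so that Tonelli's
  theorem can exchange it with expectations.\<close>

lemma nn_integral_count_space_eq_infsum:
  fixes f :: "'i \<Rightarrow> real"
  assumes "f summable_on I" "\<And>i. i \<in> I \<Longrightarrow> 0 \<le> f i"
  shows "(\<integral>\<^sup>+i. ennreal (f i) \<partial>count_space I) = ennreal (infsum f I)"
proof -
  have "Infinite_Set_Sum.abs_summable_on f I"
    using assms by (subst abs_summable_equivalent[symmetric]) (simp cong: summable_on_cong)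
  then show ?thesis
    using nn_integral_conv_infsetsum[of f I] assms(2) by (simp add: infsetsum_infsum)
qed

lemma summable_on_iff_nn_integral_finite:
  fixes f :: "'i \<Rightarrow> real"
  assumes "\<And>i. i \<in> I \<Longrightarrow> 0 \<le> f i"
  shows "f summable_on I \<longleftrightarrow> (\<integral>\<^sup>+i. ennreal (f i) \<partial>count_space I) < \<infinity>"
proof
  assume fin: "(\<integral>\<^sup>+i. ennreal (f i) \<partial>count_space I) < \<infinity>"
  have "(\<integral>\<^sup>+i. ennreal (norm (f i)) \<partial>count_space I) = (\<integral>\<^sup>+i. ennreal (f i) \<partial>count_space I)"
    by (rule nn_integral_cong) (simp add: assms)
  with fin have "Infinite_Set_Sum.abs_summable_on f I"
    unfolding abs_summable_on_def by (intro integrableI_bounded) auto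
  then have "(\<lambda>i. norm (f i)) summable_on I" by (rule abs_summable_equivalent[THEN iffD2])
  then show "f summable_on I" using assms by (simp cong: summable_on_cong)
qed (use nn_integral_count_space_eq_infsum[of f I] assms in simp)

lemma measurable_PiM_fun_upd_pair:
  assumes "i \<in> I"
  shows "(\<lambda>(x, y). y(i := x)) \<in> measurable (M i \<Otimes>\<^sub>M PiM (I - {i}) M) (PiM I M)"
proof -
  have "(\<lambda>(x, y). y(i := x)) \<in> measurable (M i \<Otimes>\<^sub>M PiM (I - {i}) M) (PiM (insert i (I - {i})) M)"
    by measurable
  moreover have "insert i (I - {i}) = I" using assms by auto
  ultimately show ?thesis by simp
qed

lemma nn_integral_PiM_split:
  assumes M: "\<And>j. j \<in> I \<Longrightarrow> prob_space (M j)" and i: "i \<in> I"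
    and h: "h \<in> borel_measurable (PiM I M)"
  shows "(\<integral>\<^sup>+u. h u \<partial>PiM I M) = (\<integral>\<^sup>+y. (\<integral>\<^sup>+x. h (y(i := x)) \<partial>M i) \<partial>PiM (I - {i}) M)"
proof -
  interpret Mi: prob_space "M i" using M i by auto
  interpret R: prob_space "PiM (I - {i}) M" using M by (intro prob_space_PiM) auto
  interpret P: pair_sigma_finite "M i" "PiM (I - {i}) M" ..
  note [measurable] = measurable_PiM_fun_upd_pair[OF i, of M] h
  have ins: "insert i (I - {i}) = I" using i by auto
  have "(\<integral>\<^sup>+u. h u \<partial>PiM I M) =
      (\<integral>\<^sup>+u. h u \<partial>distr (M i \<Otimes>\<^sub>M PiM (I - {i}) M) (PiM I M) (\<lambda>(x, y). y(i := x)))"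
    using distr_pair_PiM_eq_PiM[of "I - {i}" M i] M i by (simp add: insert_absorb)
  also have "\<dots> = (\<integral>\<^sup>+p. h ((\<lambda>(x, y). y(i := x)) p) \<partial>(M i \<Otimes>\<^sub>M PiM (I - {i}) M))"
    by (rule nn_integral_distr) measurable
  also have "\<dots> = (\<integral>\<^sup>+y. (\<integral>\<^sup>+x. h ((\<lambda>(x, y). y(i := x)) (x, y)) \<partial>M i) \<partial>PiM (I - {i}) M)"
    by (rule P.nn_integral_snd[symmetric]) measurable
  finally show ?thesis by simp
qed

lemma nn_integral_PiM_factor1:
  assumes M: "\<And>j. j \<in> I \<Longrightarrow> prob_space (M j)" and i: "i \<in> I"
    and g: "g \<in> borel_measurable (M i)" and h: "h \<in> borel_measurable (PiM I M)"
    and indep: "\<And>u x. u \<in> space (PiM I M) \<Longrightarrow> x \<in> space (M i) \<Longrightarrow> h (u(i := x)) = h u"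
  shows "(\<integral>\<^sup>+u. g (u i) * h u \<partial>PiM I M) = (\<integral>\<^sup>+x. g x \<partial>M i) * (\<integral>\<^sup>+u. h u \<partial>PiM I M)"
proof -
  interpret Mi: prob_space "M i" using M i by auto
  \<comment> \<open>Since h ignores coordinate i, that coordinate can be frozen at
    \<open>x0\<close>; this gives a measurable function of the remaining coordinates.\<close>
  obtain x0 where x0: "x0 \<in> space (M i)" using Mi.not_empty by auto
  note [measurable] = h g measurable_PiM_fun_upd_pair[OF i, of M]
  have gm: "(\<lambda>u. g (u i)) \<in> borel_measurable (PiM I M)"
    using i by measurable
  have upd: "y(i := x) \<in> space (PiM I M)" if "y \<in> space (PiM (I - {i}) M)" "x \<in> space (M i)" for y x
    using measurable_space[OF measurable_PiM_fun_upd_pair[OF i, of M], of "(x, y)"] that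
    by (simp add: space_pair_measure)
  have eq: "h (y(i := x)) = h (y(i := x0))"
    if "y \<in> space (PiM (I - {i}) M)" "x \<in> space (M i)" for y x
    using indep[OF upd[OF that(1) x0] that(2)] by simp
  have hm: "(\<lambda>y. h (y(i := x0))) \<in> borel_measurable (PiM (I - {i}) M)"
  proof -
    have "(\<lambda>y. (x0, y)) \<in> measurable (PiM (I - {i}) M) (M i \<Otimes>\<^sub>M PiM (I - {i}) M)"
      using x0 by simp
    from measurable_compose[OF measurable_compose[OF this measurable_PiM_fun_upd_pair[OF i]] h]
    show ?thesis by simp
  qed
  have "(\<integral>\<^sup>+u. g (u i) * h u \<partial>PiM I M) =
      (\<integral>\<^sup>+y. (\<integral>\<^sup>+x. g x * h (y(i := x)) \<partial>M i) \<partial>PiM (I - {i}) M)"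
    using nn_integral_PiM_split[where h="\<lambda>u. g (u i) * h u", OF M i] gm h
    by (simp add: borel_measurable_times_ennreal)
  also have "\<dots> = (\<integral>\<^sup>+y. (\<integral>\<^sup>+x. g x * h (y(i := x0)) \<partial>M i) \<partial>PiM (I - {i}) M)"
    by (intro nn_integral_cong) (simp add: eq)
  also have "\<dots> = (\<integral>\<^sup>+y. (\<integral>\<^sup>+x. g x \<partial>M i) * h (y(i := x0)) \<partial>PiM (I - {i}) M)"
    by (intro nn_integral_cong nn_integral_multc) (rule g)
  also have "\<dots> = (\<integral>\<^sup>+x. g x \<partial>M i) * (\<integral>\<^sup>+y. h (y(i := x0)) \<partial>PiM (I - {i}) M)"
    by (rule nn_integral_cmult[OF hm])
  also have "(\<integral>\<^sup>+y. h (y(i := x0)) \<partial>PiM (I - {i}) M) =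
      (\<integral>\<^sup>+y. (\<integral>\<^sup>+x. h (y(i := x)) \<partial>M i) \<partial>PiM (I - {i}) M)"
  proof (rule nn_integral_cong)
    fix y assume w: "y \<in> space (PiM (I - {i}) M)"
    have "(\<integral>\<^sup>+x. h (y(i := x)) \<partial>M i) = (\<integral>\<^sup>+x. h (y(i := x0)) \<partial>M i)"
      by (intro nn_integral_cong) (simp add: eq[OF w])
    then show "h (y(i := x0)) = (\<integral>\<^sup>+x. h (y(i := x)) \<partial>M i)" by (simp add: Mi.emeasure_space_1)
  qed
  also have "\<dots> = (\<integral>\<^sup>+u. h u \<partial>PiM I M)"
    by (rule nn_integral_PiM_split[OF M i h, symmetric])
  finally show ?thesis .
qed

text \<open>The factor h may depend on infinitely many coordinates outside F. This is the situation
  of the likelihood after finitely many of its factors have been removed.\<close>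

lemma nn_integral_PiM_factor:
  fixes g :: "'i \<Rightarrow> 'a \<Rightarrow> ennreal"
  assumes M: "\<And>j. j \<in> I \<Longrightarrow> prob_space (M j)" and F: "finite F" "F \<subseteq> I"
    and g: "\<And>i. i \<in> F \<Longrightarrow> g i \<in> borel_measurable (M i)" and h: "h \<in> borel_measurable (PiM I M)"
    and indep: "\<And>i u x. i \<in> F \<Longrightarrow> u \<in> space (PiM I M) \<Longrightarrow> x \<in> space (M i) \<Longrightarrow> h (u(i := x)) = h u"
  shows "(\<integral>\<^sup>+u. (\<Prod>i\<in>F. g i (u i)) * h u \<partial>PiM I M) =
    (\<Prod>i\<in>F. \<integral>\<^sup>+x. g i x \<partial>M i) * (\<integral>\<^sup>+u. h u \<partial>PiM I M)"
  using F g indep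
proof (induction F rule: finite_induct)
  case empty
  then show ?case by simp
next
  case (insert i F)
  have gm: "(\<lambda>u. g j (u j)) \<in> borel_measurable (PiM I M)" if "j \<in> F" for j
    using insert.prems that by (intro measurable_compose[OF measurable_component_singleton]) auto
  have hm: "(\<lambda>u. (\<Prod>j\<in>F. g j (u j)) * h u) \<in> borel_measurable (PiM I M)"
    by (intro borel_measurable_times_ennreal borel_measurable_prod_ennreal gm h)
  have "(\<integral>\<^sup>+u. (\<Prod>j\<in>insert i F. g j (u j)) * h u \<partial>PiM I M) =
      (\<integral>\<^sup>+u. g i (u i) * ((\<Prod>j\<in>F. g j (u j)) * h u) \<partial>PiM I M)"
    using insert.hyps by (simp add: mult.assoc)
  also have "\<dots> = (\<integral>\<^sup>+x. g i x \<partial>M i) * (\<integral>\<^sup>+u. (\<Prod>j\<in>F. g j (u j)) * h u \<partial>PiM I M)"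
  proof (rule nn_integral_PiM_factor1[OF M _ _ hm])
    fix u x assume u: "u \<in> space (PiM I M)" "x \<in> space (M i)"
    have "(\<Prod>j\<in>F. g j ((u(i := x)) j)) = (\<Prod>j\<in>F. g j (u j))"
      using insert.hyps by (intro prod.cong) auto
    then show "(\<Prod>j\<in>F. g j ((u(i := x)) j)) * h (u(i := x)) = (\<Prod>j\<in>F. g j (u j)) * h u"
      by (simp only: insert.prems(3)[OF insertI1 u])
  qed (use insert.prems in auto)
  also have "(\<integral>\<^sup>+u. (\<Prod>j\<in>F. g j (u j)) * h u \<partial>PiM I M) =
      (\<Prod>j\<in>F. \<integral>\<^sup>+x. g j x \<partial>M j) * (\<integral>\<^sup>+u. h u \<partial>PiM I M)"
    by (rule insert.IH) (use insert.prems in auto)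
  finally show ?case using insert.hyps by (simp add: mult.assoc)
qed

lemma nn_integral_PiM_component:
  assumes M: "\<And>j. j \<in> I \<Longrightarrow> prob_space (M j)" and i: "i \<in> I" and g: "g \<in> borel_measurable (M i)"
  shows "(\<integral>\<^sup>+u. g (u i) \<partial>PiM I M) = (\<integral>\<^sup>+x. g x \<partial>M i)"
proof -
  interpret P: prob_space "PiM I M" by (intro prob_space_PiM M)
  show ?thesis
    using nn_integral_PiM_factor1[where I=I and M=M and g=g and h="\<lambda>_. 1", OF M i g] by (simp add: P.emeasure_space_1)
qed

section \<open>Weighted sums of squares of independent standard Gaussians\<close>

lemma nn_integral_std_normal_sq: "(\<integral>\<^sup>+x. ennreal (x\<^sup>2) \<partial>std_normal) = 1"
proof -
  have "has_bochner_integral lborel (\<lambda>x. std_normal_density x * x\<^sup>2) 1"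
    using std_normal_moment_even[of 1] by simp
  then have "(\<integral>\<^sup>+x. ennreal (std_normal_density x * x\<^sup>2) \<partial>lborel) = ennreal 1"
    by (subst nn_integral_eq_integral) (auto simp: has_bochner_integral_iff normal_density_nonneg)
  then show ?thesis
    by (subst nn_integral_density) (auto simp: ennreal_mult' normal_density_nonneg)
qed

lemma measurable_std_normal_weighted_sum:
  fixes v :: "'i \<Rightarrow> real"
  assumes "countable G" "G \<subseteq> J"
  shows "(\<lambda>z. \<integral>\<^sup>+i. ennreal (v i * (z i)\<^sup>2) \<partial>count_space G) \<in> borel_measurable (PiM J (\<lambda>_. std_normal))"
proof -
  interpret sigma_finite_measure "count_space G"
    by (rule sigma_finite_measure_count_space_countable[OF assms(1)])
  have m: "(\<lambda>z. ennreal (v i * (z i)\<^sup>2)) \<in> borel_measurable (PiM J (\<lambda>_. std_normal))" if "i \<in> G" for i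
  proof -
    have "i \<in> J" using that assms(2) by auto
    then show ?thesis by measurable
  qed
  \<comment> \<open>Joint measurability in z and i can be checked for each fixed i, because i ranges
    over a countable discrete space.\<close>
  show ?thesis
    by (rule borel_measurable_nn_integral)
      (unfold case_prod_beta, rule measurable_compose_countable'[where g=snd, OF _ _ assms(1)],
        use m in \<open>auto intro: measurable_compose[OF measurable_fst]\<close>)
qed

lemma nn_integral_std_normal_weighted_sum:
  fixes v :: "'i \<Rightarrow> real"
  assumes G: "countable G" "G \<subseteq> J" and v: "\<And>i. i \<in> G \<Longrightarrow> 0 \<le> v i"
  shows "(\<integral>\<^sup>+z. (\<integral>\<^sup>+i. ennreal (v i * (z i)\<^sup>2) \<partial>count_space G) \<partial>PiM J (\<lambda>_. std_normal)) =
    (\<integral>\<^sup>+i. ennreal (v i) \<partial>count_space G)"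
proof -
  let ?G = "PiM J (\<lambda>_. std_normal)"
  have m: "(\<lambda>z. ennreal (v i * (z i)\<^sup>2)) \<in> borel_measurable ?G" if "i \<in> G" for i
  proof -
    have "i \<in> J" using that G(2) by auto
    then show ?thesis by measurable
  qed
  have "(\<integral>\<^sup>+z. (\<integral>\<^sup>+i. ennreal (v i * (z i)\<^sup>2) \<partial>count_space G) \<partial>?G) =
      (\<integral>\<^sup>+i. (\<integral>\<^sup>+z. ennreal (v i * (z i)\<^sup>2) \<partial>?G) \<partial>count_space G)"
    by (rule nn_integral_count_space_nn_integral[OF G(1) m])
  also have "\<dots> = (\<integral>\<^sup>+i. ennreal (v i) \<partial>count_space G)"
  proof (rule nn_integral_cong)
    fix i assume "i \<in> space (count_space G)"
    then have i: "i \<in> J" "0 \<le> v i" using G v by auto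
    have "(\<integral>\<^sup>+z. ennreal (v i * (z i)\<^sup>2) \<partial>?G) = (\<integral>\<^sup>+x. ennreal (v i) * ennreal (x\<^sup>2) \<partial>std_normal)"
      using nn_integral_PiM_component[of J "\<lambda>_. std_normal" i "\<lambda>x. ennreal (v i) * ennreal (x\<^sup>2)"]
        i prob_space_std_normal by (simp add: ennreal_mult)
    also have "\<dots> = ennreal (v i)"
      by (subst nn_integral_cmult) (auto simp: nn_integral_std_normal_sq)
    finally show "(\<integral>\<^sup>+z. ennreal (v i * (z i)\<^sup>2) \<partial>?G) = ennreal (v i)" .
  qed
  finally show ?thesis .
qed

text \<open>The expectation of the random sum is the finite sum of the \<open>v i\<close>, because
  each Gaussian square has mean 1.\<close>

lemma AE_std_normal_summable:
  fixes v :: "'i \<Rightarrow> real"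
  assumes J: "countable J" and v: "v summable_on J" "\<And>i. i \<in> J \<Longrightarrow> 0 \<le> v i"
  shows "AE z in PiM J (\<lambda>_. std_normal). (\<lambda>i. v i * (z i)\<^sup>2) summable_on J"
proof -
  have "(\<integral>\<^sup>+i. ennreal (v i) \<partial>count_space J) < \<infinity>"
    using summable_on_iff_nn_integral_finite[of J v] v by simp
  then have "AE z in PiM J (\<lambda>_. std_normal). (\<integral>\<^sup>+i. ennreal (v i * (z i)\<^sup>2) \<partial>count_space J) \<noteq> \<infinity>"
    by (intro nn_integral_noteq_infinite measurable_std_normal_weighted_sum[OF J order.refl])
      (simp add: nn_integral_std_normal_weighted_sum[OF J order.refl v(2)])
  then show ?thesis
    by eventually_elim (subst summable_on_iff_nn_integral_finite; use v in \<open>auto simp: less_top\<close>)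
qed

lemma finite_weighted_square_eq: "w > 0 \<Longrightarrow> finite {t::real. w * t\<^sup>2 + r = x}"
proof -
  assume w: "w > 0"
  have "{t::real. w * t\<^sup>2 + r = x} \<subseteq> {sqrt ((x - r) / w), - sqrt ((x - r) / w)}"
  proof
    fix t assume "t \<in> {t::real. w * t\<^sup>2 + r = x}"
    then have "(x - r) / w = t\<^sup>2" using w by (auto simp: field_simps)
    then show "t \<in> {sqrt ((x - r) / w), - sqrt ((x - r) / w)}" by auto
  qed
  then show ?thesis by (rule finite_subset) simp
qed

lemma AE_std_normal_not_in_finite: "finite A \<Longrightarrow> AE t in std_normal. t \<notin> A"
proof -
  assume "finite A"
  then have "AE t in lborel. t \<notin> A"
    by (intro AE_not_in) (simp add: null_sets_def emeasure_lborel_countable countable_finite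
      borel_closed finite_imp_closed)
  then show ?thesis by (simp add: AE_density) (erule eventually_mono, simp)
qed

text \<open>Conditionally on the other coordinates, the sum is a nonconstant quadratic polynomial in one
  Gaussian variable.\<close>

lemma AE_std_normal_weighted_sum_neq:
  fixes w :: "'i \<Rightarrow> real"
  assumes I: "countable I" and w: "w summable_on I" "\<And>i. i \<in> I \<Longrightarrow> 0 \<le> w i"
    and i: "i \<in> I" "w i > 0"
    and m: "(\<lambda>z. \<Sum>\<^sub>\<infinity>j\<in>I. w j * (z j)\<^sup>2) \<in> borel_measurable (PiM I (\<lambda>_. std_normal))"
  shows "AE z in PiM I (\<lambda>_. std_normal). (\<Sum>\<^sub>\<infinity>j\<in>I. w j * (z j)\<^sup>2) \<noteq> x"
proof -
  let ?G = "\<lambda>J. PiM J (\<lambda>_. std_normal)"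
  let ?S = "\<lambda>J z. \<Sum>\<^sub>\<infinity>j\<in>J. w j * (z j)\<^sup>2"
  let ?A = "{z \<in> space (?G I). ?S I z = x}"
  note [measurable] = m
  have A: "?A \<in> sets (?G I)" by measurable
  have "emeasure (?G I) ?A = (\<integral>\<^sup>+z. indicator ?A z \<partial>?G I)" using A by simp
  also have "\<dots> = (\<integral>\<^sup>+y. (\<integral>\<^sup>+t. indicator ?A (y(i := t)) \<partial>std_normal) \<partial>?G (I - {i}))"
    using A by (intro nn_integral_PiM_split i prob_space_std_normal) auto
  also have "\<dots> = (\<integral>\<^sup>+y. 0 \<partial>?G (I - {i}))"
  proof (rule nn_integral_cong_AE)
    have "AE y in ?G (I - {i}). (\<lambda>j. w j * (y j)\<^sup>2) summable_on (I - {i})"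
      by (rule AE_std_normal_summable) (use I w in \<open>auto intro: summable_on_subset_banach\<close>)
    then show "AE y in ?G (I - {i}). (\<integral>\<^sup>+t. indicator ?A (y(i := t)) \<partial>std_normal) = 0"
    proof eventually_elim
      case (elim y)
      have S: "?S I (y(i := t)) = w i * t\<^sup>2 + ?S (I - {i}) y" for t
      proof -
        have "?S (insert i (I - {i})) (y(i := t)) =
            w i * ((y(i := t)) i)\<^sup>2 + ?S (I - {i}) (y(i := t))"
        proof (rule infsum_insert)
          have "(\<lambda>j. w j * ((y(i := t)) j)\<^sup>2) summable_on (I - {i}) \<longleftrightarrow>
              (\<lambda>j. w j * (y j)\<^sup>2) summable_on (I - {i})"
            by (rule summable_on_cong) simp
          with elim show "(\<lambda>j. w j * ((y(i := t)) j)\<^sup>2) summable_on (I - {i})" by blast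
        qed simp
        also have "?S (I - {i}) (y(i := t)) = ?S (I - {i}) y" by (rule infsum_cong) auto
        finally show ?thesis using i by (simp add: insert_absorb)
      qed
      have "AE t in std_normal. t \<notin> {t. w i * t\<^sup>2 + ?S (I - {i}) y = x}"
        by (intro AE_std_normal_not_in_finite finite_weighted_square_eq i)
      then have "(\<integral>\<^sup>+t. indicator ?A (y(i := t)) \<partial>std_normal) = (\<integral>\<^sup>+t. 0 \<partial>std_normal)"
        by (intro nn_integral_cong_AE, elim eventually_mono)
          (simp add: S indicator_def del: fun_upd_apply)
      then show ?case by simp
    qed
  qed
  finally have "emeasure (?G I) ?A = 0" by simp
  then show ?thesis using A by (subst AE_iff_measurable[OF A]) auto
qed

section \<open>The wavelet prior\<close>

lemma countable_cdv_index: "countable (cdv_index J0)"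
  by (rule countableI_type)

text \<open>The factor 2 is due to the coarsest level l = J0 - 1, which carries 2^J0 = 2 * 2^l
  scaling functions.\<close>

lemma cdv_index_subset: "J0 \<ge> 1 \<Longrightarrow> cdv_index J0 \<subseteq> (SIGMA l:UNIV. {..<2 * 2 ^ l})"
proof
  fix i assume "J0 \<ge> 1" "i \<in> cdv_index J0"
  then show "i \<in> (SIGMA l:UNIV. {..<2 * 2 ^ l})"
    by (cases i, cases J0) (auto simp: cdv_index_def split: if_splits)
qed

text \<open>Excludes level 0, where \<open>ln (2 ^ l)\<close> is 0 and the weight of the weak norm
  would vanish.\<close>

lemma cdv_index_level_pos: "J0 \<ge> 2 \<Longrightarrow> i \<in> cdv_index J0 \<Longrightarrow> fst i \<ge> 1"
  by (auto simp: cdv_index_def)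

lemma cdv_index_ne: "(J0 - 1, 0) \<in> cdv_index J0"
  by (auto simp: cdv_index_def)

text \<open>The truncation by whole levels from \<open>obs_pairing\<close>. The pairing need not
  converge absolutely, so this order of summation has to be kept.\<close>

definition upto_level :: "nat \<Rightarrow> nat \<Rightarrow> (nat \<times> nat) set"
  where "upto_level J0 L = {i \<in> cdv_index J0. fst i \<le> L}"

lemma finite_upto_level:
  assumes "J0 \<ge> 1" shows "finite (upto_level J0 L)"
proof -
  let ?B = "SIGMA l:{..L}. {..<(2::nat) * 2 ^ l}"
  have "upto_level J0 L \<subseteq> ?B"
  proof
    fix i assume "i \<in> upto_level J0 L"
    then show "i \<in> ?B" using subsetD[OF cdv_index_subset[OF assms], of i]
      by (auto simp: upto_level_def)
  qed
  moreover have "finite ?B" by simp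
  ultimately show ?thesis by (rule finite_subset)
qed

lemma filterlim_upto_level:
  assumes "J0 \<ge> 1"
  shows "filterlim (upto_level J0) (finite_subsets_at_top (cdv_index J0)) sequentially"
proof (rule filterlim_finite_subsets_at_topI[OF finite_upto_level[OF assms]])
  show "upto_level J0 L \<subseteq> cdv_index J0" for L by (auto simp: upto_level_def)
  fix i assume "i \<in> cdv_index J0"
  then show "\<forall>\<^sub>F L in sequentially. i \<in> upto_level J0 L"
    by (intro eventually_sequentiallyI[of "fst i"]) (simp add: upto_level_def)
qed

lemma sum_upto_level:
  assumes "J0 \<ge> 1"
  shows "(\<Sum>i\<in>upto_level J0 L. h i) = (\<Sum>l\<le>L. \<Sum>i\<in>{i \<in> cdv_index J0. fst i = l}. h i)"
proof -
  have "(\<Sum>l\<le>L. sum h {i \<in> upto_level J0 L. fst i = l}) = (\<Sum>i\<in>upto_level J0 L. h i)"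
    by (rule sum.group[OF finite_upto_level[OF assms]]) (auto simp: upto_level_def)
  moreover have "{i \<in> upto_level J0 L. fst i = l} = {i \<in> cdv_index J0. fst i = l}" if "l \<le> L" for l
    using that by (auto simp: upto_level_def)
  ultimately show ?thesis by simp
qed

lemma summable_on_cdv_index:
  fixes g :: "nat \<Rightarrow> real"
  assumes J0: "J0 \<ge> 1" and g: "\<And>l. 0 \<le> g l" and s: "summable (\<lambda>l. 2 ^ l * g l)"
  shows "(\<lambda>i. g (fst i)) summable_on cdv_index J0"
proof (rule summable_on_subset_banach[OF _ cdv_index_subset[OF J0]])
  show "(\<lambda>i. g (fst i)) summable_on (SIGMA l:UNIV. {..<(2::nat) * 2 ^ l})"
  proof (rule summable_on_SigmaI)
    fix l :: nat
    show "((\<lambda>k. g (fst (l, k))) has_sum (\<Sum>k<(2::nat) * 2 ^ l. g l)) {..<(2::nat) * 2 ^ l}"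
      by (intro has_sum_finiteI) auto
    have "summable (\<lambda>l. 2 * (2 ^ l * g l))" using s by (rule summable_mult)
    then show "(\<lambda>l. \<Sum>k<(2::nat) * 2 ^ l. g l) summable_on UNIV"
      by (subst summable_on_UNIV_nonneg_real_iff) (auto simp: g mult.assoc)
  qed (auto simp: g)
qed

lemma summable_on_cdv_index_powr:
  assumes "J0 \<ge> 1" "a > 1"
  shows "(\<lambda>i. 2 powr (- (real (fst i) * a))) summable_on cdv_index J0"
proof (rule summable_on_cdv_index[OF assms(1), of "\<lambda>l. 2 powr (- (real l * a))"])
  have eq: "2 ^ l * 2 powr (- (real l * a)) = (2 powr (1 - a)) ^ l" for l
    by (simp add: powr_realpow[symmetric] powr_add[symmetric] powr_powr algebra_simps)
  have "(2::real) powr (1 - a) < 2 powr 0" using assms(2) by (intro powr_less_mono) auto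
  then show "summable (\<lambda>l. 2 ^ l * 2 powr (- (real l * a)))"
    unfolding eq by (intro summable_geometric) auto
qed auto

text \<open>Hoeffding's lemma for the centred variable t u, whose range has width 2 |t| M: the
  exponent is the squared width over 8.\<close>

lemma nn_integral_exp_uniform_le:
  assumes "M > 0"
  shows "(\<integral>\<^sup>+u. ennreal (exp (t * u)) \<partial>uniform_measure lborel {- M..M}) \<le> ennreal (exp (t\<^sup>2 * M\<^sup>2 / 2))"
proof -
  let ?U = "uniform_measure lborel {- M..M}"
  interpret U: prob_space ?U
    by (rule prob_space_uniform_measure) (use assms in auto)
  have ae: "AE u in ?U. t * u \<in> {- (\<bar>t\<bar> * M)..\<bar>t\<bar> * M}"
  proof (rule AE_uniform_measureI)
    show "AE u in lborel. u \<in> {- M..M} \<longrightarrow> t * u \<in> {- (\<bar>t\<bar> * M)..\<bar>t\<bar> * M}"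
    proof (intro AE_I2 impI)
      fix u assume "u \<in> {- M..M}"
      then have "\<bar>t * u\<bar> \<le> \<bar>t\<bar> * M" unfolding abs_mult by (intro mult_left_mono) auto
      then show "t * u \<in> {- (\<bar>t\<bar> * M)..\<bar>t\<bar> * M}" by (auto simp: abs_le_iff)
    qed
  qed simp
  interpret interval_bounded_random_variable ?U "\<lambda>u. t * u" "- (\<bar>t\<bar> * M)" "\<bar>t\<bar> * M"
    by unfold_locales (use ae in auto)
  have "has_bochner_integral lborel (\<lambda>u. (t * u / (2 * M)) * indicator {- M..M} u)
      (t * M\<^sup>2 / (4 * M) - t * (- M)\<^sup>2 / (4 * M))"
    by (rule has_bochner_integral_FTC_Icc_real)
      (use assms in \<open>auto intro!: derivative_eq_intros continuous_intros simp: field_simps\<close>)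
  then have "has_bochner_integral lborel (\<lambda>u. (indicator {- M..M} u / (2 * M)) *\<^sub>R (t * u)) 0"
    by (simp add: mult_ac)
  then have "has_bochner_integral (density lborel (\<lambda>u. ennreal (indicator {- M..M} u / (2 * M)))) (\<lambda>u. t * u) 0"
    by (rule has_bochner_integral_density[rotated 3]) (use assms in auto)
  also have "density lborel (\<lambda>u. ennreal (indicator {- M..M} u / (2 * M))) = ?U"
    unfolding uniform_measure_def
    by (intro density_cong) (use assms in \<open>auto simp: indicator_def simp flip: divide_ennreal\<close>)
  finally have "U.expectation (\<lambda>u. t * u) = 0" by (simp add: has_bochner_integral_iff)
  then have "(\<integral>\<^sup>+u. ennreal (exp (1 * (t * u))) \<partial>?U) \<le> ennreal (exp (1\<^sup>2 * (\<bar>t\<bar> * M - - (\<bar>t\<bar> * M))\<^sup>2 / 8))"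
    by (intro Hoeffdings_lemma_nn_integral_0) auto
  also have "1\<^sup>2 * (\<bar>t\<bar> * M - - (\<bar>t\<bar> * M))\<^sup>2 / 8 = t\<^sup>2 * M\<^sup>2 / 2"
    by (simp add: power2_eq_square)
  finally show ?thesis by simp
qed

locale wavelet_prior =
  fixes J0 :: nat and \<psi> :: "nat \<Rightarrow> nat \<Rightarrow> real \<Rightarrow> real" and \<gamma> M \<delta> :: real
  assumes gamma: "\<gamma> > 0" and M_pos: "M > 0" and delta: "\<delta> > 1 / 2" and J0: "J0 \<ge> 2"
    and onb: "orthonormal_basis (cdv_index J0) (wavelet \<psi>)"
begin

abbreviation "I \<equiv> cdv_index J0"

definition decay :: "nat \<times> nat \<Rightarrow> real"
  where "decay i = 2 powr (- real (fst i) * (\<gamma> + 1 / 2))"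

definition weight :: "nat \<times> nat \<Rightarrow> real"
  where "weight i = inverse (2 ^ fst i) * ln (2 ^ fst i) powr (- 2 * \<delta>)"

text \<open>Summability of the squared data with this weight, which is heavier than the squared decay, makes
  the pairing with a draw from the prior converge absolutely over levels.\<close>

definition obs_weight :: "nat \<times> nat \<Rightarrow> real"
  where "obs_weight i = 2 powr (- (real (fst i) * (1 + \<gamma>)))"

abbreviation "unif \<equiv> uniform_measure lborel {- M..M}"

abbreviation "draws \<equiv> PiM I (\<lambda>_. unif)"

definition series :: "(nat \<times> nat \<Rightarrow> real) \<Rightarrow> l2"
  where "series u = (\<Sum>\<^sub>\<infinity>i\<in>I. (decay i * u i) *\<^sub>R wavelet \<psi> i)"

definition prior :: "l2 measure" where "prior = distr draws borel series"

lemma J0_ge1: "J0 \<ge> 1" using J0 by simp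

lemma on: "orthonormal_on I (wavelet \<psi>)" using onb by (rule orthonormal_basis_imp_on)

lemma uniform_wavelet_prior_eq: "uniform_wavelet_prior J0 \<psi> \<gamma> M = prior"
  by (simp add: uniform_wavelet_prior_def prior_def series_def[abs_def] decay_def case_prod_beta')

lemma H_norm_eq: "H_norm J0 \<delta> c = sqrt (\<Sum>\<^sub>\<infinity>i\<in>I. weight i * (c i)\<^sup>2)"
  by (simp add: H_norm_def weight_def case_prod_beta')

lemma decay_inverse: "decay i = inverse (2 powr (real (fst i) * (\<gamma> + 1 / 2)))"
  by (simp only: decay_def mult_minus_left powr_minus)

lemma decay_pos: "decay i > 0" by (simp add: decay_def)

lemma weight_nonneg: "weight i \<ge> 0" by (simp add: weight_def)

lemma obs_weight_pos: "obs_weight i > 0" by (simp add: obs_weight_def)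

lemma weight_pos: "i \<in> I \<Longrightarrow> weight i > 0"
proof -
  assume "i \<in> I"
  then have "fst i \<ge> 1" by (rule cdv_index_level_pos[OF J0])
  then have "ln (2 ^ fst i :: real) > 0" by (intro ln_gt_zero one_less_power) auto
  then show ?thesis by (simp add: weight_def)
qed

lemma decay_sq: "(decay i)\<^sup>2 = 2 powr (- (real (fst i) * (1 + 2 * \<gamma>)))"
  unfolding decay_def power2_eq_square powr_add[symmetric] by (rule arg_cong[where f="\<lambda>x. 2 powr x"]) (simp add: algebra_simps)

lemma decay_sq_summable: "(\<lambda>i. (decay i)\<^sup>2) summable_on I"
  unfolding decay_sq by (rule summable_on_cdv_index_powr[OF J0_ge1]) (use gamma in simp)

lemma obs_weight_summable: "obs_weight summable_on I"
  unfolding obs_weight_def[abs_def] by (rule summable_on_cdv_index_powr[OF J0_ge1]) (use gamma in simp)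

lemma decay_sq_le: "(decay i)\<^sup>2 \<le> obs_weight i"
  unfolding decay_sq obs_weight_def using gamma by (intro powr_mono) (auto intro!: mult_left_mono)

text \<open>The 2^l functions of a level cancel \<open>inverse (2 ^ l)\<close> and leave a constant
  times l^(-2\<delta>), which is summable by \<delta> > 1/2. This is the trace condition that puts
  white noise into the weak space.\<close>

lemma weight_summable: "weight summable_on I"
  unfolding weight_def[abs_def]
proof (rule summable_on_cdv_index[OF J0_ge1, of "\<lambda>l. inverse (2 ^ l) * ln (2 ^ l) powr (- 2 * \<delta>)"])
  have "(2 ^ l * (inverse (2 ^ l) * ln (2 ^ l) powr (- 2 * \<delta>))) = ln 2 powr (- 2 * \<delta>) * real l powr (- 2 * \<delta>)" for l
    by (simp add: ln_realpow powr_mult mult.commute)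
  moreover have "summable (\<lambda>l. ln 2 powr (- 2 * \<delta>) * real l powr (- 2 * \<delta>))"
    by (intro summable_mult) (use delta in \<open>simp add: summable_real_powr_iff\<close>)
  ultimately show "summable (\<lambda>l. 2 ^ l * (inverse (2 ^ l) * ln (2 ^ l) powr (- 2 * \<delta>)))" by simp
qed simp

lemma prob_space_unif: "prob_space unif"
  by (rule prob_space_uniform_measure) (use M_pos in auto)

lemma prob_space_draws: "prob_space draws"
  by (intro prob_space_PiM prob_space_unif)

lemma measurable_series: "series \<in> borel_measurable draws"
  unfolding series_def[abs_def]
  by (rule borel_measurable_orthonormal_series[OF countable_cdv_index on]) measurable

lemma prob_space_prior: "prob_space prior"
  unfolding prior_def by (rule prob_space.prob_space_distr[OF prob_space_draws measurable_series])

lemma AE_draws: "AE u in draws. \<forall>i\<in>I. \<bar>u i\<bar> \<le> M"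
proof (rule AE_ball_countable'[OF _ countable_cdv_index])
  fix i assume i: "i \<in> I"
  have "AE x in unif. \<bar>x\<bar> \<le> M" by (rule AE_uniform_measureI) auto
  then show "AE u in draws. \<bar>u i\<bar> \<le> M"
    by (intro AE_PiM_component[OF _ i]) (auto simp: prob_space_unif)
qed

text \<open>For draws bounded by M the coefficients are square-summable, so \<open>series u\<close>
  is a genuine sum and not the default value of \<open>infsum\<close>.\<close>

lemma
  assumes "\<forall>i\<in>I. \<bar>u i\<bar> \<le> M"
  shows series_coef: "i \<in> I \<Longrightarrow> coef \<psi> (series u) i = decay i * u i"
    and series_norm: "((\<lambda>i. (decay i * u i)\<^sup>2) has_sum (norm (series u))\<^sup>2) I"
proof -
  have "(\<lambda>i. (decay i * u i)\<^sup>2) summable_on I"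
  proof (rule summable_on_comparison_test)
    show "(\<lambda>i. M\<^sup>2 * (decay i)\<^sup>2) summable_on I" by (intro summable_on_cmult_right decay_sq_summable)
    fix i assume "i \<in> I"
    then have "\<bar>u i\<bar>\<^sup>2 \<le> M\<^sup>2" using assms by (intro power_mono) auto
    then show "(decay i * u i)\<^sup>2 \<le> M\<^sup>2 * (decay i)\<^sup>2"
      by (simp add: power_mult_distrib mult.commute[of "M\<^sup>2"] mult_left_mono)
  qed auto
  then have s: "(\<lambda>i. (decay i * u i) *\<^sub>R wavelet \<psi> i) summable_on I"
    by (rule orthonormal_series_summable[OF on])
  then show c: "coef \<psi> (series u) i = decay i * u i" if "i \<in> I" for i
    using orthonormal_series_coef[OF on s that] by (simp add: coef_def series_def)
  have "((\<lambda>i. (coef \<psi> (series u) i)\<^sup>2) has_sum (norm (series u))\<^sup>2) I"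
    unfolding coef_def by (rule parseval[OF onb])
  then show "((\<lambda>i. (decay i * u i)\<^sup>2) has_sum (norm (series u))\<^sup>2) I"
    by (rule has_sum_cong[THEN iffD1, rotated]) (simp add: c)
qed

lemma measurable_coef: "(\<lambda>f. coef \<psi> f i) \<in> borel_measurable borel"
  unfolding coef_def by (intro borel_measurable_continuous_onI continuous_intros)

end

section \<open>The posterior as a product of truncated normal distributions\<close>

text \<open>Bayes' formula in one coordinate: s x t - (s x)^2/2 = t^2/2 - (s x - t)^2/2, followed by
  the substitution y = s x - t, which maps [-M, M] to the truncation interval. It is applied with
  \<open>s = sqrt n * decay i\<close> and \<open>t = sqrt n * X i\<close>.\<close>

lemma nn_integral_gaussian_factor:
  fixes g :: "real \<Rightarrow> ennreal"
  assumes s: "s > 0" and M: "M > 0" and g[measurable]: "g \<in> borel_measurable borel"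
  shows "(\<integral>\<^sup>+x. ennreal (exp (s * x * t - (s * x)\<^sup>2 / 2)) * g (s * x - t) \<partial>uniform_measure lborel {- M..M}) =
    ennreal (exp (t\<^sup>2 / 2) * sqrt (2 * pi) / (2 * M * s)) *
      (\<integral>\<^sup>+y. g y * indicator {- (s * M) - t..s * M - t} y \<partial>std_normal)"
proof -
  let ?J = "{- (s * M) - t..s * M - t}" and ?K = "exp (t\<^sup>2 / 2) * sqrt (2 * pi) / (2 * M * s)"
  let ?e = "\<lambda>x. ennreal (exp (s * x * t - (s * x)\<^sup>2 / 2))"
  let ?h = "\<lambda>y. ennreal (std_normal_density y) * (g y * indicator ?J y)"
  have emeas: "emeasure lborel {- M..M} = ennreal (2 * M)" using M by simp
  have "(\<integral>\<^sup>+x. ?e x * g (s * x - t) \<partial>uniform_measure lborel {- M..M}) =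
      (\<integral>\<^sup>+x. ?e x * g (s * x - t) * indicator {- M..M} x \<partial>lborel) / ennreal (2 * M)"
    unfolding emeas[symmetric] by (rule nn_integral_uniform_measure) (use M in auto)
  also have "\<dots> = ennreal (1 / (2 * M)) *
      (\<integral>\<^sup>+x. ?e x * g (s * x - t) * indicator {- M..M} x \<partial>lborel)"
    using M by (simp add: divide_ennreal_def inverse_ennreal mult.commute inverse_eq_divide)
  also have "\<dots> = (\<integral>\<^sup>+x. ennreal (1 / (2 * M)) *
      (?e x * g (s * x - t) * indicator {- M..M} x) \<partial>lborel)"
    by (rule nn_integral_cmult[symmetric]) measurable
  also have "\<dots> = (\<integral>\<^sup>+x. ennreal (?K * s) * (?h (- t + s * x)) \<partial>lborel)"
  proof (rule nn_integral_cong)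
    fix x :: real
    have ind: "indicator ?J (- t + s * x) = (indicator {- M..M} x :: ennreal)"
    proof -
      have "- (s * M) \<le> s * x \<longleftrightarrow> - M \<le> x"
        using mult_le_cancel_left_pos[OF s, of "- M" x] by simp
      moreover have "s * x \<le> s * M \<longleftrightarrow> x \<le> M" using s by simp
      ultimately show ?thesis by (simp add: indicator_def)
    qed
    have "exp (s * x * t - (s * x)\<^sup>2 / 2) = exp (t\<^sup>2 / 2) * exp (- (- t + s * x)\<^sup>2 / 2)"
      by (simp add: exp_add[symmetric] power2_eq_square field_simps)
    then have "1 / (2 * M) * exp (s * x * t - (s * x)\<^sup>2 / 2) = (?K * s) * std_normal_density (- t + s * x)"
      using s M by (simp add: std_normal_density_def)
    then have "ennreal (1 / (2 * M)) * ?e x =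
        ennreal (?K * s) * ennreal (std_normal_density (- t + s * x))"
      using s M by (subst (1 2) ennreal_mult''[symmetric]) (simp_all add: normal_density_nonneg)
    then show "ennreal (1 / (2 * M)) *
        (?e x * g (s * x - t) * indicator {- M..M} x) =
        ennreal (?K * s) * (ennreal (std_normal_density (- t + s * x)) *
          (g (- t + s * x) * indicator ?J (- t + s * x)))"
      unfolding ind by (simp add: mult.assoc[symmetric])
  qed
  also have "\<dots> = ennreal (?K * s) * (\<integral>\<^sup>+x. ?h (- t + s * x) \<partial>lborel)"
    by (rule nn_integral_cmult) measurable
  also have "\<dots> = ennreal ?K * (ennreal s * (\<integral>\<^sup>+x. ?h (- t + s * x) \<partial>lborel))"
    using s M by (simp only: ennreal_mult'' less_imp_le mult.assoc)
  also have "ennreal s * (\<integral>\<^sup>+x. ?h (- t + s * x) \<partial>lborel) =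
      (\<integral>\<^sup>+y. ennreal (std_normal_density y) * (g y * indicator ?J y) \<partial>lborel)"
    using nn_integral_real_affine[of "\<lambda>y. ennreal (std_normal_density y) * (g y * indicator ?J y)" s "- t"] s
    by simp
  also have "\<dots> = (\<integral>\<^sup>+y. g y * indicator ?J y \<partial>std_normal)"
    by (rule nn_integral_density[symmetric]) measurable
  finally show ?thesis .
qed

text \<open>One fixed data sequence. The condition \<open>good\<close> holds for almost every
  observation, so the formulas below for the posterior are deterministic statements about such
  data.\<close>

locale wavelet_posterior = wavelet_prior +
  fixes n :: nat and X :: "nat \<times> nat \<Rightarrow> real"
  assumes n: "n \<ge> 1" and good: "(\<lambda>i. obs_weight i * (X i)\<^sup>2) summable_on I"
begin

definition factor :: "nat \<times> nat \<Rightarrow> real \<Rightarrow> real"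
  where "factor i x = exp (real n * (decay i * x * X i) - real n / 2 * (decay i * x)\<^sup>2)"

text \<open>The likelihood divided by its factors in F. The limit over levels exists only almost
  surely; \<open>liminf\<close> makes the quantity measurable and independent of the coordinates in
  F everywhere.\<close>

definition rest :: "(nat \<times> nat) set \<Rightarrow> (nat \<times> nat \<Rightarrow> real) \<Rightarrow> ennreal"
  where "rest F u = liminf (\<lambda>L. \<Prod>i\<in>upto_level J0 L - F. ennreal (factor i (u i)))"

abbreviation "lik \<equiv> likelihood J0 \<psi> n X"

abbreviation "evidence \<equiv> \<integral>\<^sup>+f. ennreal (lik f) \<partial>prior"

abbreviation "post \<equiv> posterior J0 \<psi> prior n X"

abbreviation "mass \<equiv> \<Sum>\<^sub>\<infinity>i\<in>I. obs_weight i * (X i)\<^sup>2"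

lemma fin_upto: "finite (upto_level J0 L)"
  by (rule finite_upto_level[OF J0_ge1])

lemma sum_le_mass:
  assumes "finite F" "F \<subseteq> I"
  shows "(\<Sum>i\<in>F. obs_weight i * (X i)\<^sup>2) \<le> mass"
  by (rule finite_sum_le_infsum[OF good assms]) (simp add: obs_weight_pos less_imp_le)

text \<open>Independence gives a product of one-dimensional Hoeffding bounds, and the exponents add
  up to at most a multiple of \<open>mass\<close>, uniformly in F. It serves with a = 1 for single
  levels and with a = n^2 for the evidence.\<close>

lemma nn_integral_draws_exp_le:
  assumes F: "finite F" "F \<subseteq> I" and C: "\<And>i. i \<in> F \<Longrightarrow> (c i)\<^sup>2 \<le> obs_weight i * a"
    and a: "a \<ge> 0"
  shows "(\<integral>\<^sup>+u. ennreal (exp (\<Sum>i\<in>F. c i * u i * X i)) \<partial>draws) \<le> ennreal (exp (a * mass * M\<^sup>2 / 2))"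
proof -
  have "(\<integral>\<^sup>+u. ennreal (exp (\<Sum>i\<in>F. c i * u i * X i)) \<partial>draws) =
      (\<integral>\<^sup>+u. (\<Prod>i\<in>F. ennreal (exp ((c i * X i) * u i))) * 1 \<partial>draws)"
    using F by (intro nn_integral_cong) (simp add: exp_sum prod_ennreal mult_ac)
  also have "\<dots> = (\<Prod>i\<in>F. \<integral>\<^sup>+x. ennreal (exp ((c i * X i) * x)) \<partial>unif) * (\<integral>\<^sup>+u. 1 \<partial>draws)"
    by (rule nn_integral_PiM_factor[OF prob_space_unif F]) auto
  also have "(\<integral>\<^sup>+u. 1 \<partial>draws) = 1"
    using prob_space.emeasure_space_1[OF prob_space_draws] by simp
  also have "(\<Prod>i\<in>F. \<integral>\<^sup>+x. ennreal (exp ((c i * X i) * x)) \<partial>unif) * 1 \<le>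
      (\<Prod>i\<in>F. ennreal (exp ((c i * X i)\<^sup>2 * M\<^sup>2 / 2)))"
    using nn_integral_exp_uniform_le[OF M_pos] by (simp add: prod_mono_ennreal)
  also have "\<dots> = ennreal (exp (\<Sum>i\<in>F. (c i * X i)\<^sup>2 * M\<^sup>2 / 2))"
    using F by (simp add: exp_sum prod_ennreal)
  also have "\<dots> \<le> ennreal (exp (a * mass * M\<^sup>2 / 2))"
  proof (rule ennreal_leI, subst exp_le_cancel_iff)
    have "(\<Sum>i\<in>F. (c i * X i)\<^sup>2 * M\<^sup>2 / 2) \<le> (\<Sum>i\<in>F. a * M\<^sup>2 / 2 * (obs_weight i * (X i)\<^sup>2))"
    proof (rule sum_mono)
      fix i assume "i \<in> F"
      from mult_right_mono[OF C[OF this], of "(X i)\<^sup>2 * M\<^sup>2 / 2"]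
      show "(c i * X i)\<^sup>2 * M\<^sup>2 / 2 \<le> a * M\<^sup>2 / 2 * (obs_weight i * (X i)\<^sup>2)"
        by (simp add: power_mult_distrib mult_ac)
    qed
    also have "\<dots> = a * M\<^sup>2 / 2 * (\<Sum>i\<in>F. obs_weight i * (X i)\<^sup>2)"
      by (rule sum_distrib_left[symmetric])
    also have "\<dots> \<le> a * M\<^sup>2 / 2 * mass"
      by (rule mult_left_mono[OF sum_le_mass[OF F]]) (use a in simp)
    finally show "(\<Sum>i\<in>F. (c i * X i)\<^sup>2 * M\<^sup>2 / 2) \<le> a * mass * M\<^sup>2 / 2"
      by (simp add: mult_ac)
  qed
  finally show ?thesis .
qed

text \<open>The coefficientwise pairing need not converge absolutely.  Within a level, however, the signs of
  the prior coefficients cancel, and the sub-Gaussian bound makes the expected absolute value of the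
  l-th level decay geometrically.\<close>

lemma AE_pairing_convergent:
  "AE u in draws. convergent (\<lambda>L. \<Sum>i\<in>upto_level J0 L. decay i * u i * X i)"
proof -
  define lev where "lev l = {i \<in> I. fst i = l}" for l
  define D where "D l u = (\<Sum>i\<in>lev l. decay i * u i * X i)" for l u
  have lev: "finite (lev l)" "lev l \<subseteq> I" for l
    by (rule finite_subset[OF _ finite_upto_level[OF J0_ge1, of l]]) (auto simp: lev_def upto_level_def)
  have Dm[measurable]: "D l \<in> borel_measurable draws" for l
    unfolding D_def[abs_def]
  proof (intro borel_measurable_sum)
    fix i assume "i \<in> lev l"
    then have "i \<in> I" using lev(2) by auto
    then show "(\<lambda>u. decay i * u i * X i) \<in> borel_measurable draws" by measurable
  qed
  define E where "E = exp (mass * M\<^sup>2 / 2)"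
  have bound: "(\<integral>\<^sup>+u. ennreal \<bar>D l u\<bar> \<partial>draws) \<le> ennreal (2 * E * (2 powr (- \<gamma> / 2)) ^ l)" for l
  proof -
    \<comment> \<open>This scale makes \<open>t^2 * (decay i)^2\<close> equal to
      \<open>obs_weight i\<close> on level l, so both exponential moments of
      \<open>t * D l u\<close> stay below E. As t |D| is at most exp (t D) + exp (- t D), the mean
      of |D| is at most 2 E / t, which is geometric in l.\<close>
    define t where "t = 2 powr (real l * \<gamma> / 2)"
    have t: "t > 0" by (simp add: t_def)
    have sq: "(r * t * decay i)\<^sup>2 \<le> obs_weight i * 1" if "i \<in> lev l" "r\<^sup>2 = 1" for r i
    proof -
      have "fst i = l" using that by (simp add: lev_def)
      then have "t\<^sup>2 * (decay i)\<^sup>2 = obs_weight i"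
        unfolding t_def decay_sq obs_weight_def power2_eq_square[of "2 powr _"] powr_add[symmetric]
        by (intro arg_cong[where f="\<lambda>x. 2 powr x"]) (simp add: algebra_simps)
      then show ?thesis using that(2) by (simp add: power_mult_distrib)
    qed
    have ex: "(\<integral>\<^sup>+u. ennreal (exp (r * t * D l u)) \<partial>draws) \<le> ennreal E" if "r\<^sup>2 = 1" for r
      using nn_integral_draws_exp_le[OF lev(1)[of l] lev(2)[of l], of "\<lambda>i. r * t * decay i" 1] sq that
      by (simp add: D_def sum_distrib_left E_def mult_ac)
    have "(\<integral>\<^sup>+u. ennreal \<bar>D l u\<bar> \<partial>draws) \<le>
        (\<integral>\<^sup>+u. ennreal (1 / t) * (ennreal (exp (1 * t * D l u)) + ennreal (exp (- 1 * t * D l u))) \<partial>draws)"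
    proof (rule nn_integral_mono)
      fix u
      have "t * \<bar>D l u\<bar> \<le> exp (t * \<bar>D l u\<bar>)" using exp_ge_add_one_self[of "t * \<bar>D l u\<bar>"] by linarith
      also have "\<dots> \<le> exp (1 * t * D l u) + exp (- 1 * t * D l u)" by (cases "D l u \<ge> 0") auto
      finally have "\<bar>D l u\<bar> \<le> 1 / t * (exp (1 * t * D l u) + exp (- 1 * t * D l u))"
        using t by (simp add: field_simps)
      then show "ennreal \<bar>D l u\<bar> \<le> ennreal (1 / t) * (ennreal (exp (1 * t * D l u)) + ennreal (exp (- 1 * t * D l u)))"
        using t by (simp flip: ennreal_plus ennreal_mult' add: ennreal_leI)
    qed
    also have "\<dots> = ennreal (1 / t) * ((\<integral>\<^sup>+u. ennreal (exp (1 * t * D l u)) \<partial>draws) +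
        (\<integral>\<^sup>+u. ennreal (exp (- 1 * t * D l u)) \<partial>draws))"
      by (subst nn_integral_cmult, measurable) (subst nn_integral_add, measurable)
    also have "\<dots> \<le> ennreal (1 / t) * (ennreal E + ennreal E)"
      by (intro mult_left_mono add_mono ex) auto
    also have "\<dots> = ennreal (2 * E * (1 / t))"
      using t by (simp add: E_def mult.commute flip: ennreal_plus ennreal_mult')
    also have "1 / t = (2 powr (- \<gamma> / 2)) ^ l"
      by (simp add: t_def powr_minus_divide powr_realpow[symmetric] powr_powr power_divide mult.commute
        flip: powr_divide)
    finally show ?thesis .
  qed
  have r: "(2::real) powr (- \<gamma> / 2) < 1" using gamma powr_less_mono[of "- \<gamma> / 2" 0 2] by simp
  then have sg: "summable (\<lambda>l. 2 * E * (2 powr (- \<gamma> / 2)) ^ l)"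
    by (intro summable_mult summable_geometric) auto
  have "(\<integral>\<^sup>+u. (\<Sum>l. ennreal \<bar>D l u\<bar>) \<partial>draws) = (\<Sum>l. \<integral>\<^sup>+u. ennreal \<bar>D l u\<bar> \<partial>draws)"
    by (rule nn_integral_suminf) measurable
  also have "\<dots> \<le> (\<Sum>l. ennreal (2 * E * (2 powr (- \<gamma> / 2)) ^ l))"
    by (intro suminf_le bound) auto
  also have "\<dots> = ennreal (\<Sum>l. 2 * E * (2 powr (- \<gamma> / 2)) ^ l)"
    by (intro suminf_ennreal2 sg) (simp add: E_def)
  also have "\<dots> < \<infinity>" by simp
  finally have "AE u in draws. (\<Sum>l. ennreal \<bar>D l u\<bar>) \<noteq> \<infinity>"
    by (intro nn_integral_noteq_infinite) (auto, measurable)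
  then show ?thesis
  proof eventually_elim
    case (elim u)
    then have "summable (\<lambda>l. \<bar>D l u\<bar>)" by (intro summable_suminf_not_top) auto
    then have "summable (\<lambda>l. D l u)" by (rule summable_rabs_cancel)
    then show ?case
      unfolding summable_iff_convergent' sum_upto_level[OF J0_ge1] by (simp add: D_def lev_def)
  qed
qed

lemma rest_measurable: "rest F \<in> borel_measurable draws"
  unfolding rest_def[abs_def] factor_def
  by (intro borel_measurable_liminf borel_measurable_prod_ennreal)
    (auto simp: upto_level_def intro!: measurable_compose[OF measurable_component_singleton])

lemma rest_fun_upd: "i \<in> F \<Longrightarrow> rest F (u(i := x)) = rest F u"
  unfolding rest_def by (intro arg_cong[where f=liminf] ext prod.cong) auto

text \<open>The products over levels converge to the likelihood, and once a level includes F the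
  positive product over F can be divided out. A single null set serves all finite F.\<close>

lemma AE_likelihood_factor:
  "AE u in draws. \<forall>F. finite F \<longrightarrow> F \<subseteq> I \<longrightarrow>
    ennreal (lik (series u)) = (\<Prod>i\<in>F. ennreal (factor i (u i))) * rest F u"
  using AE_pairing_convergent AE_draws
proof eventually_elim
  case (elim u)
  let ?S = "\<lambda>L. \<Sum>i\<in>upto_level J0 L. decay i * u i * X i"
  have S: "?S \<longlonglongrightarrow> lim ?S" using elim(1) by (simp add: convergent_LIMSEQ_iff)
  have Q: "(\<lambda>L. \<Sum>i\<in>upto_level J0 L. (decay i * u i)\<^sup>2) \<longlonglongrightarrow> (norm (series u))\<^sup>2"
    by (rule has_sum_exhaustion[OF series_norm[OF elim(2)] filterlim_upto_level[OF J0_ge1]])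
  have pair: "obs_pairing J0 \<psi> (series u) X = lim ?S"
    unfolding obs_pairing_def upto_level_def
    by (intro arg_cong[where f=lim] ext sum.cong) (auto simp: series_coef[OF elim(2)])
  define P where "P L = (\<Prod>i\<in>upto_level J0 L. factor i (u i))" for L
  have "P = (\<lambda>L. exp (real n * ?S L - real n / 2 * (\<Sum>i\<in>upto_level J0 L. (decay i * u i)\<^sup>2)))"
  proof
    fix L
    have "P L = exp (\<Sum>i\<in>upto_level J0 L. real n * (decay i * u i * X i) - real n / 2 * (decay i * u i)\<^sup>2)"
      unfolding P_def factor_def by (rule exp_sum[OF fin_upto, symmetric])
    then show "P L = exp (real n * ?S L - real n / 2 * (\<Sum>i\<in>upto_level J0 L. (decay i * u i)\<^sup>2))"
      by (simp only: sum_subtractf sum_distrib_left)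
  qed
  also have "\<dots> \<longlonglongrightarrow> exp (real n * lim ?S - real n / 2 * (norm (series u))\<^sup>2)"
    by (intro tendsto_intros S Q)
  also have "exp (real n * lim ?S - real n / 2 * (norm (series u))\<^sup>2) = lik (series u)"
    by (simp add: likelihood_def pair)
  finally have P: "P \<longlonglongrightarrow> lik (series u)" .
  show ?case
  proof (intro allI impI)
    fix F assume F: "finite F" "F \<subseteq> I"
    let ?p = "\<Prod>i\<in>F. factor i (u i)"
    have p: "?p > 0" by (intro prod_pos) (simp add: factor_def)
    have "\<forall>\<^sub>F L in sequentially. \<forall>i\<in>F. i \<in> upto_level J0 L"
      using F by (intro eventually_ball_finite ballI eventually_sequentiallyI[of "fst _"])
        (auto simp: upto_level_def)
    then have ev: "\<forall>\<^sub>F L in sequentially. ennreal (P L / ?p) = (\<Prod>i\<in>upto_level J0 L - F. ennreal (factor i (u i)))"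
    proof eventually_elim
      case (elim L)
      then have "F \<subseteq> upto_level J0 L" by auto
      then have "P L = (\<Prod>i\<in>upto_level J0 L - F. factor i (u i)) * ?p"
        unfolding P_def by (rule prod.subset_diff) (rule finite_upto_level[OF J0_ge1])
      then show ?case using p by (simp add: prod_ennreal factor_def)
    qed
    have "(\<lambda>L. ennreal (P L / ?p)) \<longlonglongrightarrow> ennreal (lik (series u) / ?p)"
      by (intro tendsto_ennrealI tendsto_divide P tendsto_const) (use p in simp)
    then have "(\<lambda>L. \<Prod>i\<in>upto_level J0 L - F. ennreal (factor i (u i))) \<longlonglongrightarrow> ennreal (lik (series u) / ?p)"
      by (rule Lim_transform_eventually[OF _ ev])
    then have "rest F u = ennreal (lik (series u) / ?p)"
      unfolding rest_def by (intro lim_imp_Liminf) auto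
    moreover have "(\<Prod>i\<in>F. ennreal (factor i (u i))) = ennreal ?p"
      by (rule prod_ennreal) (simp add: factor_def)
    ultimately show "ennreal (lik (series u)) = (\<Prod>i\<in>F. ennreal (factor i (u i))) * rest F u"
      using p by (simp add: likelihood_def flip: ennreal_mult')
  qed
qed

text \<open>Fatou's lemma, after the quadratic terms, which only lower the exponent, have been
  dropped. This makes the evidence finite; with infinite evidence the quotient in
  \<open>posterior\<close> would be 0.\<close>

lemma rest_finite: "(\<integral>\<^sup>+u. rest {} u \<partial>draws) < \<infinity>"
proof -
  let ?p = "\<lambda>L u. \<Prod>i\<in>upto_level J0 L. ennreal (factor i (u i))"
  have m: "(\<lambda>u. \<Prod>i\<in>upto_level J0 L. ennreal (factor i (u i))) \<in> borel_measurable draws" for L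
    unfolding factor_def by (intro borel_measurable_prod_ennreal)
      (auto simp: upto_level_def intro!: measurable_compose[OF measurable_component_singleton])
  have le: "(\<integral>\<^sup>+u. ?p L u \<partial>draws) \<le>
      ennreal (exp ((real n)\<^sup>2 * mass * M\<^sup>2 / 2))" for L
  proof -
    have "(\<integral>\<^sup>+u. ?p L u \<partial>draws) \<le>
        (\<integral>\<^sup>+u. ennreal (exp (\<Sum>i\<in>upto_level J0 L. real n * decay i * u i * X i)) \<partial>draws)"
    proof (rule nn_integral_mono)
      fix u
      have "?p L u = ennreal (\<Prod>i\<in>upto_level J0 L. factor i (u i))"
        by (rule prod_ennreal) (simp add: factor_def)
      also have "\<dots> \<le> ennreal (\<Prod>i\<in>upto_level J0 L. exp (real n * decay i * u i * X i))"
        by (intro ennreal_leI prod_mono) (auto simp: factor_def mult.assoc)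
      finally show "?p L u \<le>
          ennreal (exp (\<Sum>i\<in>upto_level J0 L. real n * decay i * u i * X i))"
        by (simp only: exp_sum[OF fin_upto])
    qed
    also have "\<dots> \<le> ennreal (exp ((real n)\<^sup>2 * mass * M\<^sup>2 / 2))"
    proof (rule nn_integral_draws_exp_le)
      show "upto_level J0 L \<subseteq> I" by (auto simp: upto_level_def)
      show "(real n * decay i)\<^sup>2 \<le> obs_weight i * (real n)\<^sup>2" for i
        using mult_right_mono[OF decay_sq_le[of i], of "(real n)\<^sup>2"]
        by (simp add: power_mult_distrib mult.commute)
    qed (auto simp: fin_upto)
    finally show ?thesis .
  qed
  have "(\<integral>\<^sup>+u. rest {} u \<partial>draws) \<le>
      liminf (\<lambda>L. \<integral>\<^sup>+u. ?p L u \<partial>draws)"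
    unfolding rest_def Diff_empty by (rule nn_integral_liminf) (rule m)
  also have "\<dots> \<le> liminf (\<lambda>L::nat. ennreal (exp ((real n)\<^sup>2 * mass * M\<^sup>2 / 2)))"
    by (rule Liminf_mono[OF always_eventually[OF allI[OF le]]])
  also have "\<dots> = ennreal (exp ((real n)\<^sup>2 * mass * M\<^sup>2 / 2))"
    by (rule Liminf_const) simp
  finally show ?thesis by (rule order_le_less_trans) simp
qed

lemma lik_measurable: "lik \<in> borel_measurable borel"
proof -
  note [measurable] = measurable_coef
  show ?thesis unfolding likelihood_def[abs_def] obs_pairing_def by measurable
qed

text \<open>Endpoints of the prior interval for coefficient i in the scale
  \<open>sqrt n * (coef \<psi> f i - X i)\<close>, where the Gaussian part of the likelihood is
  standard normal.\<close>

definition lo :: "nat \<times> nat \<Rightarrow> real" where "lo i = sqrt n * (- (decay i * M) - X i)"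
definition hi :: "nat \<times> nat \<Rightarrow> real" where "hi i = sqrt n * (decay i * M - X i)"

lemma lo_less_hi: "lo i < hi i"
  using n M_pos decay_pos[of i] by (simp add: lo_def hi_def)

abbreviation "tn i \<equiv> trunc_normal (lo i) (hi i)"

text \<open>The evidence of a single coordinate, that is, the integral of \<open>factor i\<close>
  under the uniform prior.\<close>

definition gfac :: "nat \<times> nat \<Rightarrow> ennreal"
  where "gfac i = ennreal (exp ((sqrt n * X i)\<^sup>2 / 2) * sqrt (2 * pi) / (2 * M * (sqrt n * decay i))) *
    emeasure std_normal {lo i..hi i}"

lemma nn_integral_factor:
  fixes g :: "real \<Rightarrow> ennreal"
  assumes g[measurable]: "g \<in> borel_measurable borel"
  shows "(\<integral>\<^sup>+x. ennreal (factor i x) * g (sqrt n * (decay i * x - X i)) \<partial>unif) =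
    gfac i * (\<integral>\<^sup>+y. g y \<partial>tn i)"
proof -
  let ?J = "{- ((sqrt n * decay i) * M) - sqrt n * X i..(sqrt n * decay i) * M - sqrt n * X i}"
  interpret prob_space std_normal by (rule prob_space_std_normal)
  have s: "sqrt n * decay i > 0" using n decay_pos[of i] by simp
  have e: "emeasure std_normal {lo i..hi i} \<noteq> 0" by (rule emeasure_std_normal_Icc_pos[OF lo_less_hi])
  have eq: "(sqrt n * decay i) * x * (sqrt n * X i) - ((sqrt n * decay i) * x)\<^sup>2 / 2 =
      n * (decay i * x * X i) - n / 2 * (decay i * x)\<^sup>2" for x
  proof -
    have "(sqrt n * decay i) * x * (sqrt n * X i) = (sqrt n * sqrt n) * (decay i * x * X i)"
      by (simp only: mult_ac)
    moreover have "((sqrt n * decay i) * x)\<^sup>2 = (sqrt n)\<^sup>2 * (decay i * x)\<^sup>2"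
      by (simp only: power_mult_distrib mult_ac)
    ultimately show ?thesis by simp
  qed
  have eq2: "(sqrt n * decay i) * x - sqrt n * X i = sqrt n * (decay i * x - X i)" for x
    by (simp add: algebra_simps)
  have "(\<integral>\<^sup>+x. ennreal (factor i x) * g (sqrt n * (decay i * x - X i)) \<partial>unif) =
      (\<integral>\<^sup>+x. ennreal (exp ((sqrt n * decay i) * x * (sqrt n * X i) - ((sqrt n * decay i) * x)\<^sup>2 / 2)) *
        g ((sqrt n * decay i) * x - sqrt n * X i) \<partial>unif)"
    by (simp only: factor_def eq eq2)
  also have "\<dots> = ennreal (exp ((sqrt n * X i)\<^sup>2 / 2) * sqrt (2 * pi) / (2 * M * (sqrt n * decay i))) *
      (\<integral>\<^sup>+y. g y * indicator ?J y \<partial>std_normal)"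
    by (rule nn_integral_gaussian_factor[OF s M_pos g])
  also have "?J = {lo i..hi i}"
    by (simp add: lo_def hi_def algebra_simps)
  also have "(\<integral>\<^sup>+y. g y * indicator {lo i..hi i} y \<partial>std_normal) =
      emeasure std_normal {lo i..hi i} * (\<integral>\<^sup>+y. g y \<partial>tn i)"
  proof -
    let ?p = "emeasure std_normal {lo i..hi i}"
    let ?S = "\<integral>\<^sup>+y. g y * indicator {lo i..hi i} y \<partial>std_normal"
    have "(\<integral>\<^sup>+y. g y \<partial>tn i) = ?S / ?p" by (rule nn_integral_uniform_measure) auto
    moreover have "?p * (?S / ?p) = ?S * ?p / ?p" by (simp only: ennreal_times_divide mult.commute)
    moreover have "?S * ?p / ?p = ?S" using e by (intro ennreal_mult_divide_eq) auto
    ultimately show ?thesis by simp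
  qed
  finally show ?thesis by (simp add: gfac_def mult.assoc)
qed

lemma nn_integral_lik_box:
  fixes g :: "nat \<times> nat \<Rightarrow> real \<Rightarrow> ennreal"
  assumes F: "finite F" "F \<subseteq> I" and g: "\<And>i. i \<in> F \<Longrightarrow> g i \<in> borel_measurable borel"
  shows "(\<integral>\<^sup>+f. ennreal (lik f) * (\<Prod>i\<in>F. g i (sqrt n * (coef \<psi> f i - X i))) \<partial>prior) =
    (\<Prod>i\<in>F. gfac i * (\<integral>\<^sup>+y. g i y \<partial>tn i)) * (\<integral>\<^sup>+u. rest F u \<partial>draws)"
proof -
  let ?g = "\<lambda>f. \<Prod>i\<in>F. g i (sqrt n * (coef \<psi> f i - X i))"
  let ?u = "\<lambda>u. \<Prod>i\<in>F. g i (sqrt n * (coef \<psi> (series u) i - X i))"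
  note [measurable] = measurable_coef lik_measurable
  have gm: "(\<lambda>f. g i (sqrt n * (coef \<psi> f i - X i))) \<in> borel_measurable borel" if "i \<in> F" for i
    by (rule measurable_compose[OF _ g[OF that]]) measurable
  have hm: "(\<lambda>f. ennreal (lik f) * ?g f) \<in> borel_measurable borel"
    by (intro borel_measurable_times_ennreal borel_measurable_prod_ennreal gm
      measurable_compose[OF lik_measurable measurable_ennreal])
  have "(\<integral>\<^sup>+f. ennreal (lik f) * ?g f \<partial>prior) =
      (\<integral>\<^sup>+u. ennreal (lik (series u)) * ?u u \<partial>draws)"
    unfolding prior_def by (subst nn_integral_distr[OF measurable_series]) (simp_all add: hm)
  also have "\<dots> = (\<integral>\<^sup>+u. (\<Prod>i\<in>F. ennreal (factor i (u i)) * g i (sqrt n * (decay i * u i - X i))) * rest F u \<partial>draws)"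
  proof (rule nn_integral_cong_AE)
    show "AE u in draws. ennreal (lik (series u)) * ?u u =
        (\<Prod>i\<in>F. ennreal (factor i (u i)) * g i (sqrt n * (decay i * u i - X i))) * rest F u"
      using AE_likelihood_factor AE_draws
    proof eventually_elim
      case (elim u)
      have "?u u = (\<Prod>i\<in>F. g i (sqrt n * (decay i * u i - X i)))"
        using F(2) by (intro prod.cong) (auto simp: series_coef[OF elim(2)])
      moreover have "ennreal (lik (series u)) = (\<Prod>i\<in>F. ennreal (factor i (u i))) * rest F u"
        using elim(1) F by blast
      ultimately show ?case by (simp add: prod.distrib mult_ac)
    qed
  qed
  also have "\<dots> = (\<Prod>i\<in>F. \<integral>\<^sup>+x. ennreal (factor i x) * g i (sqrt n * (decay i * x - X i)) \<partial>unif) *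
      (\<integral>\<^sup>+u. rest F u \<partial>draws)"
  proof (rule nn_integral_PiM_factor[OF prob_space_unif F _ rest_measurable])
    fix i assume "i \<in> F"
    note [measurable] = g[OF this]
    show "(\<lambda>x. ennreal (factor i x) * g i (sqrt n * (decay i * x - X i))) \<in> borel_measurable unif"
      unfolding factor_def by measurable
  qed (auto simp: rest_fun_upd)
  also have "(\<Prod>i\<in>F. \<integral>\<^sup>+x. ennreal (factor i x) * g i (sqrt n * (decay i * x - X i)) \<partial>unif) =
      (\<Prod>i\<in>F. gfac i * (\<integral>\<^sup>+y. g i y \<partial>tn i))"
    by (intro prod.cong nn_integral_factor g) auto
  finally show ?thesis .
qed

lemma evidence_eq:
  assumes "finite F" "F \<subseteq> I"
  shows "evidence = (\<Prod>i\<in>F. gfac i) * (\<integral>\<^sup>+u. rest F u \<partial>draws)"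
  using nn_integral_lik_box[OF assms, of "\<lambda>_ _. 1"]
    prob_space.emeasure_space_1[OF prob_space_trunc_normal[OF lo_less_hi]]
  by (simp del: emeasure_uniform_measure)

lemma evidence_finite: "evidence \<noteq> \<infinity>"
  using evidence_eq[of "{}"] rest_finite by (simp add: less_top)

lemma evidence_pos: "evidence \<noteq> 0"
proof
  note [measurable] = lik_measurable
  interpret prob_space prior by (rule prob_space_prior)
  have sets: "sets prior = sets borel" by (simp add: prior_def)
  have [measurable]: "lik \<in> borel_measurable prior"
    using lik_measurable by (simp cong: measurable_cong_sets add: sets)
  assume "evidence = 0"
  then have "AE f in prior. ennreal (lik f) = 0" by (subst (asm) nn_integral_0_iff_AE) auto
  then have "AE f in prior. False" by eventually_elim (simp add: likelihood_def)
  then show False by simp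
qed

text \<open>The integral of \<open>rest F\<close> and the constants \<open>gfac i\<close> occur both
  in the numerator and in the evidence and cancel, so the other coordinates need not be integrated
  explicitly. The finite-dimensional marginals obtained here determine all that is needed of the
  posterior.\<close>

theorem nn_integral_posterior:
  fixes g :: "nat \<times> nat \<Rightarrow> real \<Rightarrow> ennreal"
  assumes F: "finite F" "F \<subseteq> I" and g: "\<And>i. i \<in> F \<Longrightarrow> g i \<in> borel_measurable borel"
  shows "(\<integral>\<^sup>+f. (\<Prod>i\<in>F. g i (sqrt n * (coef \<psi> f i - X i))) \<partial>post) = (\<Prod>i\<in>F. \<integral>\<^sup>+y. g i y \<partial>tn i)"
proof -
  let ?g = "\<lambda>f. \<Prod>i\<in>F. g i (sqrt n * (coef \<psi> f i - X i))"
  have sets: "sets prior = sets borel" by (simp add: prior_def)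
  have lm: "(\<lambda>f. ennreal (lik f)) \<in> borel_measurable prior"
    using lik_measurable by (auto simp: measurable_cong_sets[OF sets refl])
  have gm: "(\<lambda>f. \<Prod>i\<in>F. g i (sqrt n * (coef \<psi> f i - X i))) \<in> borel_measurable prior"
    unfolding measurable_cong_sets[OF sets refl]
  proof (intro borel_measurable_prod_ennreal)
    note [measurable] = measurable_coef
    fix i assume "i \<in> F"
    then show "(\<lambda>f. g i (sqrt n * (coef \<psi> f i - X i))) \<in> borel_measurable borel"
      by (intro measurable_compose[OF _ g]) measurable
  qed
  have "(\<integral>\<^sup>+f. ?g f \<partial>post) =
      (\<integral>\<^sup>+f. ennreal (lik f) / evidence * ?g f \<partial>prior)"
    unfolding posterior_def by (rule nn_integral_density) (use lm gm in auto)
  also have "\<dots> = (\<integral>\<^sup>+f. ennreal (lik f) * ?g f / evidence \<partial>prior)"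
    by (simp add: divide_ennreal_def mult_ac)
  also have "\<dots> = (\<integral>\<^sup>+f. ennreal (lik f) * ?g f \<partial>prior) / evidence"
    by (intro nn_integral_divide borel_measurable_times_ennreal lm gm)
  also have "\<dots> = (\<Prod>i\<in>F. \<integral>\<^sup>+y. g i y \<partial>tn i) * evidence / evidence"
    using nn_integral_lik_box[OF F, of g] g evidence_eq[OF F] by (simp add: prod.distrib mult_ac)
  also have "\<dots> = (\<Prod>i\<in>F. \<integral>\<^sup>+y. g i y \<partial>tn i)"
    using evidence_pos evidence_finite by (intro ennreal_mult_divide_eq) auto
  finally show ?thesis .
qed

end

section \<open>The weak norm, and the marginals and mean of the posterior\<close>

lemma coef_diff: "coef \<psi> (f - g) i = coef \<psi> f i - coef \<psi> g i"
  by (simp add: coef_def inner_diff_right)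

context wavelet_prior
begin

abbreviation "gauss \<equiv> PiM I (\<lambda>_. std_normal)"

lemma prob_space_gauss: "prob_space gauss"
  by (intro prob_space_PiM prob_space_std_normal)

lemma weight_le: "i \<in> I \<Longrightarrow> weight i \<le> (\<Sum>\<^sub>\<infinity>j\<in>I. weight j)"
  using finite_sum_le_infsum[OF weight_summable, of "{i}"] weight_nonneg by simp

lemma coef_sq_summable: "(\<lambda>i. (coef \<psi> g i)\<^sup>2) summable_on I"
  unfolding coef_def by (rule orthonormal_coef_summable[OF on])

lemma weighted_coef_summable: "(\<lambda>i. weight i * (coef \<psi> g i)\<^sup>2) summable_on I"
proof (rule summable_on_comparison_test)
  show "(\<lambda>i. (\<Sum>\<^sub>\<infinity>j\<in>I. weight j) * (coef \<psi> g i)\<^sup>2) summable_on I"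
    by (intro summable_on_cmult_right coef_sq_summable)
qed (auto intro!: mult_right_mono weight_le mult_nonneg_nonneg weight_nonneg)

text \<open>This is n times the squared weak norm; the square is used because it is additive over
  coordinates.\<close>

definition dispersion :: "nat \<Rightarrow> l2 \<Rightarrow> real"
  where "dispersion n g = (\<Sum>\<^sub>\<infinity>i\<in>I. weight i * (sqrt n * coef \<psi> g i)\<^sup>2)"

lemma dispersion_summable: "(\<lambda>i. weight i * (sqrt (real n) * coef \<psi> g i)\<^sup>2) summable_on I"
  using summable_on_cmult_right[OF weighted_coef_summable, of "real n" g]
  by (simp add: power_mult_distrib mult_ac)

lemma dispersion_nonneg: "dispersion n g \<ge> 0"
  unfolding dispersion_def by (intro infsum_nonneg mult_nonneg_nonneg weight_nonneg) auto

lemma dispersion_measurable: "dispersion n \<in> borel_measurable borel"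
proof -
  note [measurable] = measurable_coef
  show ?thesis unfolding dispersion_def[abs_def]
    by (rule borel_measurable_infsum_nonneg[OF countable_cdv_index])
      (measurable, simp add: weight_nonneg)
qed

text \<open>The condition 0 \<le> r is kept separate because a radius is not known to be nonnegative
  in advance and squaring would lose its sign.\<close>

lemma H_norm_le_iff:
  assumes "n \<ge> 1"
  shows "H_norm J0 \<delta> (coef \<psi> g) \<le> r / sqrt n \<longleftrightarrow> 0 \<le> r \<and> dispersion n g \<le> r\<^sup>2"
proof -
  have "dispersion n g = real n * (\<Sum>\<^sub>\<infinity>i\<in>I. weight i * (coef \<psi> g i)\<^sup>2)"
    unfolding dispersion_def infsum_cmult_right'[symmetric] by (simp add: power_mult_distrib mult_ac)
  then have "sqrt (dispersion n g) = sqrt n * H_norm J0 \<delta> (coef \<psi> g)"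
    by (simp add: H_norm_eq real_sqrt_mult)
  then have "H_norm J0 \<delta> (coef \<psi> g) \<le> r / sqrt n \<longleftrightarrow> sqrt (dispersion n g) \<le> r"
    using assms by (simp add: field_simps)
  also have "\<dots> \<longleftrightarrow> 0 \<le> r \<and> dispersion n g \<le> r\<^sup>2"
    using dispersion_nonneg[of n g] real_sqrt_ge_zero[of "dispersion n g"]
    by (metis order_trans real_le_lsqrt real_sqrt_le_iff real_sqrt_abs abs_of_nonneg)
  finally show ?thesis .
qed

end

context wavelet_posterior
begin

abbreviation "std f i \<equiv> sqrt n * (coef \<psi> f i - X i)"

lemma sets_post: "sets post = sets borel" and space_post: "space post = UNIV"
  by (simp_all add: posterior_def prior_def)

lemma std_measurable: "(\<lambda>f. std f i) \<in> borel_measurable post"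
proof -
  note [measurable] = measurable_coef
  show ?thesis unfolding measurable_cong_sets[OF sets_post refl] by measurable
qed

lemma prob_space_post: "prob_space post"
proof
  show "emeasure post (space post) = 1"
    using nn_integral_posterior[of "{}"] by simp
qed

lemma prob_space_tn: "prob_space (tn i)"
  by (rule prob_space_trunc_normal[OF lo_less_hi])

lemma emeasure_post_box:
  assumes F: "finite F" "F \<subseteq> I" and A: "\<And>i. i \<in> F \<Longrightarrow> A i \<in> sets borel"
  shows "emeasure post {f. \<forall>i\<in>F. std f i \<in> A i} = (\<Prod>i\<in>F. emeasure (tn i) (A i))"
proof -
  have S: "{f \<in> space post. \<forall>i\<in>F. std f i \<in> A i} \<in> sets post"
    using F(1) A by (intro sets.sets_Collect_finite_All measurable_sets_Collect[OF std_measurable]) auto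
  have "emeasure post {f. \<forall>i\<in>F. std f i \<in> A i} = (\<integral>\<^sup>+f. indicator {f \<in> space post. \<forall>i\<in>F. std f i \<in> A i} f \<partial>post)"
    using S by (simp add: space_post)
  also have "\<dots> = (\<integral>\<^sup>+f. (\<Prod>i\<in>F. indicator (A i) (std f i)) \<partial>post)"
    using F(1) by (intro nn_integral_cong) (auto simp: indicator_def space_post prod_zero_iff)
  also have "\<dots> = (\<Prod>i\<in>F. \<integral>\<^sup>+y. indicator (A i) y \<partial>tn i)"
    by (rule nn_integral_posterior[OF F]) (use A in auto)
  also have "\<dots> = (\<Prod>i\<in>F. emeasure (tn i) (A i))"
    using A by (intro prod.cong nn_integral_indicator) auto
  finally show ?thesis .
qed

lemma distr_post_std:
  assumes "i \<in> I" shows "distr post borel (\<lambda>f. std f i) = tn i"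
proof (rule measure_eqI)
  fix A assume "A \<in> sets (distr post borel (\<lambda>f. std f i))"
  then have A: "A \<in> sets borel" by simp
  have "emeasure (distr post borel (\<lambda>f. std f i)) A = emeasure post {f. \<forall>j\<in>{i}. std f j \<in> A}"
    by (simp add: emeasure_distr[OF std_measurable] A space_post vimage_def)
  also have "\<dots> = emeasure (tn i) A"
    using emeasure_post_box[of "{i}" "\<lambda>_. A"] A assms by (simp del: emeasure_uniform_measure)
  finally show "emeasure (distr post borel (\<lambda>f. std f i)) A = emeasure (tn i) A" .
qed simp

abbreviation "mean \<equiv> posterior_mean J0 \<psi> prior n X"
abbreviation "tmean i \<equiv> trunc_mean (lo i) (hi i)"

text \<open>Prior draws lie in a fixed ball of \<open>l2\<close> and the posterior has a density
  with respect to the prior. Hence the posterior mean is a genuine Bochner integral.\<close>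

lemma AE_post_norm: "AE f in post. norm f \<le> M * sqrt (\<Sum>\<^sub>\<infinity>i\<in>I. (decay i)\<^sup>2)"
proof -
  let ?B = "M * sqrt (\<Sum>\<^sub>\<infinity>i\<in>I. (decay i)\<^sup>2)"
  have "AE u in draws. norm (series u) \<le> ?B"
    using AE_draws
  proof eventually_elim
    case (elim u)
    have "(norm (series u))\<^sup>2 \<le> M\<^sup>2 * (\<Sum>\<^sub>\<infinity>i\<in>I. (decay i)\<^sup>2)"
    proof (rule has_sum_mono[OF series_norm[OF elim]])
      show "((\<lambda>i. M\<^sup>2 * (decay i)\<^sup>2) has_sum M\<^sup>2 * (\<Sum>\<^sub>\<infinity>i\<in>I. (decay i)\<^sup>2)) I"
        by (intro has_sum_cmult_right has_sum_infsum decay_sq_summable)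
      fix i assume "i \<in> I"
      then have "\<bar>u i\<bar>\<^sup>2 \<le> M\<^sup>2" using elim by (intro power_mono) auto
      then show "(decay i * u i)\<^sup>2 \<le> M\<^sup>2 * (decay i)\<^sup>2"
        by (simp add: power_mult_distrib mult.commute[of "M\<^sup>2"] mult_left_mono)
    qed
    then have "sqrt ((norm (series u))\<^sup>2) \<le> sqrt (M\<^sup>2 * (\<Sum>\<^sub>\<infinity>i\<in>I. (decay i)\<^sup>2))" by (rule real_sqrt_le_mono)
    then show ?case using M_pos by (simp add: real_sqrt_mult)
  qed
  then have "AE f in prior. norm f \<le> ?B"
    unfolding prior_def by (subst AE_distr_iff[OF measurable_series]) auto
  then show ?thesis
    unfolding posterior_def
    by (subst AE_density) (use lik_measurable in \<open>auto simp: prior_def elim: eventually_mono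
      intro!: borel_measurable_divide_ennreal measurable_compose[OF lik_measurable measurable_ennreal]\<close>)
qed

lemma integrable_post_id: "integrable post (\<lambda>f. f)"
proof -
  interpret prob_space post by (rule prob_space_post)
  show ?thesis
    by (rule integrable_const_bound[OF AE_post_norm])
      (simp add: measurable_cong_sets[OF sets_post refl])
qed

text \<open>Taking a coefficient is continuous and linear, so it commutes with the Bochner integral;
  what remains is the mean of a one-dimensional marginal.\<close>

lemma std_mean:
  assumes "i \<in> I" shows "sqrt n * (coef \<psi> mean i - X i) = tmean i"
proof -
  interpret prob_space post by (rule prob_space_post)
  note hb = has_bochner_integral_trunc_normal_mean[OF lo_less_hi[of i], unfolded has_bochner_integral_iff]
  have int: "integrable post (\<lambda>f. coef \<psi> f i)"
    unfolding coef_def using integrable_post_id by (rule integrable_inner_right)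
  have c: "coef \<psi> mean i = (LINT f|post. coef \<psi> f i)"
    unfolding coef_def posterior_mean_def by (rule integral_inner_right[symmetric]) (rule integrable_post_id)
  have "tmean i = (LINT y|distr post borel (\<lambda>f. std f i). y)"
    unfolding distr_post_std[OF assms] using hb by simp
  also have "\<dots> = (LINT f|post. std f i)"
    by (rule integral_distr[OF std_measurable]) simp
  also have "\<dots> = sqrt n * (coef \<psi> mean i - X i)"
    using int prob_space by (simp add: c)
  finally show ?thesis by simp
qed

lemma std_centered:
  assumes "i \<in> I" shows "sqrt n * coef \<psi> (f - mean) i = std f i - tmean i"
  using std_mean[OF assms] by (simp add: coef_diff algebra_simps)

text \<open>Tonelli and the variance bound for each truncated normal; the right side depends neither
  on n nor on the data. With G = I it controls the credible radius, with cofinite G it gives uniform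
  tightness in the weak norm.\<close>

lemma nn_integral_tail_le:
  assumes "G \<subseteq> I"
  shows "(\<integral>\<^sup>+f. ennreal (\<Sum>\<^sub>\<infinity>i\<in>G. weight i * (sqrt n * coef \<psi> (f - mean) i)\<^sup>2) \<partial>post) \<le>
    ennreal (\<Sum>\<^sub>\<infinity>i\<in>G. weight i)"
proof -
  have cG: "countable G" using assms countable_cdv_index by (rule countable_subset)
  have wG: "weight summable_on G" using weight_summable assms by (rule summable_on_subset_banach)
  let ?t = "\<lambda>f i. weight i * (sqrt n * coef \<psi> (f - mean) i)\<^sup>2"
  have tm: "(\<lambda>f. ennreal (?t f i)) \<in> borel_measurable post" for i
  proof -
    note [measurable] = measurable_coef
    show ?thesis unfolding measurable_cong_sets[OF sets_post refl] by measurable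
  qed
  have "(\<integral>\<^sup>+f. ennreal (\<Sum>\<^sub>\<infinity>i\<in>G. ?t f i) \<partial>post) = (\<integral>\<^sup>+f. (\<integral>\<^sup>+i. ennreal (?t f i) \<partial>count_space G) \<partial>post)"
    by (intro nn_integral_cong nn_integral_count_space_eq_infsum[symmetric]
      summable_on_subset_banach[OF dispersion_summable assms]) (simp add: weight_nonneg)
  also have "\<dots> = (\<integral>\<^sup>+i. (\<integral>\<^sup>+f. ennreal (?t f i) \<partial>post) \<partial>count_space G)"
    by (rule nn_integral_count_space_nn_integral[OF cG tm])
  also have "\<dots> \<le> (\<integral>\<^sup>+i. ennreal (weight i) \<partial>count_space G)"
  proof (rule nn_integral_mono)
    fix i assume "i \<in> space (count_space G)"
    then have i: "i \<in> I" using assms by auto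
    interpret T: prob_space "tn i" by (rule prob_space_tn)
    have "(\<integral>\<^sup>+f. ennreal (?t f i) \<partial>post) = (\<integral>\<^sup>+f. ennreal (weight i * (std f i - tmean i)\<^sup>2) \<partial>post)"
      by (simp only: std_centered[OF i])
    also have "\<dots> = (\<integral>\<^sup>+y. ennreal (weight i * (y - tmean i)\<^sup>2) \<partial>distr post borel (\<lambda>f. std f i))"
      by (rule nn_integral_distr[OF std_measurable, symmetric]) simp
    also have "\<dots> = (\<integral>\<^sup>+y. ennreal (weight i * (y - tmean i)\<^sup>2) \<partial>tn i)"
      by (simp only: distr_post_std[OF i])
    also have "\<dots> = ennreal (weight i * (LINT y|tn i. (y - tmean i)\<^sup>2))"
      using trunc_normal_variance(1)[OF lo_less_hi[of i]]
      by (subst nn_integral_eq_integral) (auto simp: weight_nonneg)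
    also have "\<dots> \<le> ennreal (weight i * 1)"
      by (intro ennreal_leI mult_left_mono trunc_normal_variance(2) lo_less_hi weight_nonneg)
    finally show "(\<integral>\<^sup>+f. ennreal (?t f i) \<partial>post) \<le> ennreal (weight i)" by simp
  qed
  also have "\<dots> = ennreal (\<Sum>\<^sub>\<infinity>i\<in>G. weight i)"
    by (rule nn_integral_count_space_eq_infsum[OF wG]) (rule weight_nonneg)
  finally show ?thesis .
qed

definition box :: "(nat \<times> nat) set \<Rightarrow> (nat \<times> nat \<Rightarrow> real) set"
  where "box F = {z \<in> space gauss. \<forall>i\<in>F. z i \<in> {lo i..hi i}}"

lemma emeasure_gauss_Collect:
  assumes "finite F" "F \<subseteq> I" "\<And>i. i \<in> F \<Longrightarrow> A i \<in> sets borel"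
  shows "emeasure gauss {z \<in> space gauss. \<forall>i\<in>F. z i \<in> A i} = (\<Prod>i\<in>F. emeasure std_normal (A i))"
proof -
  interpret product_prob_space "\<lambda>_. std_normal" I
    by (intro product_prob_spaceI prob_space_std_normal)
  show ?thesis by (rule emeasure_PiM_Collect) (use assms in auto)
qed

lemma measure_box:
  assumes "finite F" "F \<subseteq> I"
  shows "measure gauss (box F) = (\<Prod>i\<in>F. measure std_normal {lo i..hi i})"
  using emeasure_gauss_Collect[OF assms, of "\<lambda>i. {lo i..hi i}"]
    finite_measure.emeasure_eq_measure[OF prob_space.finite_measure[OF prob_space_std_normal]]
    finite_measure.emeasure_eq_measure[OF prob_space.finite_measure[OF prob_space_gauss]]
  by (simp add: box_def prod_ennreal prod_nonneg)

lemma box_sets: "finite F \<Longrightarrow> F \<subseteq> I \<Longrightarrow> box F \<in> sets gauss"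
  unfolding box_def
  by (intro sets.sets_Collect_finite_All measurable_sets_Collect[of _ gauss std_normal]) auto

text \<open>Both sides are the product of the laws \<open>tn i\<close>. The right side uses the same
  Gaussian space for every n, where only the conditioning event moves, so that dominated convergence
  becomes available.\<close>

lemma distr_post_block:
  assumes F: "finite F" "F \<subseteq> I"
  shows "distr post (PiM F (\<lambda>_. borel)) (\<lambda>f. \<lambda>i\<in>F. std f i) =
    distr (uniform_measure gauss (box F)) (PiM F (\<lambda>_. borel)) (\<lambda>z. \<lambda>i\<in>F. z i)"
    (is "?L = ?R")
proof -
  interpret N: prob_space std_normal by (rule prob_space_std_normal)
  interpret G: prob_space gauss by (rule prob_space_gauss)
  interpret P: product_prob_space tn UNIV by (intro product_prob_spaceI prob_space_tn)
  have sets: "sets (PiM F (\<lambda>_. borel)) = sets (PiM F tn)" by (intro sets_PiM_cong) auto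
  have mL: "(\<lambda>f. \<lambda>i\<in>F. std f i) \<in> measurable post (PiM F (\<lambda>_. borel))"
    by (intro measurable_restrict std_measurable)
  have mR: "(\<lambda>z. \<lambda>i\<in>F. z i) \<in> measurable (uniform_measure gauss (box F)) (PiM F (\<lambda>_. borel))"
    by (intro measurable_restrict) (use F in \<open>auto intro!: measurable_component_singleton\<close>)
  have J: "measure std_normal {lo i..hi i} > 0" for i
    by (rule measure_std_normal_Icc_pos[OF lo_less_hi])
  have b: "measure gauss (box F) > 0" unfolding measure_box[OF F] by (intro prod_pos J)
  have "?L = PiM F tn"
  proof (rule P.PiM_eqI[OF F(1)])
    fix A assume A: "\<And>i. i \<in> F \<Longrightarrow> A i \<in> sets (tn i)"
    then have A': "\<And>i. i \<in> F \<Longrightarrow> A i \<in> sets borel" by simp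
    have "emeasure ?L (Pi\<^sub>E F A) = emeasure post {f. \<forall>i\<in>F. std f i \<in> A i}"
      using F A' by (subst emeasure_distr[OF mL])
        (auto intro!: sets_PiM_I_finite arg_cong[where f="emeasure post"] simp: space_post PiE_iff)
    then show "emeasure ?L (Pi\<^sub>E F A) = (\<Prod>i\<in>F. emeasure (tn i) (A i))"
      using emeasure_post_box[OF F A'] by simp
  qed (simp add: sets)
  moreover have "?R = PiM F tn"
  proof (rule P.PiM_eqI[OF F(1)])
    fix A assume A: "\<And>i. i \<in> F \<Longrightarrow> A i \<in> sets (tn i)"
    then have A': "\<And>i. i \<in> F \<Longrightarrow> A i \<in> sets borel" by simp
    let ?V = "{z \<in> space gauss. \<forall>i\<in>F. z i \<in> A i}"
    have V: "?V \<in> sets gauss"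
      using F A' by (intro sets.sets_Collect_finite_All measurable_sets_Collect[of _ gauss std_normal]) auto
    have "(\<lambda>z. \<lambda>i\<in>F. z i) -` Pi\<^sub>E F A \<inter> space (uniform_measure gauss (box F)) = ?V"
      by (auto simp: PiE_iff)
    then have "emeasure ?R (Pi\<^sub>E F A) = emeasure (uniform_measure gauss (box F)) ?V"
      using F A' by (subst emeasure_distr[OF mR]) (auto intro!: sets_PiM_I_finite)
    also have "\<dots> = emeasure gauss (box F \<inter> ?V) / emeasure gauss (box F)"
      using box_sets[OF F] V by (rule emeasure_uniform_measure)
    also have "box F \<inter> ?V = {z \<in> space gauss. \<forall>i\<in>F. z i \<in> {lo i..hi i} \<inter> A i}"
      by (auto simp: box_def)
    also have "emeasure gauss \<dots> = (\<Prod>i\<in>F. emeasure std_normal ({lo i..hi i} \<inter> A i))"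
      by (rule emeasure_gauss_Collect[OF F]) (use A' in auto)
    also have "\<dots> / emeasure gauss (box F) =
        ennreal ((\<Prod>i\<in>F. measure std_normal ({lo i..hi i} \<inter> A i)) / (\<Prod>i\<in>F. measure std_normal {lo i..hi i}))"
      using b measure_box[OF F]
      by (simp add: N.emeasure_eq_measure G.emeasure_eq_measure prod_ennreal prod_nonneg divide_ennreal)
    also have "\<dots> = ennreal (\<Prod>i\<in>F. measure (tn i) (A i))"
      using A' emeasure_std_normal_Icc_pos[OF lo_less_hi]
      by (simp add: prod_dividef[symmetric] N.emeasure_eq_measure)
    also have "\<dots> = (\<Prod>i\<in>F. emeasure (tn i) (A i))"
      by (simp add: P.M.emeasure_eq_measure prod_ennreal del: measure_uniform_measure emeasure_uniform_measure)
    finally show "emeasure ?R (Pi\<^sub>E F A) = (\<Prod>i\<in>F. emeasure (tn i) (A i))" .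
  qed (simp add: sets)
  ultimately show ?thesis by simp
qed

end

section \<open>Limit theorems\<close>

lemma infsum_eq_integral_count_space:
  fixes f :: "'i \<Rightarrow> real"
  assumes "integrable (count_space I) f"
  shows "infsum f I = (LINT i|count_space I. f i)"
  using infsetsum_infsum[of f I] assms by (simp add: infsetsum_def abs_summable_on_def)

lemma integrable_count_space_nonneg:
  fixes h :: "'i \<Rightarrow> real"
  assumes "h summable_on I" "\<And>i. i \<in> I \<Longrightarrow> 0 \<le> h i"
  shows "integrable (count_space I) h"
proof (rule integrableI_bounded)
  have "(\<integral>\<^sup>+i. ennreal (norm (h i)) \<partial>count_space I) = (\<integral>\<^sup>+i. ennreal (h i) \<partial>count_space I)"
    by (rule nn_integral_cong) (simp add: assms)
  then show "(\<integral>\<^sup>+i. ennreal (norm (h i)) \<partial>count_space I) < \<infinity>"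
    using summable_on_iff_nn_integral_finite[of I h] assms by simp
qed simp

lemma infsum_dominated_convergence:
  fixes f :: "nat \<Rightarrow> 'i \<Rightarrow> real"
  assumes h: "h summable_on I" and le: "\<And>n i. i \<in> I \<Longrightarrow> \<bar>f n i\<bar> \<le> h i"
    and lim: "\<And>i. i \<in> I \<Longrightarrow> (\<lambda>n. f n i) \<longlonglongrightarrow> g i"
  shows "(\<lambda>n. infsum (f n) I) \<longlonglongrightarrow> infsum g I"
proof -
  have hi: "integrable (count_space I) h"
  proof (rule integrable_count_space_nonneg[OF h])
    fix i assume "i \<in> I"
    from le[OF this, of 0] show "0 \<le> h i" by linarith
  qed
  have l: "AE i in count_space I. (\<lambda>n. f n i) \<longlonglongrightarrow> g i"
    by (rule AE_I2) (simp add: lim)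
  have b: "AE i in count_space I. norm (f n i) \<le> h i" for n
    by (rule AE_I2) (simp add: le)
  have m: "g \<in> borel_measurable (count_space I)" "f n \<in> borel_measurable (count_space I)" for n
    by simp_all
  have "(\<lambda>n. LINT i|count_space I. f n i) \<longlonglongrightarrow> (LINT i|count_space I. g i)"
    by (rule integral_dominated_convergence[OF m hi l b])
  then show ?thesis
    using integrable_dominated_convergence[OF m hi l b]
      integrable_dominated_convergence2[OF m(1) m(2) hi l b]
    by (simp add: infsum_eq_integral_count_space)
qed

lemma integral_uniform_measure:
  fixes f :: "'a \<Rightarrow> real"
  assumes A: "A \<in> sets M" "measure M A > 0" and f: "f \<in> borel_measurable M"
  shows "(LINT x|uniform_measure M A. f x) = (LINT x|M. f x * indicator A x) / measure M A"
proof -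
  have e: "emeasure M A = ennreal (measure M A)"
    using A(2) by (intro emeasure_eq_ennreal_measure) (auto simp: measure_def)
  have "uniform_measure M A = density M (\<lambda>x. ennreal (indicator A x / measure M A))"
    unfolding uniform_measure_def e using A
    by (intro density_cong) (auto simp: indicator_def simp flip: divide_ennreal)
  then have "(LINT x|uniform_measure M A. f x) = (LINT x|M. (indicator A x / measure M A) *\<^sub>R f x)"
    using A f by (simp add: integral_density)
  also have "\<dots> = (LINT x|M. f x * indicator A x / measure M A)"
    by (intro Bochner_Integration.integral_cong) auto
  finally show ?thesis by simp
qed

lemma infsum_split_finite:
  fixes f :: "'i \<Rightarrow> real"
  assumes "f summable_on I" "finite F" "F \<subseteq> I"
  shows "infsum f I = sum f F + infsum f (I - F)"
proof -
  have "infsum f (F \<union> (I - F)) = infsum f F + infsum f (I - F)"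
    using assms by (intro infsum_Un_disjoint) (auto intro: summable_on_subset_banach)
  moreover have "F \<union> (I - F) = I" using assms by auto
  ultimately show ?thesis using assms by simp
qed

text \<open>\<open>cts_step x y\<close> is the affine function (y - t)/(y - x) clamped to [0, 1],
  and clamping is a contraction.\<close>

lemma cts_step_lipschitz:
  assumes "x < y" shows "\<bar>cts_step x y a - cts_step x y b\<bar> \<le> \<bar>a - b\<bar> / (y - x)"
proof -
  have *: "cts_step x y t = max 0 (min 1 ((y - t) / (y - x)))" for t
    using assms by (auto simp: cts_step_def max_def min_def field_simps)
  have "\<bar>max 0 (min 1 s) - max 0 (min 1 t)\<bar> \<le> \<bar>s - t\<bar>" for s t :: real by auto
  then have "\<bar>cts_step x y a - cts_step x y b\<bar> \<le> \<bar>(y - a) / (y - x) - (y - b) / (y - x)\<bar>"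
    unfolding * .
  also have "\<dots> = \<bar>a - b\<bar> / (y - x)"
    using assms by (simp add: diff_divide_distrib[symmetric] abs_minus_commute)
  finally show ?thesis .
qed

lemma cts_step_bounds: "\<bar>cts_step x y t\<bar> \<le> 1"
  by (auto simp: cts_step_def field_simps)

lemma isCont_cts_step: "x < y \<Longrightarrow> isCont (cts_step x y) t"
  using uniformly_continuous_imp_continuous[OF cts_step_uniformly_continuous, of x y]
  by (simp add: continuous_on_eq_continuous_at)

lemma borel_measurable_cts_step: "x < y \<Longrightarrow> cts_step x y \<in> borel_measurable borel"
  using uniformly_continuous_imp_continuous[OF cts_step_uniformly_continuous, of x y]
  by (rule borel_measurable_continuous_onI)

text \<open>Converts a bound on the mean of a perturbation into a bound on integrals of test
  functions; it removes the high levels at a cost uniform in n.\<close>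

lemma integral_cts_step_diff_le:
  assumes P: "prob_space P" and xy: "x < y"
    and m: "A \<in> borel_measurable P" "B \<in> borel_measurable P"
    and le: "AE w in P. \<bar>A w - B w\<bar> \<le> E w" and E: "(\<integral>\<^sup>+w. ennreal (E w) \<partial>P) \<le> ennreal t"
    and Em: "(\<lambda>w. ennreal (E w)) \<in> borel_measurable P" and t: "t \<ge> 0"
  shows "\<bar>(LINT w|P. cts_step x y (A w)) - (LINT w|P. cts_step x y (B w))\<bar> \<le> t / (y - x)"
proof -
  interpret prob_space P by fact
  note [measurable] = measurable_compose[OF m(1) borel_measurable_cts_step[OF xy]]
    measurable_compose[OF m(2) borel_measurable_cts_step[OF xy]]
  have i: "integrable P (\<lambda>w. cts_step x y (A w))" "integrable P (\<lambda>w. cts_step x y (B w))"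
    by (rule integrable_const_bound[of _ 1]; simp add: cts_step_bounds)+
  have "ennreal \<bar>LINT w|P. cts_step x y (A w) - cts_step x y (B w)\<bar> \<le>
      (\<integral>\<^sup>+w. ennreal \<bar>cts_step x y (A w) - cts_step x y (B w)\<bar> \<partial>P)"
    using integral_norm_bound_ennreal[OF Bochner_Integration.integrable_diff[OF i]] by simp
  also have "\<dots> \<le> (\<integral>\<^sup>+w. ennreal (1 / (y - x)) * ennreal (E w) \<partial>P)"
  proof (rule nn_integral_mono_AE)
    show "AE w in P. ennreal \<bar>cts_step x y (A w) - cts_step x y (B w)\<bar> \<le> ennreal (1 / (y - x)) * ennreal (E w)"
      using le
    proof eventually_elim
      case (elim w)
      have "\<bar>cts_step x y (A w) - cts_step x y (B w)\<bar> \<le> \<bar>A w - B w\<bar> / (y - x)"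
        by (rule cts_step_lipschitz[OF xy])
      also have "\<dots> \<le> E w / (y - x)" using elim xy by (intro divide_right_mono) auto
      finally show ?case using xy elim by (simp add: ennreal_leI flip: ennreal_mult')
    qed
  qed
  also have "\<dots> = ennreal (1 / (y - x)) * (\<integral>\<^sup>+w. ennreal (E w) \<partial>P)"
    by (rule nn_integral_cmult[OF Em])
  also have "\<dots> \<le> ennreal (1 / (y - x)) * ennreal t" by (intro mult_left_mono E) auto
  also have "\<dots> = ennreal (t / (y - x))" using xy t by (simp flip: ennreal_mult')
  finally have "\<bar>LINT w|P. cts_step x y (A w) - cts_step x y (B w)\<bar> \<le> t / (y - x)"
    using xy t by (subst (asm) ennreal_le_iff) auto
  then show ?thesis using i by simp
qed

text \<open>If F is the continuous distribution function of V, then F(V) is uniform on [0, 1]; so the event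
  that V does not exceed an asymptotic u-quantile has asymptotic probability u.\<close>

lemma coverage_limit:
  fixes Fn :: "nat \<Rightarrow> 'a \<Rightarrow> real \<Rightarrow> real" and T \<rho> :: "nat \<Rightarrow> 'a \<Rightarrow> real"
  assumes P: "prob_space P" and V: "V \<in> borel_measurable P"
    and cont: "\<And>x. isCont (cdf (distr P borel V)) x" and u: "0 < u" "u < 1"
    and T: "AE z in P. (\<lambda>n. T n z) \<longlonglongrightarrow> V z"
    and Fn: "AE z in P. \<forall>x. (\<lambda>n. Fn n z x) \<longlonglongrightarrow> cdf (distr P borel V) x"
    and mono: "AE z in P. \<forall>n\<ge>1. mono (Fn n z)"
    and quant: "AE z in P. \<forall>n\<ge>1. Fn n z (\<rho> n z) = u"
    and A: "\<And>n. n \<ge> 1 \<Longrightarrow> A n \<in> sets P" "AE z in P. \<forall>n\<ge>1. z \<in> A n \<longleftrightarrow> T n z \<le> \<rho> n z"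
  shows "(\<lambda>n. measure P (A n)) \<longlonglongrightarrow> u"
proof -
  interpret prob_space P by fact
  let ?D = "distr P borel V"
  let ?F = "cdf ?D"
  interpret D: real_distribution ?D
    by (rule real_distribution_distr[OF V])
  have mF: "?F a \<le> ?F b" if "a \<le> b" for a b by (rule D.cdf_nondecreasing[OF that])
  have Fprob: "prob {z \<in> space P. V z \<le> q} = ?F q" for q
    using V by (simp add: cdf_def measure_distr vimage_def Int_def conj_commute)
  have quantile: "\<exists>q. ?F q = p" if p: "0 < p" "p < 1" for p
  proof -
    obtain a where a: "?F a < p"
      using order_tendstoD(2)[OF D.cdf_lim_at_bot p(1)] by (auto simp: eventually_at_bot_linorder)
    obtain b where b: "p < ?F b"
      using order_tendstoD(1)[OF D.cdf_lim_at_top_prob p(2)] by (auto simp: eventually_at_top_linorder)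
    have "a \<le> b" using a b mF[of b a] by linarith
    then obtain q where "?F q = p" using IVT[of ?F a p b] a b cont by fastforce
    then show ?thesis ..
  qed
  have FV[measurable]: "(\<lambda>z. ?F (V z)) \<in> borel_measurable P"
    by (rule measurable_compose[OF V borel_measurable_continuous_onI])
      (simp add: continuous_at_imp_continuous_on cont)
  have le: "prob {z \<in> space P. ?F (V z) \<le> u} \<le> u"
  proof (rule field_le_epsilon)
    fix e :: real assume e: "e > 0"
    \<comment> \<open>The cap (1 - u)/2 keeps u + m below 1, where a quantile is known to
      exist.\<close>
    define m where "m = min e ((1 - u) / 2)"
    have m: "0 < m" "m \<le> e" "u + m < 1" using e u by (auto simp: m_def min_def field_simps)
    obtain q where q: "?F q = u + m" using quantile[of "u + m"] u m by auto
    have "prob {z \<in> space P. ?F (V z) \<le> u} \<le> prob {z \<in> space P. V z \<le> q}"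
    proof (rule finite_measure_mono)
      have "V z \<le> q" if "?F (V z) \<le> u" for z
      proof (rule ccontr)
        assume "\<not> V z \<le> q"
        then have "?F q \<le> ?F (V z)" by (intro mF) simp
        moreover have "?F q > u" using q m by simp
        ultimately show False using that by linarith
      qed
      then show "{z \<in> space P. ?F (V z) \<le> u} \<subseteq> {z \<in> space P. V z \<le> q}" by auto
    qed (use V in measurable)
    also have "\<dots> \<le> u + e" using q m by (simp add: Fprob)
    finally show "prob {z \<in> space P. ?F (V z) \<le> u} \<le> u + e" .
  qed
  have ge: "u \<le> prob {z \<in> space P. ?F (V z) < u}"
  proof (rule field_le_epsilon)
    fix e :: real assume e: "e > 0"
    define m where "m = min e (u / 2)"
    have m: "0 < m" "m \<le> e" "0 < u - m" using e u by (auto simp: m_def min_def)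
    obtain q where q: "?F q = u - m" using quantile[of "u - m"] u m by auto
    have "u - e \<le> prob {z \<in> space P. V z \<le> q}" using q m by (simp add: Fprob)
    also have "\<dots> \<le> prob {z \<in> space P. ?F (V z) < u}"
    proof (rule finite_measure_mono)
      have "?F (V z) < u" if "V z \<le> q" for z
      proof -
        have "?F (V z) \<le> ?F q" using that by (rule mF)
        moreover have "?F q < u" using q m by simp
        ultimately show ?thesis by linarith
      qed
      then show "{z \<in> space P. V z \<le> q} \<subseteq> {z \<in> space P. ?F (V z) < u}" by auto
    qed measurable
    finally show "u \<le> prob {z \<in> space P. ?F (V z) < u} + e" by simp
  qed
  let ?B = "{z \<in> space P. ?F (V z) < u}"
  have "prob ?B \<le> prob {z \<in> space P. ?F (V z) \<le> u}"
    by (rule finite_measure_mono) (auto, measurable)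
  with le ge have B: "prob ?B = u" by linarith
  \<comment> \<open>The distribution function may be flat at height u, so the u-quantile need not be
    unique. Comparing F(V) with u avoids the choice, and the ambiguous event is null because both
    bounds above meet at u.\<close>
  have "prob {z \<in> space P. ?F (V z) = u} = prob ({z \<in> space P. ?F (V z) \<le> u} - ?B)"
    by (rule arg_cong[where f=prob]) auto
  also have "\<dots> = prob {z \<in> space P. ?F (V z) \<le> u} - prob ?B"
    by (rule finite_measure_Diff) (measurable, auto)
  finally have "prob {z \<in> space P. ?F (V z) = u} = 0"
    using le B measure_nonneg[of P "{z \<in> space P. ?F (V z) = u}"] by linarith
  then have ne: "AE z in P. ?F (V z) \<noteq> u"
    by (subst AE_iff_measurable[of "{z \<in> space P. ?F (V z) = u}"]) (auto simp: emeasure_eq_measure)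
  \<comment> \<open>The assumptions start at n = 1, whereas dominated convergence needs
    measurability at every index; hence the shift by \<open>Suc\<close>.\<close>
  have lim: "AE z in P. (\<lambda>n. indicat_real (A (Suc n)) z) \<longlonglongrightarrow> indicat_real ?B z"
    using T Fn mono quant A(2) ne AE_space
  proof eventually_elim
    case (elim z)
    have mon: "mono (Fn n z)" and quan: "Fn n z (\<rho> n z) = u" and cov: "z \<in> A n \<longleftrightarrow> T n z \<le> \<rho> n z"
      if "n \<ge> 1" for n using elim(3,4,5) that by blast+
    \<comment> \<open>Within distance d of \<open>V z\<close> the limit stays on its side of u. The
      value of \<open>Fn\<close> at distance d/2 then forces \<open>\<rho> n z\<close> beyond that
      point, while \<open>T n z\<close> stays before it.\<close>
    have near: "\<exists>d>0. \<forall>v. \<bar>v - V z\<bar> < d \<longrightarrow> \<bar>?F v - ?F (V z)\<bar> < \<bar>?F (V z) - u\<bar>"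
      using cont[of "V z"] elim(6) unfolding isCont_def LIM_def
      by (metis abs_0 cancel_comm_monoid_add_class.diff_cancel dist_real_def zero_less_abs_iff right_minus_eq)
    then obtain d where d: "d > 0" "\<And>v. \<bar>v - V z\<bar> < d \<Longrightarrow> \<bar>?F v - ?F (V z)\<bar> < \<bar>?F (V z) - u\<bar>" by blast
    show ?case
    proof (cases "?F (V z) < u")
      case True
      have "?F (V z + d / 2) < u" using d(2)[of "V z + d / 2"] d(1) True by auto
      then have e1: "\<forall>\<^sub>F n in sequentially. Fn n z (V z + d / 2) < u"
        using elim(2) by (intro order_tendstoD(2)) auto
      have e2: "\<forall>\<^sub>F n in sequentially. T n z < V z + d / 2"
        using elim(1) d(1) by (intro order_tendstoD(2)) auto
      have "\<forall>\<^sub>F n in sequentially. z \<in> A n"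
        using e1 e2 eventually_ge_at_top[of 1]
      proof eventually_elim
        case (elim n)
        have "V z + d / 2 < \<rho> n z"
        proof (rule ccontr)
          assume "\<not> V z + d / 2 < \<rho> n z"
          then have "Fn n z (\<rho> n z) \<le> Fn n z (V z + d / 2)"
            by (intro monoD[OF mon[OF elim(3)]]) simp
          then show False using quan[OF elim(3)] elim(1) by linarith
        qed
        then show ?case unfolding cov[OF elim(3)] using elim(2) by linarith
      qed
      then have "\<forall>\<^sub>F n in sequentially. z \<in> A (Suc n)"
        unfolding eventually_sequentially by (meson le_Suc_eq)
      then have "\<forall>\<^sub>F n in sequentially. indicat_real (A (Suc n)) z = indicat_real ?B z"
        by eventually_elim (use True elim(7) in simp)
      then show ?thesis by (rule tendsto_eventually)
    next
      case False
      then have gt: "?F (V z) > u" using elim(6) by simp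
      have "?F (V z - d / 2) > u" using d(2)[of "V z - d / 2"] d(1) gt by auto
      then have e1: "\<forall>\<^sub>F n in sequentially. Fn n z (V z - d / 2) > u"
        using elim(2) by (intro order_tendstoD(1)) auto
      have e2: "\<forall>\<^sub>F n in sequentially. T n z > V z - d / 2"
        using elim(1) d(1) by (intro order_tendstoD(1)) auto
      have "\<forall>\<^sub>F n in sequentially. z \<notin> A n"
        using e1 e2 eventually_ge_at_top[of 1]
      proof eventually_elim
        case (elim n)
        have "\<rho> n z < V z - d / 2"
        proof (rule ccontr)
          assume "\<not> \<rho> n z < V z - d / 2"
          then have "Fn n z (V z - d / 2) \<le> Fn n z (\<rho> n z)"
            by (intro monoD[OF mon[OF elim(3)]]) simp
          then show False using quan[OF elim(3)] elim(1) by linarith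
        qed
        then show ?case unfolding cov[OF elim(3)] using elim(2) by linarith
      qed
      then have "\<forall>\<^sub>F n in sequentially. z \<notin> A (Suc n)"
        unfolding eventually_sequentially by (meson le_Suc_eq)
      then have "\<forall>\<^sub>F n in sequentially. indicat_real (A (Suc n)) z = indicat_real ?B z"
        by eventually_elim (use False in simp)
      then show ?thesis by (rule tendsto_eventually)
    qed
  qed
  have "(\<lambda>n. LINT z|P. indicat_real (A (Suc n)) z) \<longlonglongrightarrow> (LINT z|P. indicat_real ?B z)"
  proof (rule integral_dominated_convergence[OF _ _ _ lim])
    show "integrable P (\<lambda>z. 1 :: real)" by simp
    show "indicat_real (A (Suc n)) \<in> borel_measurable P" for n using A(1)[of "Suc n"] by simp
    show "indicat_real ?B \<in> borel_measurable P" by measurable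
  qed (auto simp: indicator_def)
  moreover have "A (Suc n) \<inter> space P = A (Suc n)" for n
    using sets.sets_into_space[OF A(1)[of "Suc n"]] by auto
  moreover have "?B \<inter> space P = ?B" by auto
  ultimately have "(\<lambda>n. prob (A (Suc n))) \<longlonglongrightarrow> prob ?B" by simp
  then show ?thesis unfolding B by (rule LIMSEQ_imp_Suc)
qed

section \<open>Asymptotics along a fixed noise sequence\<close>

lemma sqrt_mult_at_bot: "c < 0 \<Longrightarrow> filterlim (\<lambda>n. sqrt (real n) * c - (a::real)) at_bot sequentially"
  by real_asymp

lemma sqrt_mult_at_top: "c > 0 \<Longrightarrow> filterlim (\<lambda>n. sqrt (real n) * c - (a::real)) at_top sequentially"
  by real_asymp

text \<open>One noise sequence from a set of full measure. Strictness in \<open>interior\<close>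
  drives the truncation endpoints to infinity; the two summability conditions give the product form
  of the posterior and a finite limiting statistic.\<close>

locale wavelet_path = wavelet_prior +
  fixes f0 :: l2 and z :: "nat \<times> nat \<Rightarrow> real"
  assumes interior: "i \<in> I \<Longrightarrow> \<bar>coef \<psi> f0 i\<bar> < decay i * M"
    and obs_noise: "(\<lambda>i. obs_weight i * (z i)\<^sup>2) summable_on I"
    and weight_noise: "(\<lambda>i. weight i * (z i)\<^sup>2) summable_on I"
begin

definition obs :: "nat \<Rightarrow> nat \<times> nat \<Rightarrow> real"
  where "obs n = (\<lambda>i\<in>I. coef \<psi> f0 i + z i / sqrt (real n))"

lemma posterior_locale:
  assumes "n \<ge> 1" shows "wavelet_posterior J0 \<psi> \<gamma> M \<delta> n (obs n)"
proof (unfold_locales, fact assms)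
  show "(\<lambda>i. obs_weight i * (obs n i)\<^sup>2) summable_on I"
  proof (rule summable_on_comparison_test)
    show "(\<lambda>i. 2 * (coef \<psi> f0 i)\<^sup>2 + 2 * (obs_weight i * (z i)\<^sup>2)) summable_on I"
      by (intro summable_on_add summable_on_cmult_right coef_sq_summable obs_noise)
    fix i assume i: "i \<in> I"
    have one: "obs_weight i \<le> 1"
      unfolding obs_weight_def using gamma powr_mono[of "- (real (fst i) * (1 + \<gamma>))" 0 2] by simp
    have "(obs n i)\<^sup>2 \<le> 2 * (coef \<psi> f0 i)\<^sup>2 + 2 * (z i / sqrt (real n))\<^sup>2"
      using sum_squares_bound[of "coef \<psi> f0 i" "z i / sqrt (real n)"] i by (simp add: obs_def power2_sum)
    also have "(z i / sqrt (real n))\<^sup>2 \<le> (z i)\<^sup>2"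
      using assms by (simp add: power_divide divide_le_eq mult_le_cancel_left1)
    finally have "obs_weight i * (obs n i)\<^sup>2 \<le> obs_weight i * (2 * (coef \<psi> f0 i)\<^sup>2 + 2 * (z i)\<^sup>2)"
      using obs_weight_pos[of i] by (intro mult_left_mono) auto
    also have "\<dots> \<le> 2 * (coef \<psi> f0 i)\<^sup>2 + 2 * (obs_weight i * (z i)\<^sup>2)"
      using mult_right_mono[OF one, of "2 * (coef \<psi> f0 i)\<^sup>2"] by (simp add: algebra_simps)
    finally show "obs_weight i * (obs n i)\<^sup>2 \<le> 2 * (coef \<psi> f0 i)\<^sup>2 + 2 * (obs_weight i * (z i)\<^sup>2)" .
  qed (simp add: obs_weight_pos less_imp_le)
qed

text \<open>The posterior locale fixes n; these versions expose the endpoints as sequences in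
  n.\<close>

definition lo :: "nat \<Rightarrow> nat \<times> nat \<Rightarrow> real"
  where "lo n = wavelet_posterior.lo \<gamma> M n (obs n)"

definition hi :: "nat \<Rightarrow> nat \<times> nat \<Rightarrow> real"
  where "hi n = wavelet_posterior.hi \<gamma> M n (obs n)"

definition tmean :: "nat \<Rightarrow> nat \<times> nat \<Rightarrow> real"
  where "tmean n i = trunc_mean (lo n i) (hi n i)"

abbreviation "post n \<equiv> posterior J0 \<psi> prior n (obs n)"

abbreviation "mean n \<equiv> posterior_mean J0 \<psi> prior n (obs n)"

text \<open>The noise contributes \<open>z i / sqrt n\<close> to the observation, so after rescaling
  it is the constant shift \<open>- z i\<close>, while the remaining part of each endpoint grows
  like \<open>sqrt n\<close>.\<close>

lemma lo_hi_eq: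
  assumes "n \<ge> 1" "i \<in> I"
  shows "lo n i = sqrt (real n) * (- (decay i * M) - coef \<psi> f0 i) - z i"
    and "hi n i = sqrt (real n) * (decay i * M - coef \<psi> f0 i) - z i"
proof -
  interpret P: wavelet_posterior J0 \<psi> \<gamma> M \<delta> n "obs n" by (rule posterior_locale) fact
  show "lo n i = sqrt (real n) * (- (decay i * M) - coef \<psi> f0 i) - z i"
    unfolding lo_def P.lo_def using assms by (simp add: obs_def algebra_simps)
  show "hi n i = sqrt (real n) * (decay i * M - coef \<psi> f0 i) - z i"
    unfolding hi_def P.hi_def using assms by (simp add: obs_def algebra_simps)
qed

lemma lo_lim: "i \<in> I \<Longrightarrow> filterlim (\<lambda>n. lo n i) at_bot sequentially"
  and hi_lim: "i \<in> I \<Longrightarrow> filterlim (\<lambda>n. hi n i) at_top sequentially"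
proof -
  assume i: "i \<in> I"
  have neg: "- (decay i * M) - coef \<psi> f0 i < 0" and pos: "decay i * M - coef \<psi> f0 i > 0"
    using interior[OF i] by auto
  have l: "filterlim (\<lambda>n. sqrt (real n) * (- (decay i * M) - coef \<psi> f0 i) - z i) at_bot sequentially"
    by (rule sqrt_mult_at_bot[OF neg])
  have h: "filterlim (\<lambda>n. sqrt (real n) * (decay i * M - coef \<psi> f0 i) - z i) at_top sequentially"
    by (rule sqrt_mult_at_top[OF pos])
  show "filterlim (\<lambda>n. lo n i) at_bot sequentially"
    by (rule filterlim_cong[OF refl refl, THEN iffD1, OF eventually_sequentiallyI[of 1] l])
      (rule lo_hi_eq(1)[symmetric, OF _ i])
  show "filterlim (\<lambda>n. hi n i) at_top sequentially"
    by (rule filterlim_cong[OF refl refl, THEN iffD1, OF eventually_sequentiallyI[of 1] h])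
      (rule lo_hi_eq(2)[symmetric, OF _ i])
qed

lemma tmean_lim: "i \<in> I \<Longrightarrow> (\<lambda>n. tmean n i) \<longlonglongrightarrow> 0"
  unfolding tmean_def by (intro trunc_mean_tendsto_0 lo_lim hi_lim)

text \<open>In the rescaled coordinate the true coefficient sits at \<open>- z i\<close>, which
  therefore lies in the truncation interval for every n and can serve as the point s.\<close>

lemma tmean_sq_le:
  assumes "n \<ge> 1" "i \<in> I" shows "(tmean n i)\<^sup>2 \<le> 2 + (z i)\<^sup>2"
proof -
  interpret P: wavelet_posterior J0 \<psi> \<gamma> M \<delta> n "obs n" by (rule posterior_locale) fact
  have "\<bar>coef \<psi> f0 i\<bar> \<le> decay i * M" using interior[OF assms(2)] by simp
  then have "lo n i \<le> - z i" "- z i \<le> hi n i"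
    unfolding lo_hi_eq[OF assms] by (auto intro!: mult_nonneg_nonneg mult_nonneg_nonpos simp: abs_le_iff)
  moreover have "lo n i < hi n i" using P.lo_less_hi[of i] by (simp add: lo_def hi_def)
  ultimately show ?thesis
    using trunc_mean_sq_le[of "lo n i" "hi n i" "- z i"] by (simp add: tmean_def)
qed

lemma std_truth:
  assumes "n \<ge> 1" "i \<in> I"
  shows "sqrt (real n) * coef \<psi> (f0 - mean n) i = - (z i + tmean n i)"
proof -
  interpret P: wavelet_posterior J0 \<psi> \<gamma> M \<delta> n "obs n" by (rule posterior_locale) fact
  have "sqrt (real n) * (coef \<psi> (mean n) i - obs n i) = tmean n i"
    using P.std_mean[OF assms(2)] by (simp add: tmean_def lo_def hi_def)
  moreover have "sqrt (real n) * (obs n i - coef \<psi> f0 i) = z i"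
    using assms by (simp add: obs_def)
  ultimately show ?thesis by (simp add: coef_diff algebra_simps)
qed

text \<open>Each rescaled coordinate tends to \<open>- z i\<close>, but not uniformly in i.
  Dominated convergence applies because 2 z^2 + 2 (2 + z^2) = 4 + 4 z^2 bounds the squares, and this
  is summable against \<open>weight\<close> along the path.\<close>

lemma dispersion_truth_lim:
  "(\<lambda>n. dispersion n (f0 - mean n)) \<longlonglongrightarrow> (\<Sum>\<^sub>\<infinity>i\<in>I. weight i * (z i)\<^sup>2)"
proof -
  have lim: "(\<lambda>n. \<Sum>\<^sub>\<infinity>i\<in>I. weight i * (z i + tmean (Suc n) i)\<^sup>2) \<longlonglongrightarrow> (\<Sum>\<^sub>\<infinity>i\<in>I. weight i * (z i)\<^sup>2)"
  proof (rule infsum_dominated_convergence)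
    show "(\<lambda>i. 4 * weight i + 4 * (weight i * (z i)\<^sup>2)) summable_on I"
      by (intro summable_on_add summable_on_cmult_right weight_summable weight_noise)
    fix i assume i: "i \<in> I"
    show "\<bar>weight i * (z i + tmean (Suc n) i)\<^sup>2\<bar> \<le> 4 * weight i + 4 * (weight i * (z i)\<^sup>2)" for n
    proof -
      have "(z i + tmean (Suc n) i)\<^sup>2 \<le> 2 * (z i)\<^sup>2 + 2 * (tmean (Suc n) i)\<^sup>2"
        using sum_squares_bound[of "z i" "tmean (Suc n) i"] by (simp add: power2_sum)
      also have "\<dots> \<le> 4 + 4 * (z i)\<^sup>2" using tmean_sq_le[of "Suc n", OF _ i] by simp
      finally have "weight i * (z i + tmean (Suc n) i)\<^sup>2 \<le> weight i * (4 + 4 * (z i)\<^sup>2)"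
        by (intro mult_left_mono weight_nonneg)
      then show ?thesis using weight_nonneg[of i] by (simp add: abs_mult algebra_simps)
    qed
    have "(\<lambda>n. weight i * (z i + tmean (Suc n) i)\<^sup>2) \<longlonglongrightarrow> weight i * (z i + 0)\<^sup>2"
      by (intro tendsto_intros LIMSEQ_Suc tmean_lim i)
    then show "(\<lambda>n. weight i * (z i + tmean (Suc n) i)\<^sup>2) \<longlonglongrightarrow> weight i * (z i)\<^sup>2" by simp
  qed
  have eq: "dispersion (Suc n) (f0 - mean (Suc n)) = (\<Sum>\<^sub>\<infinity>i\<in>I. weight i * (z i + tmean (Suc n) i)\<^sup>2)" for n
  proof -
    have "sqrt (real (Suc n)) * coef \<psi> (f0 - mean (Suc n)) i = - (z i + tmean (Suc n) i)" if "i \<in> I" for i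
      by (rule std_truth) (use that in auto)
    then show ?thesis
      unfolding dispersion_def by (intro infsum_cong) (simp only: power2_minus)
  qed
  show ?thesis by (rule LIMSEQ_imp_Suc) (simp only: eq lim)
qed

definition block :: "(nat \<times> nat) set \<Rightarrow> nat \<Rightarrow> l2 \<Rightarrow> real"
  where "block F n f = (\<Sum>i\<in>F. weight i * (sqrt (real n) * coef \<psi> (f - mean n) i)\<^sup>2)"

text \<open>The block has the law of a Gaussian block conditioned on the event \<open>B n\<close>
  and shifted by \<open>tmean\<close>. The probability of \<open>B n\<close> tends to 1, every point
  of the space eventually lies in it, and the shift tends to 0.\<close>

lemma block_lim:
  assumes F: "finite F" "F \<subseteq> I" and xy: "x < y"
  shows "(\<lambda>n. LINT f|post n. cts_step x y (block F n f)) \<longlonglongrightarrow>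
    (LINT v|gauss. cts_step x y (\<Sum>i\<in>F. weight i * (v i)\<^sup>2))"
proof -
  let ?lim = "LINT v|gauss. cts_step x y (\<Sum>i\<in>F. weight i * (v i)\<^sup>2)"
  let ?int = "\<lambda>n. LINT f|post n. cts_step x y (block F n f)"
  interpret G: prob_space gauss by (rule prob_space_gauss)
  define B where "B n = {v \<in> space gauss. \<forall>i\<in>F. v i \<in> {lo n i..hi n i}}" for n
  define h where "h n v = cts_step x y (\<Sum>i\<in>F. weight i * (v i - tmean n i)\<^sup>2)" for n and v :: "nat \<times> nat \<Rightarrow> real"
  note [measurable] = borel_measurable_cts_step[OF xy]
  have B[measurable]: "B n \<in> sets gauss" for n
    unfolding B_def using F
    by (intro sets.sets_Collect_finite_All measurable_sets_Collect[of _ gauss std_normal]) auto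
  have hm[measurable]: "h n \<in> borel_measurable gauss" for n
    unfolding h_def[abs_def]
    by (intro measurable_compose[OF borel_measurable_sum borel_measurable_cts_step[OF xy]])
      (use F in \<open>auto intro!: borel_measurable_times borel_measurable_power borel_measurable_diff
        measurable_compose[OF measurable_component_singleton, of _ I "\<lambda>_. std_normal"]\<close>)
  have hF: "h n \<in> borel_measurable (PiM F (\<lambda>_. borel))" for n
    unfolding h_def[abs_def]
    by (intro measurable_compose[OF borel_measurable_sum borel_measurable_cts_step[OF xy]]) measurable
  have eq: "?int n = (LINT v|gauss. h n v * indicator (B n) v) / measure gauss (B n)"
    and mB: "measure gauss (B n) = (\<Prod>i\<in>F. measure std_normal {lo n i..hi n i})"
    if n: "n \<ge> 1" for n
  proof -
    interpret P: wavelet_posterior J0 \<psi> \<gamma> M \<delta> n "obs n" by (rule posterior_locale) fact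
    have Bb: "B n = P.box F" by (simp add: B_def P.box_def lo_def hi_def)
    show mB: "measure gauss (B n) = (\<Prod>i\<in>F. measure std_normal {lo n i..hi n i})"
      unfolding Bb by (simp only: P.measure_box[OF F] lo_def hi_def)
    have pos: "measure gauss (B n) > 0"
      unfolding Bb P.measure_box[OF F] by (intro prod_pos measure_std_normal_Icc_pos P.lo_less_hi)
    have restr: "(\<lambda>v. \<lambda>i\<in>F. v i) \<in> measurable (uniform_measure gauss (B n)) (PiM F (\<lambda>_. borel))"
      by (intro measurable_restrict) (use F in \<open>auto intro!: measurable_component_singleton\<close>)
    have "?int n =
        (LINT f|post n. h n (\<lambda>i\<in>F. sqrt (real n) * (coef \<psi> f i - obs n i)))"
    proof (intro Bochner_Integration.integral_cong refl)
      fix f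
      have "weight i * (sqrt (real n) * coef \<psi> (f - mean n) i)\<^sup>2 =
          weight i * ((\<lambda>i\<in>F. sqrt (real n) * (coef \<psi> f i - obs n i)) i - tmean n i)\<^sup>2" if "i \<in> F" for i
      proof -
        have "i \<in> I" using that F by auto
        from P.std_centered[OF this, of f] that show ?thesis by (simp add: tmean_def lo_def hi_def)
      qed
      then show "cts_step x y (block F n f) = h n (\<lambda>i\<in>F. sqrt (real n) * (coef \<psi> f i - obs n i))"
        unfolding block_def h_def by (intro arg_cong[where f="cts_step x y"] sum.cong) auto
    qed
    also have "\<dots> = (LINT v|distr (post n) (PiM F (\<lambda>_. borel)) (\<lambda>f. \<lambda>i\<in>F. sqrt (real n) * (coef \<psi> f i - obs n i)). h n v)"
      by (rule integral_distr[symmetric, OF _ hF]) (intro measurable_restrict P.std_measurable)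
    also have "\<dots> = (LINT v|distr (uniform_measure gauss (B n)) (PiM F (\<lambda>_. borel)) (\<lambda>v. \<lambda>i\<in>F. v i). h n v)"
      unfolding P.distr_post_block[OF F] Bb ..
    also have "\<dots> = (LINT v|uniform_measure gauss (B n). h n (\<lambda>i\<in>F. v i))"
      by (rule integral_distr[OF restr hF])
    also have "\<dots> = (LINT v|uniform_measure gauss (B n). h n v)"
      by (intro Bochner_Integration.integral_cong refl) (auto simp: h_def cong: sum.cong)
    also have "\<dots> = (LINT v|gauss. h n v * indicator (B n) v) / measure gauss (B n)"
      by (rule integral_uniform_measure[OF B pos hm])
    finally show "?int n =
        (LINT v|gauss. h n v * indicator (B n) v) / measure gauss (B n)" .
  qed
  have limB: "(\<lambda>n. measure gauss (B n)) \<longlonglongrightarrow> 1"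
  proof -
    have "(\<lambda>n. \<Prod>i\<in>F. measure std_normal {lo n i..hi n i}) \<longlonglongrightarrow> (\<Prod>i\<in>F. 1 :: real)"
      using F by (intro tendsto_prod std_normal_Icc_tendsto lo_lim hi_lim) auto
    moreover have "\<forall>\<^sub>F n in sequentially. (\<Prod>i\<in>F. measure std_normal {lo n i..hi n i}) = measure gauss (B n)"
      by (intro eventually_sequentiallyI[of 1]) (rule mB[symmetric])
    ultimately have "(\<lambda>n. measure gauss (B n)) \<longlonglongrightarrow> (\<Prod>i\<in>F. 1 :: real)"
      by (rule Lim_transform_eventually)
    then show ?thesis by simp
  qed
  have limI: "(\<lambda>n. LINT v|gauss. h n v * indicator (B n) v) \<longlonglongrightarrow>
      ?lim"
  proof (rule integral_dominated_convergence[where w="\<lambda>_. 1"])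
    show "(\<lambda>v. cts_step x y (\<Sum>i\<in>F. weight i * (v i)\<^sup>2)) \<in> borel_measurable gauss"
      by (intro measurable_compose[OF borel_measurable_sum borel_measurable_cts_step[OF xy]])
        (use F in \<open>auto intro!: borel_measurable_times borel_measurable_power
          measurable_compose[OF measurable_component_singleton, of _ I "\<lambda>_. std_normal"]\<close>)
    show "AE v in gauss. norm (h n v * indicator (B n) v) \<le> 1" for n
      by (rule AE_I2) (simp add: indicator_def h_def cts_step_bounds)
    show "AE v in gauss. (\<lambda>n. h n v * indicator (B n) v) \<longlonglongrightarrow> cts_step x y (\<Sum>i\<in>F. weight i * (v i)\<^sup>2)"
    proof (rule AE_I2)
      fix v assume v: "v \<in> space gauss"
      have "(\<lambda>n. \<Sum>i\<in>F. weight i * (v i - tmean n i)\<^sup>2) \<longlonglongrightarrow> (\<Sum>i\<in>F. weight i * (v i - 0)\<^sup>2)"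
        using F by (intro tendsto_intros tmean_lim) auto
      then have "(\<lambda>n. h n v) \<longlonglongrightarrow> cts_step x y (\<Sum>i\<in>F. weight i * (v i - 0)\<^sup>2)"
        unfolding h_def by (rule isCont_tendsto_compose[OF isCont_cts_step[OF xy]])
      moreover have "\<forall>\<^sub>F n in sequentially. h n v = h n v * indicator (B n) v"
      proof -
        have "\<forall>\<^sub>F n in sequentially. \<forall>i\<in>F. lo n i \<le> v i \<and> v i \<le> hi n i"
          using F by (intro eventually_ball_finite ballI eventually_conj)
            (auto intro!: filterlim_at_top[THEN iffD1, rule_format] filterlim_at_bot[THEN iffD1, rule_format]
              lo_lim hi_lim)
        then show ?thesis by eventually_elim (use v in \<open>simp add: B_def\<close>)
      qed
      ultimately have "(\<lambda>n. h n v * indicator (B n) v) \<longlonglongrightarrow> cts_step x y (\<Sum>i\<in>F. weight i * (v i - 0)\<^sup>2)"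
        by (rule Lim_transform_eventually)
      then show "(\<lambda>n. h n v * indicator (B n) v) \<longlonglongrightarrow> cts_step x y (\<Sum>i\<in>F. weight i * (v i)\<^sup>2)"
        by simp
    qed
  qed (simp_all, measurable)
  have "(\<lambda>n. (LINT v|gauss. h n v * indicator (B n) v) / measure gauss (B n)) \<longlonglongrightarrow>
      ?lim / 1"
    by (intro tendsto_divide limI limB) simp
  moreover have "\<forall>\<^sub>F n in sequentially. (LINT v|gauss. h n v * indicator (B n) v) / measure gauss (B n) =
      ?int n"
    by (intro eventually_sequentiallyI[of 1]) (rule eq[symmetric])
  ultimately have "(\<lambda>n. LINT f|post n. cts_step x y (block F n f)) \<longlonglongrightarrow>
      ?lim / 1"
    by (rule Lim_transform_eventually)
  then show ?thesis by simp
qed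

end

section \<open>The limiting statistic and its continuous distribution\<close>

context wavelet_prior
begin

text \<open>The squared weak norm of white noise. It plays two parts: its value at z is the limit
  for the truth, and its law is the limit of the posterior laws.\<close>

definition limit_stat :: "(nat \<times> nat \<Rightarrow> real) \<Rightarrow> real"
  where "limit_stat v = (\<Sum>\<^sub>\<infinity>i\<in>I. weight i * (v i)\<^sup>2)"

lemma limit_stat_measurable: "limit_stat \<in> borel_measurable gauss"
  unfolding limit_stat_def[abs_def]
  by (rule borel_measurable_infsum_nonneg[OF countable_cdv_index]) (measurable, simp add: weight_nonneg)

lemma AE_weight_noise: "AE v in gauss. (\<lambda>i. weight i * (v i)\<^sup>2) summable_on I"
  by (rule AE_std_normal_summable[OF countable_cdv_index weight_summable weight_nonneg])

lemma AE_obs_noise: "AE v in gauss. (\<lambda>i. obs_weight i * (v i)\<^sup>2) summable_on I"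
  by (rule AE_std_normal_summable[OF countable_cdv_index obs_weight_summable])
    (simp add: obs_weight_pos less_imp_le)

text \<open>One coordinate of positive weight is enough to exclude atoms; the index
  \<open>(J0 - 1, 0)\<close> serves.\<close>

lemma isCont_cdf_limit_stat: "isCont (cdf (distr gauss borel limit_stat)) x"
proof -
  interpret G: prob_space gauss by (rule prob_space_gauss)
  interpret D: real_distribution "distr gauss borel limit_stat"
    by (rule G.real_distribution_distr[OF limit_stat_measurable])
  have "AE v in gauss. limit_stat v \<noteq> x"
    unfolding limit_stat_def
    by (rule AE_std_normal_weighted_sum_neq[OF countable_cdv_index weight_summable weight_nonneg
      cdv_index_ne weight_pos[OF cdv_index_ne] limit_stat_measurable[unfolded limit_stat_def[abs_def]]])
  then have "AE t in distr gauss borel limit_stat. t \<notin> {x}"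
    by (subst AE_distr_iff[OF limit_stat_measurable]) auto
  then have "measure (distr gauss borel limit_stat) {x} = 0"
    by (subst (asm) AE_iff_measurable[of "{x}"]) (auto simp: measure_def)
  then show ?thesis by (simp add: D.isCont_cdf)
qed

end

context wavelet_path
begin

text \<open>Both statistics are cut to a finite set F with an error governed by the weights outside
  F alone, and the finite blocks converge by \<open>block_lim\<close>. The limit law is the same for
  every path z.\<close>

lemma dispersion_weak_lim:
  "(\<lambda>n. cdf (distr (post n) borel (\<lambda>f. dispersion n (f - mean n))) x) \<longlonglongrightarrow> cdf (distr gauss borel limit_stat) x"
proof -
  let ?d = "\<lambda>n f. dispersion n (f - mean n)"
  let ?VF = "\<lambda>F v. \<Sum>i\<in>F. weight i * (v i)\<^sup>2"
  let ?P = "\<lambda>n. post (Suc n)"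
  interpret G: prob_space gauss by (rule prob_space_gauss)
  define D where "D n = distr (?P n) borel (\<lambda>f. ?d (Suc n) f)" for n
  have pl: "wavelet_posterior J0 \<psi> \<gamma> M \<delta> (Suc n) (obs (Suc n))" for n by (rule posterior_locale) simp
  have pp: "prob_space (?P n)" for n by (rule wavelet_posterior.prob_space_post[OF pl])
  have ps: "sets (post n) = sets borel" for n by (simp add: posterior_def prior_def)
  have dm: "(\<lambda>f. dispersion n (f - mean n)) \<in> borel_measurable (post n)" for n
    unfolding measurable_cong_sets[OF ps refl]
    by (rule measurable_compose[OF _ dispersion_measurable]) measurable
  have bm: "block F n \<in> borel_measurable (post n)" for F n
  proof -
    note [measurable] = measurable_coef
    show ?thesis unfolding measurable_cong_sets[OF ps refl] block_def[abs_def] by measurable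
  qed
  have rd: "real_distribution (D n)" for n
    unfolding D_def by (rule prob_space.real_distribution_distr[OF pp dm])
  have rl: "real_distribution (distr gauss borel limit_stat)"
    by (rule G.real_distribution_distr[OF limit_stat_measurable])
  have "weak_conv_m D (distr gauss borel limit_stat)"
  proof (rule integral_cts_step_conv_imp_weak_conv[OF rd rl])
    fix x y :: real assume xy: "x < y"
    note [measurable] = borel_measurable_cts_step[OF xy]
    let ?a = "\<lambda>n. LINT f|?P n. cts_step x y (?d (Suc n) f)"
    let ?b = "LINT v|gauss. cts_step x y (limit_stat v)"
    have "?a \<longlonglongrightarrow> ?b"
    proof (rule LIMSEQ_I)
      fix e :: real assume e: "e > 0"
      \<comment> \<open>Division by y - x, from the Lipschitz constant of the test function, turns
        this tail into e/3. The same F serves all n and the limit.\<close>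
      then have "e * (y - x) / 3 > 0" using xy by simp
      then obtain F where F: "finite F" "F \<subseteq> I"
        "\<And>G. finite G \<Longrightarrow> F \<subseteq> G \<Longrightarrow> G \<subseteq> I \<Longrightarrow> \<bar>sum weight G - infsum weight I\<bar> < e * (y - x) / 3"
        using eventually_finite_subsets_at_top_summable_close[OF weight_summable] by metis
      let ?t = "infsum weight (I - F)"
      have t0: "?t \<ge> 0" by (intro infsum_nonneg weight_nonneg)
      have "?t < e * (y - x) / 3"
        using F(3)[OF F(1) order.refl F(2)] infsum_split_finite[OF weight_summable F(1,2)] by linarith
      then have t: "?t / (y - x) < e / 3" using xy by (simp add: field_simps)
      have one: "\<bar>?a n - (LINT f|?P n. cts_step x y (block F (Suc n) f))\<bar> \<le> ?t / (y - x)" for n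
      proof (rule integral_cts_step_diff_le[OF pp xy dm bm])
        let ?E = "\<lambda>f. \<Sum>\<^sub>\<infinity>i\<in>I - F. weight i * (sqrt (real (Suc n)) * coef \<psi> (f - mean (Suc n)) i)\<^sup>2"
        show "AE f in ?P n. \<bar>?d (Suc n) f - block F (Suc n) f\<bar> \<le> ?E f"
        proof (rule AE_I2)
          fix f
          have "?d (Suc n) f = block F (Suc n) f + ?E f"
            unfolding dispersion_def block_def by (rule infsum_split_finite[OF dispersion_summable F(1,2)])
          moreover have "?E f \<ge> 0" by (intro infsum_nonneg mult_nonneg_nonneg weight_nonneg) auto
          ultimately show "\<bar>?d (Suc n) f - block F (Suc n) f\<bar> \<le> ?E f" by simp
        qed
        show "(\<integral>\<^sup>+f. ennreal (?E f) \<partial>?P n) \<le> ennreal ?t"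
          by (rule wavelet_posterior.nn_integral_tail_le[OF pl]) auto
        have "?E \<in> borel_measurable (?P n)"
        proof -
          note [measurable] = measurable_coef
          show ?thesis unfolding measurable_cong_sets[OF ps refl]
            by (rule borel_measurable_infsum_nonneg) (auto simp: weight_nonneg countable_cdv_index)
        qed
        then show "(\<lambda>f. ennreal (?E f)) \<in> borel_measurable (?P n)" by simp
      qed (rule t0)
      have two: "\<bar>?b - (LINT v|gauss. cts_step x y (?VF F v))\<bar> \<le> ?t / (y - x)"
      proof (rule integral_cts_step_diff_le[OF prob_space_gauss xy limit_stat_measurable])
        let ?E = "\<lambda>v. \<Sum>\<^sub>\<infinity>i\<in>I - F. weight i * (v i)\<^sup>2"
        have cI: "countable (I - F)" using countable_cdv_index by simp
        have wF: "weight summable_on (I - F)" using weight_summable by (rule summable_on_subset_banach) auto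
        show "(\<lambda>v. \<Sum>i\<in>F. weight i * (v i)\<^sup>2) \<in> borel_measurable gauss"
          using F by (auto intro!: borel_measurable_sum borel_measurable_times borel_measurable_power
            measurable_compose[OF measurable_component_singleton, of _ I "\<lambda>_. std_normal"])
        show "AE v in gauss. \<bar>limit_stat v - ?VF F v\<bar> \<le> ?E v"
          using AE_weight_noise
        proof eventually_elim
          case (elim v)
          have "limit_stat v = ?VF F v + ?E v"
            unfolding limit_stat_def by (rule infsum_split_finite[OF elim F(1,2)])
          moreover have "?E v \<ge> 0" by (intro infsum_nonneg mult_nonneg_nonneg weight_nonneg) auto
          ultimately show ?case by simp
        qed
        have "(\<integral>\<^sup>+v. ennreal (?E v) \<partial>gauss) = (\<integral>\<^sup>+v. (\<integral>\<^sup>+i. ennreal (weight i * (v i)\<^sup>2) \<partial>count_space (I - F)) \<partial>gauss)"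
        proof (rule nn_integral_cong_AE)
          show "AE v in gauss. ennreal (?E v) = (\<integral>\<^sup>+i. ennreal (weight i * (v i)\<^sup>2) \<partial>count_space (I - F))"
            using AE_weight_noise
          proof eventually_elim
            case (elim v)
            then have "(\<lambda>i. weight i * (v i)\<^sup>2) summable_on (I - F)"
              by (rule summable_on_subset_banach) auto
            then show ?case
              by (intro nn_integral_count_space_eq_infsum[symmetric]) (simp_all add: weight_nonneg)
          qed
        qed
        also have "\<dots> = ennreal ?t"
          using nn_integral_std_normal_weighted_sum[OF cI Diff_subset, of weight]
            nn_integral_count_space_eq_infsum[OF wF] by (simp add: weight_nonneg)
        finally show "(\<integral>\<^sup>+v. ennreal (?E v) \<partial>gauss) \<le> ennreal ?t" by simp
        have "?E \<in> borel_measurable gauss"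
          by (rule borel_measurable_infsum_nonneg[OF cI]) (auto simp: weight_nonneg
            intro!: borel_measurable_times borel_measurable_power
            measurable_compose[OF measurable_component_singleton, of _ I "\<lambda>_. std_normal"])
        then show "(\<lambda>v. ennreal (?E v)) \<in> borel_measurable gauss" by simp
      qed (rule t0)
      have conv: "(\<lambda>n. LINT f|?P n. cts_step x y (block F (Suc n) f)) \<longlonglongrightarrow>
          (LINT v|gauss. cts_step x y (?VF F v))"
        by (rule LIMSEQ_Suc[OF block_lim[OF F(1,2) xy]])
      have "e / 3 > 0" using e by simp
      from LIMSEQ_D[OF conv this] obtain N where N: "\<forall>n\<ge>N. norm
          ((LINT f|?P n. cts_step x y (block F (Suc n) f)) -
            (LINT v|gauss. cts_step x y (?VF F v))) < e / 3" ..
      show "\<exists>N. \<forall>n\<ge>N. norm (?a n - ?b) < e"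
      proof (intro exI allI impI)
        fix n assume "n \<ge> N"
        from N[rule_format, OF this] one[of n] two t show "norm (?a n - ?b) < e"
          unfolding real_norm_def by linarith
      qed
    qed
    moreover have "integral\<^sup>L (D n) (cts_step x y) = ?a n" for n
      unfolding D_def by (rule integral_distr[OF dm]) measurable
    moreover have "integral\<^sup>L (distr gauss borel limit_stat) (cts_step x y) = ?b"
      by (rule integral_distr[OF limit_stat_measurable]) measurable
    ultimately show "(\<lambda>n. integral\<^sup>L (D n) (cts_step x y)) \<longlonglongrightarrow>
        integral\<^sup>L (distr gauss borel limit_stat) (cts_step x y)" by simp
  qed
  \<comment> \<open>As the limit has no atoms, weak convergence yields convergence of the
    distribution functions at every x.\<close>
  then have "(\<lambda>n. cdf (D n) x) \<longlonglongrightarrow> cdf (distr gauss borel limit_stat) x"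
    using isCont_cdf_limit_stat unfolding weak_conv_m_def weak_conv_def by blast
  then show ?thesis unfolding D_def by (rule LIMSEQ_imp_Suc)
qed

end

section \<open>Measurability, credible radius and diameter\<close>

context wavelet_prior
begin

abbreviation "obs_space \<equiv> PiM I (\<lambda>_. borel :: real measure)"

definition obs_map :: "l2 \<Rightarrow> nat \<Rightarrow> (nat \<times> nat \<Rightarrow> real) \<Rightarrow> nat \<times> nat \<Rightarrow> real"
  where "obs_map f0 n z = (\<lambda>i\<in>I. coef \<psi> f0 i + z i / sqrt (real n))"

lemma obs_law_eq: "obs_law J0 \<psi> n f0 = distr gauss obs_space (obs_map f0 n)"
  by (simp add: obs_law_def white_noise_def obs_map_def[abs_def])

lemma obs_map_measurable: "obs_map f0 n \<in> measurable gauss obs_space"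
  unfolding obs_map_def[abs_def] by (intro measurable_restrict) measurable

lemma likelihood_joint_measurable:
  "(\<lambda>(X, f). likelihood J0 \<psi> n X f) \<in> borel_measurable (obs_space \<Otimes>\<^sub>M prior)"
proof -
  have sets: "sets (obs_space \<Otimes>\<^sub>M prior) = sets (obs_space \<Otimes>\<^sub>M (borel :: l2 measure))"
    by (intro sets_pair_measure_cong) (simp_all add: prior_def)
  have s: "(\<lambda>p. \<Sum>i\<in>{i \<in> I. fst i \<le> L}. coef \<psi> (snd p) i * fst p i) \<in>
      borel_measurable (obs_space \<Otimes>\<^sub>M (borel :: l2 measure))" for L
  proof (intro borel_measurable_sum borel_measurable_times)
    fix i assume "i \<in> {i \<in> I. fst i \<le> L}"
    then have "i \<in> I" by simp
    then show "(\<lambda>p. fst p i) \<in> borel_measurable (obs_space \<Otimes>\<^sub>M (borel :: l2 measure))"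
      by (intro measurable_compose[OF measurable_fst measurable_component_singleton])
    show "(\<lambda>p. coef \<psi> (snd p) i) \<in> borel_measurable (obs_space \<Otimes>\<^sub>M (borel :: l2 measure))"
      by (rule measurable_compose[OF measurable_snd measurable_coef])
  qed
  show ?thesis
    unfolding measurable_cong_sets[OF sets refl] likelihood_def obs_pairing_def case_prod_beta
    by (intro borel_measurable_exp[THEN measurable_compose[rotated]] borel_measurable_diff
      borel_measurable_times borel_measurable_const borel_measurable_lim_metric s borel_measurable_power
      borel_measurable_norm[THEN measurable_compose[rotated]] measurable_snd)
qed

text \<open>Rewritten as an integral against the fixed prior with a jointly measurable real density,
  the mean is measurable as a parameter integral.\<close>

lemma posterior_mean_measurable:
  "(\<lambda>X. posterior_mean J0 \<psi> prior n X) \<in> borel_measurable obs_space"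
proof -
  interpret prob_space prior by (rule prob_space_prior)
  let ?E = "\<lambda>X. \<integral>\<^sup>+g. ennreal (likelihood J0 \<psi> n X g) \<partial>prior"
  \<comment> \<open>Passing to reals loses nothing: the evidence is never 0, so the quotient is
    finite, and for exceptional data with infinite evidence it is 0.\<close>
  define r where "r X f = enn2real (ennreal (likelihood J0 \<psi> n X f) / ?E X)" for X f
  note L = likelihood_joint_measurable[of n]
  have Lm: "(\<lambda>p. ennreal (likelihood J0 \<psi> n (fst p) (snd p))) \<in> borel_measurable (obs_space \<Otimes>\<^sub>M prior)"
    using L by (intro measurable_compose[OF _ measurable_ennreal]) (simp add: case_prod_beta)
  have Em: "?E \<in> borel_measurable obs_space"
    by (rule borel_measurable_nn_integral) (use Lm in \<open>simp add: case_prod_beta\<close>)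
  have rm: "(\<lambda>p. r (fst p) (snd p)) \<in> borel_measurable (obs_space \<Otimes>\<^sub>M prior)"
    unfolding r_def
    by (intro borel_measurable_enn2real borel_measurable_divide_ennreal Lm
      measurable_compose[OF measurable_fst Em])
  have "posterior_mean J0 \<psi> prior n X = (LINT f|prior. r X f *\<^sub>R f)" if X: "X \<in> space obs_space" for X
  proof -
    have lX: "likelihood J0 \<psi> n X \<in> borel_measurable prior"
      using measurable_compose[OF measurable_Pair1'[OF X] L] by simp
    have "?E X \<noteq> 0"
    proof
      assume "?E X = 0"
      then have "AE f in prior. ennreal (likelihood J0 \<psi> n X f) = 0"
        by (subst (asm) nn_integral_0_iff_AE) (use lX in auto)
      then have "AE f in prior. False" by eventually_elim (simp add: likelihood_def)
      then show False by simp
    qed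
    then have "ennreal (likelihood J0 \<psi> n X f) / ?E X = ennreal (r X f)" for f
      unfolding r_def by (subst ennreal_enn2real) (auto simp: less_top[symmetric] ennreal_divide_eq_top_iff)
    then have post: "posterior J0 \<psi> prior n X = density prior (\<lambda>f. ennreal (r X f))"
      by (simp add: posterior_def)
    have rX: "r X \<in> borel_measurable prior"
      using measurable_compose[OF measurable_Pair1'[OF X] rm] by simp
    show ?thesis
      unfolding posterior_mean_def post
    proof (rule integral_density[OF _ rX])
      show "(\<lambda>f. f) \<in> borel_measurable prior" by (simp add: prior_def)
      show "AE f in prior. 0 \<le> r X f" by (simp add: r_def)
    qed
  qed
  moreover have "(\<lambda>X. LINT f|prior. r X f *\<^sub>R f) \<in> borel_measurable obs_space"
  proof (rule borel_measurable_lebesgue_integral)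
    have "(\<lambda>p. snd p) \<in> borel_measurable (obs_space \<Otimes>\<^sub>M prior)"
      by (rule measurable_compose[OF measurable_snd]) (simp add: prior_def)
    then show "(\<lambda>(X, f). r X f *\<^sub>R f) \<in> borel_measurable (obs_space \<Otimes>\<^sub>M prior)"
      unfolding case_prod_beta by (intro borel_measurable_scaleR rm)
  qed
  ultimately show ?thesis by (subst measurable_cong) auto
qed

section \<open>The diameter: smoothness against the weak norm\<close>

lemma C_space_coef_le:
  assumes g: "g \<in> C_space J0 \<psi> \<gamma>" and i: "i \<in> I"
  shows "\<bar>coef \<psi> g i\<bar> \<le> decay i * C_norm J0 \<psi> \<gamma> g"
proof -
  let ?h = "\<lambda>(l, k). 2 powr (real l * (\<gamma> + 1 / 2)) * \<bar>coef \<psi> g (l, k)\<bar>"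
  have h: "?h i = \<bar>coef \<psi> g i\<bar> / decay i"
    by (simp only: decay_inverse divide_inverse inverse_inverse_eq mult.commute case_prod_beta' prod.collapse)
  have "?h i \<le> (SUP i\<in>I. ?h i)"
    by (rule cSUP_upper[OF i]) (use g in \<open>simp add: C_space_def\<close>)
  then show ?thesis using decay_pos[of i] unfolding h C_norm_def by (simp add: divide_le_eq mult.commute)
qed

lemma dispersion_diff_le: "dispersion n (g - h) \<le> 2 * dispersion n g + 2 * dispersion n h"
proof -
  let ?t = "\<lambda>f i. weight i * (sqrt (real n) * coef \<psi> f i)\<^sup>2"
  have "dispersion n (g - h) \<le> (\<Sum>\<^sub>\<infinity>i\<in>I. 2 * ?t g i + 2 * ?t h i)"
    unfolding dispersion_def
  proof (rule infsum_mono)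
    show "(\<lambda>i. 2 * ?t g i + 2 * ?t h i) summable_on I"
      by (intro summable_on_add summable_on_cmult_right dispersion_summable)
    fix i
    have "(sqrt (real n) * coef \<psi> (g - h) i)\<^sup>2 \<le> 2 * (sqrt (real n) * coef \<psi> g i)\<^sup>2 + 2 * (sqrt (real n) * coef \<psi> h i)\<^sup>2"
      using sum_squares_bound[of "sqrt (real n) * coef \<psi> g i" "- (sqrt (real n) * coef \<psi> h i)"]
      by (simp add: coef_diff right_diff_distrib power2_diff)
    from mult_left_mono[OF this weight_nonneg[of i]]
    show "?t (g - h) i \<le> 2 * ?t g i + 2 * ?t h i" by (simp add: algebra_simps)
  qed (rule dispersion_summable)
  also have "\<dots> = 2 * dispersion n g + 2 * dispersion n h"
    unfolding dispersion_def
    by (simp add: infsum_add infsum_cmult_right' summable_on_cmult_right dispersion_summable)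
  finally show ?thesis .
qed

lemma card_level_le: "real (card {i \<in> I. fst i = l}) \<le> 2 * 2 ^ l"
proof -
  have "{i \<in> I. fst i = l} \<subseteq> {l} \<times> {..<2 * 2 ^ l}"
    using cdv_index_subset[OF J0_ge1] by fastforce
  then have "card {i \<in> I. fst i = l} \<le> card ({l} \<times> {..<(2::nat) * 2 ^ l})"
    by (rule card_mono[rotated]) simp
  then have "real (card {i \<in> I. fst i = l}) \<le> real (2 * 2 ^ l)"
    by (subst of_nat_le_iff) (simp add: card_cartesian_product)
  then show ?thesis by simp
qed

text \<open>A level has at most 2 * 2^l indices, each contributing 2^(-l(1+2\<gamma>)), hence at
  most 2 x^l with x = 2^(-2\<gamma>); the rest is a geometric tail.\<close>

lemma decay_sq_tail:
  "(\<Sum>\<^sub>\<infinity>i\<in>I - upto_level J0 L. (decay i)\<^sup>2) \<le> 2 / (1 - 2 powr (- (2 * \<gamma>))) * (2 powr (- (2 * \<gamma>))) ^ L"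
proof (rule infsum_le_finite_sums)
  let ?x = "2 powr (- (2 * \<gamma>)) :: real"
  let ?s = "\<lambda>i. if fst i > L then (decay i)\<^sup>2 else 0"
  let ?b = "\<lambda>l. if l > L then 2 powr (- (real l * (1 + 2 * \<gamma>))) else 0"
  let ?lev = "\<lambda>l. {i \<in> I. fst i = l}"
  have x: "0 < ?x" "?x < 1" using gamma powr_less_mono[of "- (2 * \<gamma>)" 0 2] by auto
  show "(\<lambda>i. (decay i)\<^sup>2) summable_on (I - upto_level J0 L)"
    by (rule summable_on_subset_banach[OF decay_sq_summable]) auto
  fix X assume X: "finite X" "X \<subseteq> I - upto_level J0 L"
  define m where "m = Max (fst ` X)"
  have "X \<subseteq> upto_level J0 m"
  proof
    fix i assume i: "i \<in> X"
    then have "fst i \<le> m" unfolding m_def using X by (intro Max_ge) auto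
    then show "i \<in> upto_level J0 m" using i X by (auto simp: upto_level_def)
  qed
  then have "(\<Sum>i\<in>X. (decay i)\<^sup>2) = (\<Sum>i\<in>X. ?s i)"
    using X by (intro sum.cong) (auto simp: upto_level_def)
  also have "\<dots> \<le> (\<Sum>i\<in>upto_level J0 m. ?s i)"
    by (rule sum_mono2[OF finite_upto_level[OF J0_ge1] \<open>X \<subseteq> upto_level J0 m\<close>]) simp
  also have "\<dots> = (\<Sum>l\<le>m. \<Sum>i\<in>?lev l. ?s i)"
    by (rule sum_upto_level[OF J0_ge1])
  also have "\<dots> \<le> (\<Sum>l\<le>m. if l > L then 2 * ?x ^ l else 0)"
  proof (rule sum_mono)
    fix l
    have "(\<Sum>i\<in>?lev l. ?s i) =
        (\<Sum>i\<in>?lev l. ?b l)"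
      by (intro sum.cong) (auto simp: decay_sq)
    also have "\<dots> = real (card (?lev l)) * ?b l"
      by simp
    also have "\<dots> \<le> (2 * 2 ^ l) * ?b l"
      by (rule mult_right_mono[OF card_level_le]) simp
    also have "\<dots> = (if l > L then 2 * ?x ^ l else 0)"
    proof -
      have "2 ^ l * 2 powr (- (real l * (1 + 2 * \<gamma>))) = ?x ^ l"
        by (simp add: powr_realpow[symmetric] powr_add[symmetric] powr_powr algebra_simps)
      then show ?thesis by simp
    qed
    finally show "(\<Sum>i\<in>?lev l. ?s i) \<le> (if l > L then 2 * ?x ^ l else 0)" .
  qed
  \<comment> \<open>The level L itself is added to the tail, so that the shifted geometric sum
    starts with \<open>?x ^ L\<close>.\<close>
  also have "\<dots> \<le> (\<Sum>l<L + Suc m. if l \<ge> L then 2 * ?x ^ l else 0)"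
    by (rule order_trans[OF sum_mono sum_mono2]) (use x in auto)
  also have "\<dots> = (\<Sum>l\<in>{L..<L + Suc m}. 2 * ?x ^ l)"
    by (rule sum.mono_neutral_cong_right) auto
  also have "\<dots> = (\<Sum>k<Suc m. 2 * ?x ^ L * ?x ^ k)"
    using sum.shift_bounds_nat_ivl[of "\<lambda>l. 2 * ?x ^ l" 0 L "Suc m"]
    by (simp add: atLeast0LessThan power_add mult_ac add.commute)
  also have "\<dots> \<le> 2 * ?x ^ L * (1 / (1 - ?x))"
  proof -
    have "(\<Sum>k<Suc m. ?x ^ k) \<le> (\<Sum>k. ?x ^ k)"
      by (rule sum_le_suminf) (use x in \<open>auto intro: summable_geometric\<close>)
    then have "(\<Sum>k<Suc m. ?x ^ k) \<le> 1 / (1 - ?x)" using suminf_geometric[of ?x] x by simp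
    then show ?thesis unfolding sum_distrib_left[symmetric] by (rule mult_left_mono) simp
  qed
  finally show "(\<Sum>i\<in>X. (decay i)\<^sup>2) \<le> 2 / (1 - ?x) * ?x ^ L" by (simp add: mult_ac)
qed

text \<open>Up to level L the weak norm controls the L2 norm at the price of the inverse weight; above L the
  smoothness bound is used.\<close>

lemma norm_le_interpolation:
  assumes n: "n \<ge> 1" and smooth: "\<And>i. i \<in> I \<Longrightarrow> \<bar>coef \<psi> d i\<bar> \<le> B * decay i"
  shows "(norm d)\<^sup>2 \<le> 2 ^ L * (real L * ln 2) powr (2 * \<delta>) * dispersion n d / real n +
    B\<^sup>2 * (2 / (1 - 2 powr (- (2 * \<gamma>))) * (2 powr (- (2 * \<gamma>))) ^ L)"
proof -
  let ?a = "2 ^ L * (real L * ln 2) powr (2 * \<delta>)"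
  let ?tail = "2 / (1 - 2 powr (- (2 * \<gamma>))) * (2 powr (- (2 * \<gamma>))) ^ L"
  let ?t = "\<lambda>i. weight i * (sqrt (real n) * coef \<psi> d i)\<^sup>2"
  let ?c = "\<lambda>i. (coef \<psi> d i)\<^sup>2"
  let ?F = "upto_level J0 L"
  have F: "finite ?F" "?F \<subseteq> I" using finite_upto_level[OF J0_ge1] by (auto simp: upto_level_def)
  have "(norm d)\<^sup>2 = (\<Sum>\<^sub>\<infinity>i\<in>I. ?c i)"
    using infsumI[OF parseval[OF onb, of d]] by (simp add: coef_def)
  also have "\<dots> = (\<Sum>i\<in>?F. ?c i) + (\<Sum>\<^sub>\<infinity>i\<in>I - ?F. ?c i)"
    by (rule infsum_split_finite[OF coef_sq_summable F])
  also have "(\<Sum>i\<in>?F. ?c i) \<le> ?a * dispersion n d / real n"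
  proof -
    have "(\<Sum>i\<in>?F. ?c i) \<le>
        (\<Sum>i\<in>?F. ?a / real n * ?t i)"
    proof (rule sum_mono)
      fix i assume "i \<in> ?F"
      then have i: "i \<in> I" "fst i \<le> L" by (auto simp: upto_level_def)
      then have l: "1 \<le> fst i" using cdv_index_level_pos[OF J0] by auto
      have "(2::real) ^ fst i > 1" using l by (intro one_less_power) auto
      then have "1 = 2 ^ fst i * ln (2 ^ fst i) powr (2 * \<delta>) * weight i"
        by (simp add: weight_def powr_minus field_simps)
      also have "\<dots> \<le> ?a * weight i"
        using i l delta
        by (intro mult_right_mono mult_mono power_increasing powr_mono2 weight_nonneg) (auto simp: ln_realpow)
      finally have "1 * ?c i \<le> ?a * weight i * ?c i"
        by (rule mult_right_mono) simp
      also have "\<dots> = ?a / real n * ?t i"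
        using n by (simp add: power_mult_distrib)
      finally show "?c i \<le> ?a / real n * ?t i"
        by simp
    qed
    also have "\<dots> = ?a / real n * (\<Sum>i\<in>?F. weight i * (sqrt (real n) * coef \<psi> d i)\<^sup>2)"
      by (rule sum_distrib_left[symmetric])
    also have "\<dots> \<le> ?a / real n * dispersion n d"
      unfolding dispersion_def
      by (intro mult_left_mono finite_sum_le_infsum[OF dispersion_summable F]) (auto simp: weight_nonneg)
    finally show ?thesis by simp
  qed
  also have "(\<Sum>\<^sub>\<infinity>i\<in>I - ?F. ?c i) \<le> B\<^sup>2 * ?tail"
  proof -
    have "(\<Sum>\<^sub>\<infinity>i\<in>I - ?F. ?c i) \<le> (\<Sum>\<^sub>\<infinity>i\<in>I - ?F. B\<^sup>2 * (decay i)\<^sup>2)"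
    proof (rule infsum_mono)
      show "(\<lambda>i. ?c i) summable_on (I - ?F)"
        by (rule summable_on_subset_banach[OF coef_sq_summable]) auto
      show "(\<lambda>i. B\<^sup>2 * (decay i)\<^sup>2) summable_on (I - ?F)"
        by (rule summable_on_subset_banach[OF summable_on_cmult_right[OF decay_sq_summable]]) auto
      fix i assume "i \<in> I - ?F"
      then have "\<bar>coef \<psi> d i\<bar>\<^sup>2 \<le> (B * decay i)\<^sup>2" using smooth[of i] by (intro power_mono) auto
      then show "?c i \<le> B\<^sup>2 * (decay i)\<^sup>2" by (simp add: power_mult_distrib)
    qed
    also have "\<dots> = B\<^sup>2 * (\<Sum>\<^sub>\<infinity>i\<in>I - ?F. (decay i)\<^sup>2)" by (rule infsum_cmult_right')
    also have "\<dots> \<le> B\<^sup>2 * ?tail"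
      by (intro mult_left_mono decay_sq_tail) simp
    finally show ?thesis .
  qed
  finally show ?thesis by simp
qed

text \<open>For 2^L of order n^(1/(2\<gamma>+1)) both 2^L/n and 2^(-2\<gamma>L) have order
  n^(-2\<gamma>/(2\<gamma>+1)). The logarithm stems from the inverse weight at level L.\<close>

lemma norm_le_rate:
  assumes n: "n \<ge> 3" and smooth: "\<And>i. i \<in> I \<Longrightarrow> \<bar>coef \<psi> d i\<bar> \<le> B * decay i"
    and disp: "dispersion n d \<le> Q"
  shows "norm d \<le> sqrt (Q + B\<^sup>2 * (2 / (1 - 2 powr (- (2 * \<gamma>)))) * 2 powr (2 * \<gamma>)) *
    (real n powr (- \<gamma> / (2 * \<gamma> + 1)) * ln (real n) powr \<delta>)"
proof -
  define a where "a = 1 / (2 * \<gamma> + 1)"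
  have a: "0 < a" "a \<le> 1" using gamma by (auto simp: a_def)
  \<comment> \<open>Rounding down gives 2^L \<le> n^a \<le> 2 * 2^L; the lost factor 2 produces the
    constant \<open>2 powr (2 * \<gamma>)\<close>.\<close>
  define L where "L = nat \<lfloor>log 2 (real n powr a)\<rfloor>"
  have Q0: "Q \<ge> 0" using dispersion_nonneg[of n d] disp by linarith
  have n0: "real n > 0" "real n \<ge> 1" using n by auto
  \<comment> \<open>Here n \<ge> 3 > e enters: the logarithmic factor is at least 1 and may also be
    attached to the term from the high levels.\<close>
  have ln1: "ln (real n) \<ge> 1"
  proof -
    have "exp 1 \<le> (3::real)" by (rule exp_le)
    then have "exp 1 \<le> real n" using n by linarith
    then show ?thesis using n0 by (simp add: ln_ge_iff)
  qed
  have p1: "real n powr a \<ge> 1" using n0 a by (simp add: ge_one_powr_ge_zero)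
  then have log0: "log 2 (real n powr a) \<ge> 0"
    using n0 by (subst zero_le_log_cancel_iff) auto
  have Lle: "real L \<le> log 2 (real n powr a)" and Lgt: "log 2 (real n powr a) < real L + 1"
    using log0 by (simp_all add: L_def)
  have plog: "2 powr log 2 (real n powr a) = real n powr a"
    by (rule powr_log_cancel) (use n0 in auto)
  have pow_le: "2 ^ L \<le> real n powr a"
  proof -
    have "2 powr real L \<le> 2 powr log 2 (real n powr a)" using Lle by (intro powr_mono) auto
    then show ?thesis by (simp only: plog) (simp add: powr_realpow)
  qed
  have pow_ge: "real n powr a \<le> 2 * 2 ^ L"
  proof -
    have "2 powr log 2 (real n powr a) \<le> 2 powr (real L + 1)" using Lgt by (intro powr_mono) auto
    then show ?thesis by (simp only: plog) (simp add: powr_realpow powr_add mult.commute)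
  qed
  have Lln: "real L * ln 2 \<le> ln (real n)"
  proof -
    have "real L * ln 2 \<le> log 2 (real n powr a) * ln 2" using Lle by (intro mult_right_mono) auto
    also have "\<dots> = a * ln (real n)" using n0 by (simp add: log_def ln_powr)
    also have "\<dots> \<le> ln (real n)" using a ln1 by (simp add: mult_le_cancel_right1)
    finally show ?thesis .
  qed
  let ?r = "real n powr (2 * (- \<gamma> / (2 * \<gamma> + 1)))" and ?l = "ln (real n) powr (2 * \<delta>)"
  let ?D = "2 / (1 - 2 powr (- (2 * \<gamma>))) :: real"
  have D0: "?D \<ge> 0" using gamma powr_less_mono[of "- (2 * \<gamma>)" 0 2] by simp
  have l1: "?l \<ge> 1" using ln1 delta by (simp add: ge_one_powr_ge_zero)
  have one: "2 ^ L * (real L * ln 2) powr (2 * \<delta>) * dispersion n d / real n \<le> ?r * ?l * Q"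
  proof -
    have "2 ^ L / real n \<le> real n powr a / real n" using pow_le n0 by (intro divide_right_mono) auto
    also have "\<dots> = real n powr (a - 1)" using n0 by (simp add: powr_diff)
    also have "a - 1 = 2 * (- \<gamma> / (2 * \<gamma> + 1))" using gamma by (simp add: a_def field_simps)
    finally have c: "2 ^ L / real n \<le> ?r" .
    have "(real L * ln 2) powr (2 * \<delta>) \<le> ?l" using Lln delta by (intro powr_mono2) auto
    with c have "2 ^ L / real n * (real L * ln 2) powr (2 * \<delta>) * dispersion n d \<le> ?r * ?l * Q"
      using disp dispersion_nonneg[of n d] by (intro mult_mono) auto
    then show ?thesis by simp
  qed
  have two: "B\<^sup>2 * (?D * (2 powr (- (2 * \<gamma>))) ^ L) \<le> ?r * ?l * (B\<^sup>2 * ?D * 2 powr (2 * \<gamma>))"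
  proof -
    have "(2 powr (- (2 * \<gamma>))) ^ L = (2 ^ L) powr (- (2 * \<gamma>))"
      by (simp add: powr_realpow[symmetric] powr_powr mult.commute)
    also have "\<dots> \<le> (real n powr a / 2) powr (- (2 * \<gamma>))"
      using pow_ge p1 gamma n0 by (intro powr_mono2') auto
    also have "\<dots> = 2 powr (2 * \<gamma>) * (real n powr a) powr (- (2 * \<gamma>))"
      by (simp add: powr_divide powr_minus field_simps)
    also have "(real n powr a) powr (- (2 * \<gamma>)) = ?r"
      by (simp add: powr_powr a_def)
    finally have "(2 powr (- (2 * \<gamma>))) ^ L \<le> 2 powr (2 * \<gamma>) * ?r * 1" by simp
    also have "\<dots> \<le> 2 powr (2 * \<gamma>) * ?r * ?l" by (intro mult_left_mono l1) auto
    finally have "B\<^sup>2 * ?D * (2 powr (- (2 * \<gamma>))) ^ L \<le> B\<^sup>2 * ?D * (2 powr (2 * \<gamma>) * ?r * ?l)"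
      using D0 by (intro mult_left_mono mult_nonneg_nonneg) auto
    then show ?thesis by (simp only: mult_ac)
  qed
  have "(norm d)\<^sup>2 \<le> ?r * ?l * (Q + B\<^sup>2 * ?D * 2 powr (2 * \<gamma>))"
    using norm_le_interpolation[of n d B L] smooth n one two by (simp add: distrib_left)
  then have "sqrt ((norm d)\<^sup>2) \<le> sqrt (?r * ?l * (Q + B\<^sup>2 * ?D * 2 powr (2 * \<gamma>)))"
    by (rule real_sqrt_le_mono)
  also have "\<dots> = sqrt (Q + B\<^sup>2 * ?D * 2 powr (2 * \<gamma>)) * (sqrt ?r * sqrt ?l)"
    by (simp add: real_sqrt_mult mult.commute)
  also have "sqrt ?r = real n powr (- \<gamma> / (2 * \<gamma> + 1))"
    by (rule real_sqrt_unique) (simp_all add: powr_powr[symmetric] power2_eq_square powr_add[symmetric])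
  also have "sqrt ?l = ln (real n) powr \<delta>"
    by (rule real_sqrt_unique) (simp_all add: power2_eq_square powr_add[symmetric])
  finally show ?thesis by simp
qed

end

section \<open>The credible radius\<close>

context wavelet_posterior
begin

lemma dispersion_post_measurable: "(\<lambda>f. dispersion n (f - mean)) \<in> borel_measurable post"
  unfolding measurable_cong_sets[OF sets_post refl]
  by (rule measurable_compose[OF _ dispersion_measurable]) measurable

text \<open>Chebyshev's inequality bounds the credible radius uniformly in the data, because every
  coordinate of the posterior has variance at most 1/n.\<close>

lemma credible_radius:
  assumes alpha: "0 < \<alpha>" "\<alpha> < 1"
    and r: "measure post (H_ball J0 \<psi> \<delta> mean (r / sqrt (real n))) = 1 - \<alpha>"
  shows "0 \<le> r" "r\<^sup>2 \<le> (\<Sum>\<^sub>\<infinity>i\<in>I. weight i) / \<alpha>"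
    and "cdf (distr post borel (\<lambda>f. dispersion n (f - mean))) (r\<^sup>2) = 1 - \<alpha>"
proof -
  interpret P: prob_space post by (rule prob_space_post)
  note dm[measurable] = dispersion_post_measurable
  have ball: "H_ball J0 \<psi> \<delta> mean (r / sqrt (real n)) = {f. 0 \<le> r \<and> dispersion n (f - mean) \<le> r\<^sup>2}"
    unfolding H_ball_def using H_norm_le_iff[OF n] by auto
  show r0: "0 \<le> r"
  proof (rule ccontr)
    assume "\<not> 0 \<le> r"
    then have "H_ball J0 \<psi> \<delta> mean (r / sqrt (real n)) = {}" unfolding ball by auto
    then show False using r alpha by simp
  qed
  have le: "measure post {f \<in> space post. dispersion n (f - mean) \<le> r\<^sup>2} = 1 - \<alpha>"
    using r unfolding ball by (simp add: r0 space_post)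
  have "cdf (distr post borel (\<lambda>f. dispersion n (f - mean))) (r\<^sup>2) =
      measure post {f \<in> space post. dispersion n (f - mean) \<le> r\<^sup>2}"
    unfolding cdf_def by (subst measure_distr[OF dm]) (auto intro!: arg_cong[where f="measure post"])
  with le show "cdf (distr post borel (\<lambda>f. dispersion n (f - mean))) (r\<^sup>2) = 1 - \<alpha>" by simp
  let ?A = "{f \<in> space post. \<not> dispersion n (f - mean) \<le> r\<^sup>2}"
  have A: "measure post ?A = \<alpha>"
    using P.prob_neg[of "\<lambda>f. dispersion n (f - mean) \<le> r\<^sup>2"] le by simp
  \<comment> \<open>Markov's inequality for the dispersion, used on the complement of the ball,
    whose posterior probability is exactly \<alpha>.\<close>
  have "ennreal (r\<^sup>2 * \<alpha>) = ennreal (r\<^sup>2) * emeasure post ?A"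
    using A alpha by (simp add: P.emeasure_eq_measure ennreal_mult')
  also have "\<dots> = (\<integral>\<^sup>+f. ennreal (r\<^sup>2) * indicator ?A f \<partial>post)"
    by (rule nn_integral_cmult_indicator[symmetric]) measurable
  also have "\<dots> \<le> (\<integral>\<^sup>+f. ennreal (dispersion n (f - mean)) \<partial>post)"
    by (rule nn_integral_mono) (auto simp: indicator_def intro!: ennreal_leI)
  also have "\<dots> \<le> ennreal (\<Sum>\<^sub>\<infinity>i\<in>I. weight i)"
    using nn_integral_tail_le[of I] by (simp add: dispersion_def)
  finally have "r\<^sup>2 * \<alpha> \<le> (\<Sum>\<^sub>\<infinity>i\<in>I. weight i)"
    by (subst (asm) ennreal_le_iff) (auto intro!: infsum_nonneg weight_nonneg)
  then show "r\<^sup>2 \<le> (\<Sum>\<^sub>\<infinity>i\<in>I. weight i) / \<alpha>" using alpha by (simp add: le_divide_eq)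
qed

end

theorem corollary1:
  fixes S J0 :: nat and \<psi> :: "nat \<Rightarrow> nat \<Rightarrow> real \<Rightarrow> real"
    and \<gamma> M \<alpha> \<delta> :: real and f0 :: l2
    and prior :: "l2 measure" and P :: "nat \<Rightarrow> (nat \<times> nat \<Rightarrow> real) measure"
    and fbar :: "nat \<Rightarrow> (nat \<times> nat \<Rightarrow> real) \<Rightarrow> l2"
    and R :: "nat \<Rightarrow> (nat \<times> nat \<Rightarrow> real) \<Rightarrow> real"
    and C' :: "nat \<Rightarrow> (nat \<times> nat \<Rightarrow> real) \<Rightarrow> l2 set"
  assumes "\<gamma> > 0" and "M > 0" and "0 < \<alpha>" and "\<alpha> < 1" and "\<delta> > 1 / 2"
    and "J0 \<ge> 2" and "cdv_basis S J0 \<psi>" and "real S > max \<gamma> (1 / 2)"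
    and "f0 \<in> C_space J0 \<psi> \<gamma>" and "C_norm J0 \<psi> \<gamma> f0 < M"
    and "prior = uniform_wavelet_prior J0 \<psi> \<gamma> M"
    and "\<And>n. P n = obs_law J0 \<psi> n f0"
    and "\<And>n X. fbar n X = posterior_mean J0 \<psi> prior n X"
    and "\<And>n. n \<ge> 1 \<Longrightarrow> R n \<in> borel_measurable (P n)"
    and "\<And>n. n \<ge> 1 \<Longrightarrow> AE X in P n.
      measure (posterior J0 \<psi> prior n X) (H_ball J0 \<psi> \<delta> (fbar n X) (R n X / sqrt (real n))) = 1 - \<alpha>"
    and "\<And>n X. C' n X = credible_set J0 \<psi> \<gamma> M \<delta> (fbar n X) (R n X / sqrt (real n))"
  shows "(\<lambda>n. measure (P n) {X \<in> space (P n). f0 \<in> C' n X}) \<longlonglongrightarrow> 1 - \<alpha> \<and>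
    (\<exists>\<kappa>>0. bigO_P P (\<lambda>n X. diameter (C' n X))
      (\<lambda>n. real n powr (- \<gamma> / (2 * \<gamma> + 1)) * ln (real n) powr \<kappa>))"
proof
  interpret wavelet_prior J0 \<psi> \<gamma> M \<delta>
    using assms(1,2,5,6,7) by unfold_locales (auto simp: cdv_basis_def)
  interpret G: prob_space gauss by (rule prob_space_gauss)
  note prior_eq = assms(11)[unfolded uniform_wavelet_prior_eq]
  let ?W = "\<Sum>\<^sub>\<infinity>i\<in>I. weight i"
  let ?X = "obs_map f0"
  let ?F = "\<lambda>n z. cdf (distr (posterior J0 \<psi> prior n (?X n z)) borel (\<lambda>f. dispersion n (f - fbar n (?X n z))))"
  let ?T = "\<lambda>n z. dispersion n (f0 - fbar n (?X n z))"
  let ?cover = "\<lambda>n. {z \<in> space gauss. f0 \<in> C' n (?X n z)}"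
  let ?ball = "\<lambda>n z. measure (posterior J0 \<psi> prior n (?X n z)) (H_ball J0 \<psi> \<delta> (fbar n (?X n z)) (R n (?X n z) / sqrt (real n))) = 1 - \<alpha>"
  have P: "P n = distr gauss obs_space (?X n)" for n
    unfolding assms(12) obs_law_eq ..
  have sP: "space (P n) = space obs_space" "sets (P n) = sets obs_space" for n
    by (simp_all add: P)
  have R: "R n \<in> borel_measurable obs_space" if "n \<ge> 1" for n
    using assms(14)[OF that] unfolding measurable_cong_sets[OF sP(2) refl] .
  \<comment> \<open>The truth satisfies the smoothness constraint by assumption, so coverage is
    decided by the weak ball alone.\<close>
  have mem_f0: "f0 \<in> C' n X \<longleftrightarrow> 0 \<le> R n X \<and> dispersion n (f0 - fbar n X) \<le> (R n X)\<^sup>2"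
    if "n \<ge> 1" for n X
    using assms(9,10) unfolding assms(16) credible_set_def H_ball_def by (auto simp: H_norm_le_iff[OF that])
  have path: "AE z in gauss. wavelet_path J0 \<psi> \<gamma> M \<delta> f0 z"
    using AE_obs_noise AE_weight_noise
  proof eventually_elim
    case (elim z)
    have "\<bar>coef \<psi> f0 i\<bar> < decay i * M" if "i \<in> I" for i
      using C_space_coef_le[OF assms(9) that] mult_strict_left_mono[OF assms(10) decay_pos[of i]]
      by linarith
    with elim show ?case
      by (intro wavelet_path.intro wavelet_path_axioms.intro) (unfold_locales, auto)
  qed
  have obs_eq: "wavelet_path.obs J0 \<psi> f0 z n = ?X n z" if "wavelet_path J0 \<psi> \<gamma> M \<delta> f0 z" for z n
    using wavelet_path.obs_def[OF that] by (simp add: obs_map_def)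
  \<comment> \<open>The radius condition is given for each n separately; the countably many null
    sets are merged so that it holds along a whole path.\<close>
  have "AE z in gauss. \<forall>n. n \<ge> 1 \<longrightarrow>
      ?ball n z"
    unfolding AE_all_countable
  proof (intro allI)
    fix n :: nat
    show "AE z in gauss. n \<ge> 1 \<longrightarrow>
        ?ball n z"
    proof (cases "n \<ge> 1")
      case True
      from AE_distrD[OF obs_map_measurable assms(15)[OF True, unfolded P]] show ?thesis by simp
    qed simp
  qed
  with path have radius: "AE z in gauss. \<forall>n\<ge>1. 0 \<le> R n (?X n z) \<and> (R n (?X n z))\<^sup>2 \<le> ?W / \<alpha> \<and>
      ?F n z ((R n (?X n z))\<^sup>2) = 1 - \<alpha>"
  proof eventually_elim
    case (elim z)
    show ?case
    proof (intro allI impI)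
      fix n :: nat assume n: "n \<ge> 1"
      interpret W: wavelet_posterior J0 \<psi> \<gamma> M \<delta> n "?X n z"
        using wavelet_path.posterior_locale[OF elim(1) n] unfolding obs_eq[OF elim(1)] .
      from W.credible_radius[OF assms(3,4), of "R n (?X n z)"] elim(2) n
      show "0 \<le> R n (?X n z) \<and> (R n (?X n z))\<^sup>2 \<le> ?W / \<alpha> \<and>
          ?F n z ((R n (?X n z))\<^sup>2) = 1 - \<alpha>"
        unfolding assms(13) prior_eq by blast
    qed
  qed
  have cover_sets: "{X \<in> space obs_space. f0 \<in> C' n X} \<in> sets obs_space" if n: "n \<ge> 1" for n
  proof -
    have d: "(\<lambda>X. dispersion n (f0 - fbar n X)) \<in> borel_measurable obs_space"
      unfolding assms(13) prior_eq
      by (intro measurable_compose[OF _ dispersion_measurable] borel_measurable_diff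
        borel_measurable_const posterior_mean_measurable)
    have "{X \<in> space obs_space. 0 \<le> R n X \<and> dispersion n (f0 - fbar n X) \<le> (R n X)\<^sup>2} \<in> sets obs_space"
      by (intro sets.sets_Collect_conj borel_measurable_le d R[OF n] borel_measurable_power borel_measurable_const)
    then show ?thesis by (simp only: mem_f0[OF n])
  qed

  have "(\<lambda>n. measure gauss (?cover n)) \<longlonglongrightarrow> 1 - \<alpha>"
  proof (rule coverage_limit[OF prob_space_gauss limit_stat_measurable isCont_cdf_limit_stat,
      where T="?T" and \<rho>="\<lambda>n z. (R n (?X n z))\<^sup>2"
        and Fn="?F"])
    show "0 < 1 - \<alpha>" "1 - \<alpha> < 1" using assms(3,4) by auto
    show "AE z in gauss. (\<lambda>n. ?T n z) \<longlonglongrightarrow> limit_stat z"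
      using path
    proof eventually_elim
      case (elim z)
      from wavelet_path.dispersion_truth_lim[OF elim, unfolded obs_eq[OF elim]] show ?case
        unfolding assms(13) prior_eq limit_stat_def .
    qed
    show "AE z in gauss. \<forall>x. (\<lambda>n. ?F n z x) \<longlonglongrightarrow> cdf (distr gauss borel limit_stat) x"
      using path
    proof eventually_elim
      case (elim z)
      from wavelet_path.dispersion_weak_lim[OF elim, unfolded obs_eq[OF elim]] show ?case
        unfolding assms(13) prior_eq by (rule allI)
    qed
    show "AE z in gauss. \<forall>n\<ge>1. mono (?F n z)"
      using path
    proof eventually_elim
      case (elim z)
      show ?case
      proof (intro allI impI)
        fix n :: nat assume n: "n \<ge> 1"
        interpret W: wavelet_posterior J0 \<psi> \<gamma> M \<delta> n "?X n z"
          using wavelet_path.posterior_locale[OF elim n] unfolding obs_eq[OF elim] .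
        interpret D: real_distribution "distr W.post borel (\<lambda>f. dispersion n (f - W.mean))"
          by (rule prob_space.real_distribution_distr[OF W.prob_space_post W.dispersion_post_measurable])
        show "mono (?F n z)"
          unfolding assms(13) prior_eq by (intro monoI D.cdf_nondecreasing)
      qed
    qed
    show "AE z in gauss. \<forall>n\<ge>1. ?F n z ((R n (?X n z))\<^sup>2) = 1 - \<alpha>"
      using radius by eventually_elim blast
    show "?cover n \<in> sets gauss" if "n \<ge> 1" for n
    proof -
      have "?X n -` {X \<in> space obs_space. f0 \<in> C' n X} \<inter> space gauss = ?cover n"
        using measurable_space[OF obs_map_measurable[of f0 n]] by auto
      then show ?thesis using measurable_sets[OF obs_map_measurable cover_sets[OF that], of f0 n] by simp
    qed
    show "AE z in gauss. \<forall>n\<ge>1. z \<in> ?cover n \<longleftrightarrow>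
        ?T n z \<le> (R n (?X n z))\<^sup>2"
      using radius AE_space by eventually_elim (auto simp: mem_f0)
  qed
  moreover have "\<forall>\<^sub>F n in sequentially. measure gauss (?cover n) =
      measure (P n) {X \<in> space (P n). f0 \<in> C' n X}"
  proof (rule eventually_sequentiallyI[of 1])
    fix n :: nat assume n: "n \<ge> 1"
    have "?X n -` {X \<in> space obs_space. f0 \<in> C' n X} \<inter> space gauss = ?cover n"
      using measurable_space[OF obs_map_measurable[of f0 n]] by auto
    then show "measure gauss (?cover n) = measure (P n) {X \<in> space (P n). f0 \<in> C' n X}"
      using measure_distr[OF obs_map_measurable cover_sets[OF n], of f0 n] by (simp add: P)
  qed
  ultimately show "(\<lambda>n. measure (P n) {X \<in> space (P n). f0 \<in> C' n X}) \<longlonglongrightarrow> 1 - \<alpha>"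
    by (rule Lim_transform_eventually)

  \<comment> \<open>Two members of the set differ by at most B = 2 M times \<open>decay\<close>, and
    their dispersion is at most Q = 4 W/\<alpha>, with W the sum of the weights: 2 W/\<alpha> for
    the distance of each to the mean.\<close>
  define K where "K = sqrt (4 * (?W / \<alpha>) + (2 * M)\<^sup>2 * (2 / (1 - 2 powr (- (2 * \<gamma>)))) * 2 powr (2 * \<gamma>))"
  have gpos: "1 - 2 powr (- (2 * \<gamma>)) > (0::real)"
    using gamma powr_less_mono[of "- (2 * \<gamma>)" 0 2] by simp
  have W0: "?W \<ge> 0" by (intro infsum_nonneg weight_nonneg)
  have "K > 0"
    unfolding K_def using gpos M_pos W0 assms(3)
    by (intro real_sqrt_gt_zero add_nonneg_pos mult_pos_pos divide_pos_pos) auto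
  \<comment> \<open>The radius bound holds with probability 1, so one K serves every
    \<epsilon>.\<close>
  have "bigO_P P (\<lambda>n X. diameter (C' n X)) (\<lambda>n. real n powr (- \<gamma> / (2 * \<gamma> + 1)) * ln (real n) powr \<delta>)"
    unfolding bigO_P_def
  proof (intro allI impI exI conjI)
    fix \<epsilon> :: real assume "\<epsilon> > 0"
    show "K > 0" by fact
    show "\<forall>\<^sub>F n in sequentially. \<exists>A\<in>sets (P n). measure (P n) A \<ge> 1 - \<epsilon> \<and>
        (\<forall>X\<in>A. \<bar>diameter (C' n X)\<bar> \<le> K * (real n powr (- \<gamma> / (2 * \<gamma> + 1)) * ln (real n) powr \<delta>))"
    proof (rule eventually_sequentiallyI[of 3])
      fix n :: nat assume n3: "n \<ge> 3"
      then have n: "n \<ge> 1" by simp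
      let ?A = "{X \<in> space obs_space. (R n X)\<^sup>2 \<le> ?W / \<alpha>}"
      let ?r = "K * (real n powr (- \<gamma> / (2 * \<gamma> + 1)) * ln (real n) powr \<delta>)"
      note [measurable] = R[OF n]
      have A: "?A \<in> sets obs_space" by measurable
      have "AE X in P n. X \<in> ?A"
        unfolding P using radius n
        by (subst AE_distr_iff[OF obs_map_measurable])
          (use A measurable_space[OF obs_map_measurable] in \<open>auto elim!: eventually_mono\<close>)
      moreover have "prob_space (P n)" unfolding P by (rule G.prob_space_distr[OF obs_map_measurable])
      ultimately have "measure (P n) ?A = 1"
        using prob_space.prob_eq_1[of "P n" ?A] A sP(2) by auto
      moreover have "\<bar>diameter (C' n X)\<bar> \<le> ?r" if X: "X \<in> ?A" for X
      proof -
        have close: "norm (g - h) \<le> ?r" if gh: "g \<in> C' n X" "h \<in> C' n X" for g h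
          unfolding K_def
        proof (rule norm_le_rate[OF n3])
          have C: "f \<in> C_space J0 \<psi> \<gamma>" "C_norm J0 \<psi> \<gamma> f \<le> M" "dispersion n (f - fbar n X) \<le> ?W / \<alpha>"
            if "f \<in> C' n X" for f
            using that X unfolding assms(16) credible_set_def H_ball_def
            by (auto simp: H_norm_le_iff[OF n])
          have small: "\<bar>coef \<psi> f i\<bar> \<le> decay i * M" if "f \<in> C' n X" "i \<in> I" for f i
            using C_space_coef_le[OF C(1)[OF that(1)] that(2)]
              mult_left_mono[OF C(2)[OF that(1)], of "decay i"] decay_pos[of i] by linarith
          show "\<bar>coef \<psi> (g - h) i\<bar> \<le> 2 * M * decay i" if "i \<in> I" for i
          proof -
            have "2 * M * decay i = decay i * M + decay i * M" by simp
            then show ?thesis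
              using small[OF gh(1) that] small[OF gh(2) that]
                abs_triangle_ineq4[of "coef \<psi> g i" "coef \<psi> h i"] unfolding coef_diff by linarith
          qed
          have "dispersion n (g - h) \<le> 2 * dispersion n (g - fbar n X) + 2 * dispersion n (h - fbar n X)"
            using dispersion_diff_le[of n "g - fbar n X" "h - fbar n X"] by simp
          then show "dispersion n (g - h) \<le> 4 * (?W / \<alpha>)"
            using C(3)[OF gh(1)] C(3)[OF gh(2)] by linarith
        qed
        have r0: "?r \<ge> 0" using \<open>K > 0\<close> by simp
        \<comment> \<open>Needed for nonnegativity of \<open>diameter\<close>, since the supremum
          over an unbounded set would be unspecified.\<close>
        have "bounded (C' n X)"
        proof (cases "C' n X = {}")
          case False
          then obtain g where "g \<in> C' n X" by auto
          then show ?thesis using close unfolding bounded_def dist_norm by blast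
        qed simp
        then have "diameter (C' n X) \<ge> 0" by (rule diameter_ge_0)
        moreover have "diameter (C' n X) \<le> ?r"
          by (rule diameter_le) (use r0 close in auto)
        ultimately show ?thesis by simp
      qed
      ultimately show "\<exists>A\<in>sets (P n). measure (P n) A \<ge> 1 - \<epsilon> \<and> (\<forall>X\<in>A. \<bar>diameter (C' n X)\<bar> \<le> ?r)"
        using A sP(2) \<open>\<epsilon> > 0\<close> by (intro bexI[of _ ?A]) auto
    qed
  qed
  then show "\<exists>\<kappa>>0. bigO_P P (\<lambda>n X. diameter (C' n X))
      (\<lambda>n. real n powr (- \<gamma> / (2 * \<gamma> + 1)) * ln (real n) powr \<kappa>)"
    using delta by (intro exI[of _ \<delta>]) auto
qed

end
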